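(* Let $\mathcal{B}$ be a (strict) braided monoidal category, $\mathcal{M}$ a monoidal category, and $F\colon \mathcal{M}\to \mathcal{B}$ a monoidal functor (not necessarily strict) satisfying the higher representability conditions for some object $B\in \mathcal{B}$. Then $B$ is a universal quasi-bialgebra object in $\mathcal{B}$ such that $F$ factors as $\mathcal{M}\to B\text{-}\mathbf{Mod}(\mathcal{B})\to \mathcal{B}$, where the first functor is monoidal and the second is the forgetful functor. Here universal means: if $B'$ is another quasi-bialgebra object in $\mathcal{B}$ with such a factorization of $F$ through $B'\text{-}\mathbf{Mod}(\mathcal{B})$, then there is a unique morphism $B'\to B$ such that the induced pullback functor $B\text{-}\mathbf{Mod}(\mathcal{B})\to B'\text{-}\mathbf{Mod}(\mathcal{B})$ commutes with the functors from $\mathcal{M}$ and the forgetful functors to $\mathcal{B}$.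
   Context: $\mathcal{B}$ has braiding $\Psi$ and unit $I$. Monoidal functors are strong. Higher representability for $B$: the functors $V\mapsto\mathrm{Nat}(V\otimes F^{\otimes n},F^{\otimes n})$, $\mathcal{B}^{\mathrm{op}}\to\mathbf{Set}$, are representable for all $n\geq 0$ by $B^{\otimes n}$ as follows. Here $F^{\otimes n}\colon\mathcal{M}^{n}\to\mathcal{B}$, $(X_1,\dots,X_n)\mapsto F(X_1)\otimes\cdots\otimes F(X_n)$ (for $n=0$ it is the constant functor with value $I$). For $n=1$ there is an isomorphism $\mathrm{Nat}(V\otimes F,F)\cong\mathrm{Hom}_{\mathcal{B}}(V,B)$ natural in $V$; let $\sigma\colon B\otimes F\Rightarrow F$ correspond to $\mathrm{id}_B$. For $\beta\colon V\to B^{\otimes n}$ let $\theta^n_V(\beta)\colon V\otimes F^{\otimes n}\Rightarrow F^{\otimes n}$ be the composite $$V\otimes F(X_1)\otimes\cdots\otimes F(X_n)\xrightarrow{\beta\otimes\mathrm{id}}B^{\otimes n}\otimes F(X_1)\otimes\cdots\otimes F(X_n)\to B\otimes F(X_1)\otimes\cdots\otimes B\otimes F(X_n)\xrightarrow{\sigma_{X_1}\otimes\cdots\otimes\sigma_{X_n}}F(X_1)\otimes\cdots\otimes F(X_n),$$ the middle map being given by the braiding $\Psi$. The condition is that $\beta\mapsto\theta^n_V(\beta)$ is a bijection $\mathrm{Hom}_{\mathcal{B}}(V,B^{\otimes n})\to\mathrm{Nat}(V\otimes F^{\otimes n},F^{\otimes n})$ for all $V$ and all $n\geq0$. A quasi-bialgebra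 object in $\mathcal{B}$ is an algebra $B$ in $\mathcal{B}$ with algebra morphisms $\Delta\colon B\to B\otimes B$, $\varepsilon\colon B\to I$ and an invertible element $\phi\colon I\to B^{\otimes 3}$ such that (products taken in the braided tensor product algebras $B^{\otimes n}$) $(\mathrm{id}\otimes\Delta)\Delta\cdot\phi=\phi\cdot(\Delta\otimes\mathrm{id})\Delta$, $(\varepsilon\otimes\mathrm{id})\Delta=\mathrm{id}=(\mathrm{id}\otimes\varepsilon)\Delta$, $(\mathrm{id}\otimes\varepsilon\otimes\mathrm{id})\phi=1\otimes1$, and the 3-cycle condition $(1\otimes\phi)\cdot(\mathrm{id}\otimes\Delta\otimes\mathrm{id})(\phi)\cdot(\phi\otimes1)=(\mathrm{id}\otimes\mathrm{id}\otimes\Delta)(\phi)\cdot(\Delta\otimes\mathrm{id}\otimes\mathrm{id})(\phi)$. Then the category $B\text{-}\mathbf{Mod}(\mathcal{B})$ of left $B$-modules is monoidal via $\Delta$, with associativity isomorphism given by the action of $\phi$. Morphisms of quasi-bialgebras preserve all of this structure. *)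

theory Defs
  imports "HOL-Library.FuncSet"
begin

record ('o, 'a) cat =
  Obj :: "'o set"
  Mor :: "'a set"
  Dom :: "'a \<Rightarrow> 'o"
  Cod :: "'a \<Rightarrow> 'o"
  ident :: "'o \<Rightarrow> 'a"
  comp :: "'a \<Rightarrow> 'a \<Rightarrow> 'a" (infixr "\<cdot>\<index>" 55)

definition hom :: "('o, 'a, 'z) cat_scheme \<Rightarrow> 'o \<Rightarrow> 'o \<Rightarrow> 'a set" where
  "hom C a b = {f \<in> Mor C. Dom C f = a \<and> Cod C f = b}"

definition isos :: "('o, 'a, 'z) cat_scheme \<Rightarrow> 'o \<Rightarrow> 'o \<Rightarrow> 'a set" where
  "isos C a b = {f \<in> hom C a b. \<exists>g \<in> hom C b a.
     g \<cdot>\<^bsub>C\<^esub> f = ident C a \<and> f \<cdot>\<^bsub>C\<^esub> g = ident C b}"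

locale category =
  fixes C (structure)
  assumes Dom_closed: "f \<in> Mor C \<Longrightarrow> Dom C f \<in> Obj C"
    and Cod_closed: "f \<in> Mor C \<Longrightarrow> Cod C f \<in> Obj C"
    and ident_closed: "a \<in> Obj C \<Longrightarrow> ident C a \<in> hom C a a"
    and comp_closed: "\<lbrakk>f \<in> hom C a b; g \<in> hom C b c\<rbrakk> \<Longrightarrow> g \<cdot> f \<in> hom C a c"
    and comp_ident_right: "f \<in> hom C a b \<Longrightarrow> f \<cdot> ident C a = f"
    and comp_ident_left: "f \<in> hom C a b \<Longrightarrow> ident C b \<cdot> f = f"
    and comp_assoc: "\<lbrakk>f \<in> hom C a b; g \<in> hom C b c; h \<in> hom C c d\<rbrakk>
      \<Longrightarrow> (h \<cdot> g) \<cdot> f = h \<cdot> (g \<cdot> f)"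

record ('p, 'q, 'o, 'a) fctr =
  fobj :: "'p \<Rightarrow> 'o"
  farr :: "'q \<Rightarrow> 'a"

locale is_functor = C: category C + D: category D
  for C :: "('p, 'q, 'y) cat_scheme" and D :: "('o, 'a, 'z) cat_scheme"
    and F :: "('p, 'q, 'o, 'a, 'x) fctr_scheme" +
  assumes fobj_closed: "a \<in> Obj C \<Longrightarrow> fobj F a \<in> Obj D"
    and farr_closed: "f \<in> hom C a b \<Longrightarrow> farr F f \<in> hom D (fobj F a) (fobj F b)"
    and farr_ident: "a \<in> Obj C \<Longrightarrow> farr F (ident C a) = ident D (fobj F a)"
    and farr_comp: "\<lbrakk>f \<in> hom C a b; g \<in> hom C b c\<rbrakk>
      \<Longrightarrow> farr F (g \<cdot>\<^bsub>C\<^esub> f) = farr F g \<cdot>\<^bsub>D\<^esub> farr F f"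

text \<open>Components are taken to be extensional, so that equality of functions is equality of
  natural transformations and bijections onto this set are bijections onto \<open>Nat(F, G)\<close>.\<close>

definition nat_trans :: "('p, 'q, 'y) cat_scheme \<Rightarrow> ('o, 'a, 'z) cat_scheme \<Rightarrow>
    ('p, 'q, 'o, 'a, 'u) fctr_scheme \<Rightarrow> ('p, 'q, 'o, 'a, 'v) fctr_scheme \<Rightarrow> ('p \<Rightarrow> 'a) set" where
  "nat_trans C D F G =
     {t \<in> extensional (Obj C).
        (\<forall>x \<in> Obj C. t x \<in> hom D (fobj F x) (fobj G x)) \<and>
        (\<forall>f \<in> Mor C. t (Cod C f) \<cdot>\<^bsub>D\<^esub> farr F f = farr G f \<cdot>\<^bsub>D\<^esub> t (Dom C f))}"

definition power_cat :: "('o, 'a, 'z) cat_scheme \<Rightarrow> nat \<Rightarrow> ('o list, 'a list) cat" where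
  "power_cat C n =
     \<lparr>Obj = {xs. length xs = n \<and> set xs \<subseteq> Obj C},
      Mor = {fs. length fs = n \<and> set fs \<subseteq> Mor C},
      Dom = map (Dom C), Cod = map (Cod C), ident = map (ident C), comp = map2 (comp C)\<rparr>"


record ('o, 'a) moncat = "('o, 'a) cat" +
  ten_obj :: "'o \<Rightarrow> 'o \<Rightarrow> 'o" (infixr "\<otimes>\<index>" 70)
  ten_arr :: "'a \<Rightarrow> 'a \<Rightarrow> 'a" (infixr "\<star>\<index>" 70)
  unit_obj :: 'o ("\<I>\<index>")
  assoc :: "'o \<Rightarrow> 'o \<Rightarrow> 'o \<Rightarrow> 'a"
  lunit :: "'o \<Rightarrow> 'a"
  runit :: "'o \<Rightarrow> 'a"

locale monoidal_category = category C
  for C :: "('o, 'a, 'z) moncat_scheme" (structure) +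
  assumes unit_closed: "\<I> \<in> Obj C"
    and ten_obj_closed: "\<lbrakk>a \<in> Obj C; b \<in> Obj C\<rbrakk> \<Longrightarrow> a \<otimes> b \<in> Obj C"
    and ten_arr_closed: "\<lbrakk>f \<in> hom C a b; g \<in> hom C c d\<rbrakk>
      \<Longrightarrow> f \<star> g \<in> hom C (a \<otimes> c) (b \<otimes> d)"
    and ten_ident: "\<lbrakk>a \<in> Obj C; b \<in> Obj C\<rbrakk>
      \<Longrightarrow> ident C a \<star> ident C b = ident C (a \<otimes> b)"
    and interchange: "\<lbrakk>f \<in> hom C a b; g \<in> hom C b c; f' \<in> hom C a' b'; g' \<in> hom C b' c'\<rbrakk>
      \<Longrightarrow> (g \<cdot> f) \<star> (g' \<cdot> f') = (g \<star> g') \<cdot> (f \<star> f')"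
    and assoc_iso: "\<lbrakk>a \<in> Obj C; b \<in> Obj C; c \<in> Obj C\<rbrakk>
      \<Longrightarrow> assoc C a b c \<in> isos C ((a \<otimes> b) \<otimes> c) (a \<otimes> (b \<otimes> c))"
    and lunit_iso: "a \<in> Obj C \<Longrightarrow> lunit C a \<in> isos C (\<I> \<otimes> a) a"
    and runit_iso: "a \<in> Obj C \<Longrightarrow> runit C a \<in> isos C (a \<otimes> \<I>) a"
    and assoc_natural: "\<lbrakk>f \<in> hom C a a'; g \<in> hom C b b'; h \<in> hom C c c'\<rbrakk>
      \<Longrightarrow> assoc C a' b' c' \<cdot> ((f \<star> g) \<star> h) = (f \<star> (g \<star> h)) \<cdot> assoc C a b c"
    and lunit_natural: "f \<in> hom C a b \<Longrightarrow> lunit C b \<cdot> (ident C \<I> \<star> f) = f \<cdot> lunit C a"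
    and runit_natural: "f \<in> hom C a b \<Longrightarrow> runit C b \<cdot> (f \<star> ident C \<I>) = f \<cdot> runit C a"
    and pentagon: "\<lbrakk>a \<in> Obj C; b \<in> Obj C; c \<in> Obj C; d \<in> Obj C\<rbrakk>
      \<Longrightarrow> (ident C a \<star> assoc C b c d) \<cdot> assoc C a (b \<otimes> c) d \<cdot> (assoc C a b c \<star> ident C d)
        = assoc C a b (c \<otimes> d) \<cdot> assoc C (a \<otimes> b) c d"
    and triangle: "\<lbrakk>a \<in> Obj C; b \<in> Obj C\<rbrakk>
      \<Longrightarrow> (ident C a \<star> lunit C b) \<cdot> assoc C a \<I> b = runit C a \<star> ident C b"

locale strict_monoidal_category = monoidal_category C
  for C :: "('o, 'a, 'z) moncat_scheme" (structure) +
  assumes ten_obj_assoc: "\<lbrakk>a \<in> Obj C; b \<in> Obj C; c \<in> Obj C\<rbrakk>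
      \<Longrightarrow> (a \<otimes> b) \<otimes> c = a \<otimes> (b \<otimes> c)"
    and unit_ten_obj: "a \<in> Obj C \<Longrightarrow> \<I> \<otimes> a = a"
    and ten_obj_unit: "a \<in> Obj C \<Longrightarrow> a \<otimes> \<I> = a"
    and assoc_strict: "\<lbrakk>a \<in> Obj C; b \<in> Obj C; c \<in> Obj C\<rbrakk>
      \<Longrightarrow> assoc C a b c = ident C (a \<otimes> (b \<otimes> c))"
    and lunit_strict: "a \<in> Obj C \<Longrightarrow> lunit C a = ident C a"
    and runit_strict: "a \<in> Obj C \<Longrightarrow> runit C a = ident C a"

record ('o, 'a) braided_moncat = "('o, 'a) moncat" +
  braid :: "'o \<Rightarrow> 'o \<Rightarrow> 'a" ("\<Psi>\<index>")

locale strict_braided_category = strict_monoidal_category C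
  for C :: "('o, 'a, 'z) braided_moncat_scheme" (structure) +
  assumes braid_iso: "\<lbrakk>a \<in> Obj C; b \<in> Obj C\<rbrakk> \<Longrightarrow> \<Psi> a b \<in> isos C (a \<otimes> b) (b \<otimes> a)"
    and braid_natural: "\<lbrakk>f \<in> hom C a a'; g \<in> hom C b b'\<rbrakk>
      \<Longrightarrow> \<Psi> a' b' \<cdot> (f \<star> g) = (g \<star> f) \<cdot> \<Psi> a b"
    and hexagon_right: "\<lbrakk>a \<in> Obj C; b \<in> Obj C; c \<in> Obj C\<rbrakk>
      \<Longrightarrow> \<Psi> a (b \<otimes> c) = (ident C b \<star> \<Psi> a c) \<cdot> (\<Psi> a b \<star> ident C c)"
    and hexagon_left: "\<lbrakk>a \<in> Obj C; b \<in> Obj C; c \<in> Obj C\<rbrakk>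
      \<Longrightarrow> \<Psi> (a \<otimes> b) c = (\<Psi> a c \<star> ident C b) \<cdot> (ident C a \<star> \<Psi> b c)"

text \<open>A functor with comparison arrows \<open>fmult x y : F x \<otimes> F y \<rightarrow> F (x \<otimes> y)\<close> and
  \<open>funit : \<I> \<rightarrow> F \<I>\<close>; the record imposes no laws.\<close>

record ('p, 'q, 'o, 'a) mfctr = "('p, 'q, 'o, 'a) fctr" +
  fmult :: "'p \<Rightarrow> 'p \<Rightarrow> 'a"
  funit :: 'a

locale monoidal_functor = is_functor M N F + M: monoidal_category M + N: monoidal_category N
  for M :: "('p, 'q, 'y) moncat_scheme" and N :: "('o, 'a, 'z) moncat_scheme"
    and F :: "('p, 'q, 'o, 'a, 'x) mfctr_scheme" +
  assumes fmult_iso: "\<lbrakk>x \<in> Obj M; y \<in> Obj M\<rbrakk>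
      \<Longrightarrow> fmult F x y \<in> isos N (fobj F x \<otimes>\<^bsub>N\<^esub> fobj F y) (fobj F (x \<otimes>\<^bsub>M\<^esub> y))"
    and funit_iso: "funit F \<in> isos N \<I>\<^bsub>N\<^esub> (fobj F \<I>\<^bsub>M\<^esub>)"
    and fmult_natural: "\<lbrakk>f \<in> hom M x x'; g \<in> hom M y y'\<rbrakk>
      \<Longrightarrow> fmult F x' y' \<cdot>\<^bsub>N\<^esub> (farr F f \<star>\<^bsub>N\<^esub> farr F g)
        = farr F (f \<star>\<^bsub>M\<^esub> g) \<cdot>\<^bsub>N\<^esub> fmult F x y"
    and fmult_assoc: "\<lbrakk>x \<in> Obj M; y \<in> Obj M; z \<in> Obj M\<rbrakk>
      \<Longrightarrow> farr F (assoc M x y z) \<cdot>\<^bsub>N\<^esub> fmult F (x \<otimes>\<^bsub>M\<^esub> y) z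
            \<cdot>\<^bsub>N\<^esub> (fmult F x y \<star>\<^bsub>N\<^esub> ident N (fobj F z))
        = fmult F x (y \<otimes>\<^bsub>M\<^esub> z) \<cdot>\<^bsub>N\<^esub> (ident N (fobj F x) \<star>\<^bsub>N\<^esub> fmult F y z)
            \<cdot>\<^bsub>N\<^esub> assoc N (fobj F x) (fobj F y) (fobj F z)"
    and fmult_lunit: "x \<in> Obj M
      \<Longrightarrow> farr F (lunit M x) \<cdot>\<^bsub>N\<^esub> fmult F \<I>\<^bsub>M\<^esub> x \<cdot>\<^bsub>N\<^esub> (funit F \<star>\<^bsub>N\<^esub> ident N (fobj F x))
        = lunit N (fobj F x)"
    and fmult_runit: "x \<in> Obj M
      \<Longrightarrow> farr F (runit M x) \<cdot>\<^bsub>N\<^esub> fmult F x \<I>\<^bsub>M\<^esub> \<cdot>\<^bsub>N\<^esub> (ident N (fobj F x) \<star>\<^bsub>N\<^esub> funit F)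
        = runit N (fobj F x)"

definition mfctr_comp :: "('o, 'a, 'z) cat_scheme \<Rightarrow> ('m, 'n, 'o, 'a) mfctr \<Rightarrow>
    ('p, 'q, 'm, 'n) mfctr \<Rightarrow> ('p, 'q, 'o, 'a) mfctr" where
  "mfctr_comp D G F =
     \<lparr>fobj = \<lambda>x. fobj G (fobj F x),
      farr = \<lambda>f. farr G (farr F f),
      fmult = \<lambda>x y. farr G (fmult F x y) \<cdot>\<^bsub>D\<^esub> fmult G (fobj F x) (fobj F y),
      funit = farr G (funit F) \<cdot>\<^bsub>D\<^esub> funit G\<rparr>"

text \<open>Equality of functors on the objects and arrows of the source category, including equality
  of the comparison arrows.\<close>

definition mfctr_eq :: "('p, 'q, 'z) cat_scheme \<Rightarrow> ('p, 'q, 'o, 'a) mfctr \<Rightarrow>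
    ('p, 'q, 'o, 'a) mfctr \<Rightarrow> bool" where
  "mfctr_eq M F G \<longleftrightarrow>
     (\<forall>x \<in> Obj M. fobj F x = fobj G x) \<and>
     (\<forall>f \<in> Mor M. farr F f = farr G f) \<and>
     (\<forall>x \<in> Obj M. \<forall>y \<in> Obj M. fmult F x y = fmult G x y) \<and>
     funit F = funit G"


record ('o, 'a) alg =
  car :: 'o
  mlt :: 'a
  aunit :: 'a

record ('o, 'a) qbialg = "('o, 'a) alg" +
  comul :: 'a
  counit :: 'a
  reassoc :: 'a

type_synonym ('o, 'a) lmod = "'o \<times> 'a"
type_synonym ('o, 'a) lmod_hom = "('o, 'a) lmod \<times> 'a \<times> ('o, 'a) lmod"

context
  fixes N :: "('o, 'a) braided_moncat" (structure)
begin

primrec obj_power :: "'o \<Rightarrow> nat \<Rightarrow> 'o" where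
  "obj_power b 0 = \<I>"
| "obj_power b (Suc n) = b \<otimes> obj_power b n"

definition ten_objs :: "'o list \<Rightarrow> 'o" where
  "ten_objs xs = foldr (\<otimes>) xs \<I>"

definition ten_arrs :: "'a list \<Rightarrow> 'a" where
  "ten_arrs fs = foldr (\<star>) fs (ident N \<I>)"

definition is_algebra :: "('o, 'a, 'x) alg_scheme \<Rightarrow> bool" where
  "is_algebra A \<longleftrightarrow>
     car A \<in> Obj N \<and>
     mlt A \<in> hom N (car A \<otimes> car A) (car A) \<and>
     aunit A \<in> hom N \<I> (car A) \<and>
     mlt A \<cdot> (mlt A \<star> ident N (car A)) = mlt A \<cdot> (ident N (car A) \<star> mlt A) \<and>
     mlt A \<cdot> (aunit A \<star> ident N (car A)) = ident N (car A) \<and>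
     mlt A \<cdot> (ident N (car A) \<star> aunit A) = ident N (car A)"

definition alg_morphism ::
    "('o, 'a, 'x) alg_scheme \<Rightarrow> ('o, 'a, 'y) alg_scheme \<Rightarrow> 'a \<Rightarrow> bool" where
  "alg_morphism A C f \<longleftrightarrow>
     f \<in> hom N (car A) (car C) \<and>
     f \<cdot> mlt A = mlt C \<cdot> (f \<star> f) \<and>
     f \<cdot> aunit A = aunit C"

definition unit_alg :: "('o, 'a) alg" where
  "unit_alg = \<lparr>car = \<I>, mlt = ident N \<I>, aunit = ident N \<I>\<rparr>"

definition alg_tensor ::
    "('o, 'a, 'x) alg_scheme \<Rightarrow> ('o, 'a, 'y) alg_scheme \<Rightarrow> ('o, 'a) alg" where
  "alg_tensor A C =
     \<lparr>car = car A \<otimes> car C,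
      mlt = (mlt A \<star> mlt C) \<cdot> (ident N (car A) \<star> \<Psi> (car C) (car A) \<star> ident N (car C)),
      aunit = aunit A \<star> aunit C\<rparr>"

primrec alg_power :: "('o, 'a, 'x) alg_scheme \<Rightarrow> nat \<Rightarrow> ('o, 'a) alg" where
  "alg_power A 0 = unit_alg"
| "alg_power A (Suc n) = alg_tensor A (alg_power A n)"

text \<open>The product of \<open>f : V \<rightarrow> A\<close> and \<open>g : W \<rightarrow> A\<close> is an arrow \<open>V \<otimes> W \<rightarrow> A\<close>. It is only
  used when \<open>V\<close> or \<open>W\<close> is \<open>\<I>\<close>, as in \<open>(id \<otimes> \<Delta>)\<Delta> \<cdot> \<phi>\<close>.\<close>

definition alg_prod :: "('o, 'a, 'x) alg_scheme \<Rightarrow> 'a \<Rightarrow> 'a \<Rightarrow> 'a" where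
  "alg_prod A f g = mlt A \<cdot> (f \<star> g)"

definition invertible_element :: "('o, 'a, 'x) alg_scheme \<Rightarrow> 'a \<Rightarrow> bool" where
  "invertible_element A x \<longleftrightarrow>
     x \<in> hom N \<I> (car A) \<and>
     (\<exists>y \<in> hom N \<I> (car A). alg_prod A x y = aunit A \<and> alg_prod A y x = aunit A)"

definition quasi_bialgebra :: "('o, 'a) qbialg \<Rightarrow> bool" where
  "quasi_bialgebra H \<longleftrightarrow>
     (let i = ident N (car H); \<Delta> = comul H; \<epsilon> = counit H; \<phi> = reassoc H; \<eta> = aunit H;
          H3 = alg_power H 3; H4 = alg_power H 4
      in is_algebra H \<and>
         alg_morphism H (alg_tensor H H) \<Delta> \<and>
         alg_morphism H unit_alg \<epsilon> \<and>
         invertible_element H3 \<phi> \<and>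
         alg_prod H3 ((i \<star> \<Delta>) \<cdot> \<Delta>) \<phi> = alg_prod H3 \<phi> ((\<Delta> \<star> i) \<cdot> \<Delta>) \<and>
         (\<epsilon> \<star> i) \<cdot> \<Delta> = i \<and>
         (i \<star> \<epsilon>) \<cdot> \<Delta> = i \<and>
         (i \<star> \<epsilon> \<star> i) \<cdot> \<phi> = \<eta> \<star> \<eta> \<and>
         alg_prod H4 (alg_prod H4 (\<eta> \<star> \<phi>) ((i \<star> \<Delta> \<star> i) \<cdot> \<phi>)) (\<phi> \<star> \<eta>)
           = alg_prod H4 ((i \<star> i \<star> \<Delta>) \<cdot> \<phi>) ((\<Delta> \<star> i \<star> i) \<cdot> \<phi>))"

definition qb_morphism :: "('o, 'a) qbialg \<Rightarrow> ('o, 'a) qbialg \<Rightarrow> 'a \<Rightarrow> bool" where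
  "qb_morphism H K f \<longleftrightarrow>
     alg_morphism H K f \<and>
     (f \<star> f) \<cdot> comul H = comul K \<cdot> f \<and>
     counit K \<cdot> f = counit H \<and>
     (f \<star> f \<star> f) \<cdot> reassoc H = reassoc K"


text \<open>\<open>interleave b [x\<^sub>1, \<dots>, x\<^sub>n]\<close> is the arrow
  \<open>b\<^sup>n \<otimes> x\<^sub>1 \<otimes> \<dots> \<otimes> x\<^sub>n \<rightarrow> (b \<otimes> x\<^sub>1) \<otimes> \<dots> \<otimes> (b \<otimes> x\<^sub>n)\<close> given by the braiding: the last \<open>n - 1\<close>
  factors \<open>b\<close> are moved past \<open>x\<^sub>1\<close> by \<open>\<Psi>\<close>, and so on.\<close>

primrec interleave :: "'o \<Rightarrow> 'o list \<Rightarrow> 'a" where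
  "interleave b [] = ident N \<I>"
| "interleave b (x # xs) =
     (ident N (b \<otimes> x) \<star> interleave b xs)
       \<cdot> (ident N b \<star> \<Psi> (obj_power b (length xs)) x \<star> ident N (ten_objs xs))"

text \<open>The factorwise action of \<open>b\<^sup>n\<close> on \<open>x\<^sub>1 \<otimes> \<dots> \<otimes> x\<^sub>n\<close>, given pairs
  \<open>(x\<^sub>i, \<rho>\<^sub>i : b \<otimes> x\<^sub>i \<rightarrow> x\<^sub>i)\<close>.\<close>

definition diag_action :: "'o \<Rightarrow> ('o, 'a) lmod list \<Rightarrow> 'a" where
  "diag_action b ms = ten_arrs (map snd ms) \<cdot> interleave b (map fst ms)"

definition is_module :: "('o, 'a, 'x) alg_scheme \<Rightarrow> ('o, 'a) lmod \<Rightarrow> bool" where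
  "is_module A m \<longleftrightarrow>
     fst m \<in> Obj N \<and>
     snd m \<in> hom N (car A \<otimes> fst m) (fst m) \<and>
     snd m \<cdot> (mlt A \<star> ident N (fst m)) = snd m \<cdot> (ident N (car A) \<star> snd m) \<and>
     snd m \<cdot> (aunit A \<star> ident N (fst m)) = ident N (fst m)"

definition ten_mod :: "('o, 'a) qbialg \<Rightarrow> ('o, 'a) lmod \<Rightarrow> ('o, 'a) lmod \<Rightarrow> ('o, 'a) lmod" where
  "ten_mod H m n =
     (fst m \<otimes> fst n, diag_action (car H) [m, n] \<cdot> (comul H \<star> ident N (fst m \<otimes> fst n)))"

definition unit_mod :: "('o, 'a) qbialg \<Rightarrow> ('o, 'a) lmod" where
  "unit_mod H = (\<I>, counit H)"

definition Mod :: "('o, 'a) qbialg \<Rightarrow> (('o, 'a) lmod, ('o, 'a) lmod_hom) moncat" where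
  "Mod H =
     \<lparr>Obj = {m. is_module H m},
      Mor = {(m, f, n). is_module H m \<and> is_module H n \<and> f \<in> hom N (fst m) (fst n) \<and>
               f \<cdot> snd m = snd n \<cdot> (ident N (car H) \<star> f)},
      Dom = (\<lambda>(m, f, n). m),
      Cod = (\<lambda>(m, f, n). n),
      ident = (\<lambda>m. (m, ident N (fst m), m)),
      comp = (\<lambda>(m', g, n') (m, f, n). (m, g \<cdot> f, n')),
      ten_obj = ten_mod H,
      ten_arr = (\<lambda>(m, f, n) (m', g, n'). (ten_mod H m m', f \<star> g, ten_mod H n n')),
      unit_obj = unit_mod H,
      assoc = (\<lambda>l m n.
        (ten_mod H (ten_mod H l m) n,
         diag_action (car H) [l, m, n] \<cdot> (reassoc H \<star> ident N (fst l \<otimes> fst m \<otimes> fst n)),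
         ten_mod H l (ten_mod H m n))),
      lunit = (\<lambda>m. (ten_mod H (unit_mod H) m, ident N (fst m), m)),
      runit = (\<lambda>m. (ten_mod H m (unit_mod H), ident N (fst m), m))\<rparr>"

text \<open>The forgetful functor preserves tensor products and the unit on the nose, hence carries
  identity comparison arrows; it is not a \<open>monoidal_functor\<close> unless the reassociator acts
  trivially.\<close>

definition forget :: "(('o, 'a) lmod, ('o, 'a) lmod_hom, 'o, 'a) mfctr" where
  "forget =
     \<lparr>fobj = fst,
      farr = (\<lambda>(m, f, n). f),
      fmult = (\<lambda>m n. ident N (fst m \<otimes> fst n)),
      funit = ident N \<I>\<rparr>"

text \<open>Pullback along \<open>f : H' \<rightarrow> H\<close>; the argument \<open>H'\<close> is needed for the comparison arrows only.\<close>

definition pull_mod :: "'a \<Rightarrow> ('o, 'a) lmod \<Rightarrow> ('o, 'a) lmod" where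
  "pull_mod f m = (fst m, snd m \<cdot> (f \<star> ident N (fst m)))"

definition pullback :: "('o, 'a) qbialg \<Rightarrow> 'a \<Rightarrow>
    (('o, 'a) lmod, ('o, 'a) lmod_hom, ('o, 'a) lmod, ('o, 'a) lmod_hom) mfctr" where
  "pullback H' f =
     \<lparr>fobj = pull_mod f,
      farr = (\<lambda>(m, g, n). (pull_mod f m, g, pull_mod f n)),
      fmult = (\<lambda>m n. ident (Mod H') (ten_obj (Mod H') (pull_mod f m) (pull_mod f n))),
      funit = ident (Mod H') (unit_obj (Mod H'))\<rparr>"


text \<open>\<open>F\<^sup>\<otimes>\<^sup>n : M\<^sup>n \<rightarrow> N\<close>, where \<open>n\<close> is the length of the list.\<close>

definition tensor_power_fctr :: "('p, 'q, 'o, 'a, 'x) fctr_scheme \<Rightarrow>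
    ('p list, 'q list, 'o, 'a) fctr" where
  "tensor_power_fctr F =
     \<lparr>fobj = \<lambda>xs. ten_objs (map (fobj F) xs), farr = \<lambda>fs. ten_arrs (map (farr F) fs)\<rparr>"

definition ten_fctr :: "'o \<Rightarrow> ('p, 'q, 'o, 'a, 'x) fctr_scheme \<Rightarrow> ('p, 'q, 'o, 'a) fctr" where
  "ten_fctr v F = \<lparr>fobj = \<lambda>x. v \<otimes> fobj F x, farr = \<lambda>f. ident N v \<star> farr F f\<rparr>"

definition theta :: "('p, 'q, 'z) cat_scheme \<Rightarrow> ('p, 'q, 'o, 'a, 'x) fctr_scheme \<Rightarrow>
    'o \<Rightarrow> ('p \<Rightarrow> 'a) \<Rightarrow> nat \<Rightarrow> 'a \<Rightarrow> 'p list \<Rightarrow> 'a" where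
  "theta M F b \<sigma> n \<beta> =
     (\<lambda>xs \<in> Obj (power_cat M n).
        diag_action b (map (\<lambda>x. (fobj F x, \<sigma> x)) xs)
          \<cdot> (\<beta> \<star> ident N (ten_objs (map (fobj F) xs))))"

definition represents :: "('p, 'q, 'z) cat_scheme \<Rightarrow> ('p, 'q, 'o, 'a, 'x) fctr_scheme \<Rightarrow>
    'o \<Rightarrow> ('o \<Rightarrow> 'a \<Rightarrow> 'p \<Rightarrow> 'a) \<Rightarrow> bool" where
  "represents M F b \<rho> \<longleftrightarrow>
     (\<forall>v \<in> Obj N. bij_betw (\<rho> v) (hom N v b) (nat_trans M N (ten_fctr v F) F)) \<and>
     (\<forall>v \<in> Obj N. \<forall>w \<in> Obj N. \<forall>g \<in> hom N w v. \<forall>\<beta> \<in> hom N v b. \<forall>x \<in> Obj M.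
        \<rho> w (\<beta> \<cdot> g) x = \<rho> v \<beta> x \<cdot> (g \<star> ident N (fobj F x)))"

definition higher_representable ::
    "('p, 'q, 'z) cat_scheme \<Rightarrow> ('p, 'q, 'o, 'a, 'x) fctr_scheme \<Rightarrow> 'o \<Rightarrow> bool" where
  "higher_representable M F b \<longleftrightarrow>
     (\<exists>\<rho>. represents M F b \<rho> \<and>
        (\<forall>n. \<forall>v \<in> Obj N.
           bij_betw (theta M F b (\<rho> b (ident N b)) n)
             (hom N v (obj_power b n))
             (nat_trans (power_cat M n) N
                (ten_fctr v (tensor_power_fctr F)) (tensor_power_fctr F))))"


text \<open>The equation includes the comparison arrows, i.e. those of \<open>G\<close> are lifts of those of \<open>F\<close>.
  Without this the universal property fails: twisting the coproduct of \<open>H\<close> and the comparison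
  arrows of \<open>G\<close> leaves the underlying functors unchanged.\<close>

definition factorization :: "('p, 'q) moncat \<Rightarrow> ('p, 'q, 'o, 'a) mfctr \<Rightarrow> ('o, 'a) qbialg \<Rightarrow>
    ('p, 'q, ('o, 'a) lmod, ('o, 'a) lmod_hom) mfctr \<Rightarrow> bool" where
  "factorization M F H G \<longleftrightarrow>
     quasi_bialgebra H \<and> monoidal_functor M (Mod H) G \<and> mfctr_eq M (mfctr_comp N forget G) F"

definition universal_factorization :: "('p, 'q) moncat \<Rightarrow> ('p, 'q, 'o, 'a) mfctr \<Rightarrow>
    ('o, 'a) qbialg \<Rightarrow> ('p, 'q, ('o, 'a) lmod, ('o, 'a) lmod_hom) mfctr \<Rightarrow> bool" where
  "universal_factorization M F H G \<longleftrightarrow>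
     factorization M F H G \<and>
     (\<forall>H' G'. factorization M F H' G' \<longrightarrow>
        (\<exists>!f. qb_morphism H' H f \<and>
           mfctr_eq M (mfctr_comp (Mod H') (pullback H' f) G) G' \<and>
           mfctr_eq (Mod H) (mfctr_comp N forget (pullback H' f)) forget))"

end

end

theory Submission
  imports Defs
begin

text \<open>The idea is Tannaka reconstruction. Higher representability says that an arrow \<open>v \<rightarrow> B\<^sup>n\<close> is the
same thing as a natural transformation \<open>v \<otimes> F\<^sup>n \<rightarrow> F\<^sup>n\<close>. So a structure arrow of \<open>B\<close> exists as soon
as one can write down how it should act on the objects \<open>F x\<close> (\<open>full1\<close>, \<open>full2\<close>), and an equation
between arrows into \<open>B\<^sup>n\<close> holds as soon as both sides act in the same way (\<open>faithful1\<close>,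
\<open>faithful2\<close>, \<open>faithful3\<close>).

Let \<open>\<sigma> : B \<otimes> F \<rightarrow> F\<close> be the universal action. The product of \<open>B\<close> acts as \<open>\<sigma>\<close> applied twice, the unit
as the identity, the coproduct as \<open>\<sigma>\<close> on \<open>F (x \<otimes> y)\<close> carried to \<open>F x \<otimes> F y\<close> along the
comparison isomorphism of \<open>F\<close>, and the counit as \<open>\<sigma>\<close> on \<open>F \<I>\<close> carried to \<open>\<I>\<close>. The reassociator has to act
as the difference between the two ways of comparing \<open>F x \<otimes> F y \<otimes> F z\<close> with the value of \<open>F\<close> on the
triple tensor product. Since \<open>F\<close> is coherent with the associators there is no difference, so the reassociator
is \<open>\<eta> \<otimes> \<eta> \<otimes> \<eta>\<close> and \<open>B\<close> is an ordinary bialgebra in the braided category. This makes the module category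
strictly associative and unital, as the base is (\<open>Mod_monoidal\<close>).

All verifications are arguments about equivariant arrows. If an isomorphism is equivariant, then the action on
its target determines the action on its source (\<open>equivariant_source_unique\<close>), and the latter is a
module if the former is (\<open>module_transport\<close>). Hence each axiom of \<open>B\<close> is a coherence axiom of \<open>F\<close> read as
an equality of two equivariant isomorphisms: coassociativity comes from \<open>fmult_associative\<close>, the counit
laws from the unit laws of \<open>F\<close>, and multiplicativity of the coproduct from the fact that \<open>F (x \<otimes> y)\<close> is a
module. The computations with the braiding are confined to the action of \<open>b \<otimes> c\<close> on
\<open>x \<otimes> y\<close> made from actions of \<open>b\<close> on \<open>x\<close> and of \<open>c\<close> on \<open>y\<close>: it is natural (\<open>juxt_precomp\<close>,
\<open>juxt_intertwine\<close>), associative (\<open>juxt_assoc\<close>) and compatible with composition (\<open>juxt_comp\<close>).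

For universality, a factorization through the modules of \<open>H'\<close> is an action of \<open>H'\<close> on \<open>F\<close>
(\<open>factorizationE\<close>), that is, one arrow \<open>f : H' \<rightarrow> B\<close>. The action of \<open>H'\<close> is the
pullback of \<open>\<sigma>\<close> along \<open>f\<close>, which determines \<open>f\<close>; and \<open>f\<close> respects the structure arrows because
those of \<open>H'\<close> and of \<open>B\<close> act in the same way on the objects \<open>F x\<close>. In particular the reassociator of \<open>H'\<close> acts on
these objects as the identity, whatever it is in \<open>H'\<close>.\<close>

section \<open>Strict monoidal structures\<close>

context category begin

lemma ident_in_isos: "a \<in> Obj C \<Longrightarrow> ident C a \<in> isos C a a"
  using ident_closed[of a] comp_ident_left[of "ident C a" a a] by (auto simp: isos_def)

end

lemma monoidal_category_if_strict:
  fixes C :: "('o, 'a, 'z) moncat_scheme" (structure)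
  assumes "category C"
    and unit: "\<I> \<in> Obj C"
    and ten_obj: "\<And>a b. \<lbrakk>a \<in> Obj C; b \<in> Obj C\<rbrakk> \<Longrightarrow> a \<otimes> b \<in> Obj C"
    and ten_arr: "\<And>f g a b c d. \<lbrakk>f \<in> hom C a b; g \<in> hom C c d\<rbrakk> \<Longrightarrow> f \<star> g \<in> hom C (a \<otimes> c) (b \<otimes> d)"
    and ten_id: "\<And>a b. \<lbrakk>a \<in> Obj C; b \<in> Obj C\<rbrakk> \<Longrightarrow> ident C a \<star> ident C b = ident C (a \<otimes> b)"
    and inter: "\<And>f g f' g' a b c a' b' c'. \<lbrakk>f \<in> hom C a b; g \<in> hom C b c; f' \<in> hom C a' b'; g' \<in> hom C b' c'\<rbrakk>
      \<Longrightarrow> (g \<cdot> f) \<star> (g' \<cdot> f') = (g \<star> g') \<cdot> (f \<star> f')"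
    and obj_assoc: "\<And>a b c. \<lbrakk>a \<in> Obj C; b \<in> Obj C; c \<in> Obj C\<rbrakk> \<Longrightarrow> (a \<otimes> b) \<otimes> c = a \<otimes> (b \<otimes> c)"
    and obj_unit: "\<And>a. a \<in> Obj C \<Longrightarrow> \<I> \<otimes> a = a" "\<And>a. a \<in> Obj C \<Longrightarrow> a \<otimes> \<I> = a"
    and arr_assoc: "\<And>f g h. \<lbrakk>f \<in> Mor C; g \<in> Mor C; h \<in> Mor C\<rbrakk> \<Longrightarrow> (f \<star> g) \<star> h = f \<star> (g \<star> h)"
    and arr_unit: "\<And>f. f \<in> Mor C \<Longrightarrow> ident C \<I> \<star> f = f" "\<And>f. f \<in> Mor C \<Longrightarrow> f \<star> ident C \<I> = f"
    and assoc: "\<And>a b c. \<lbrakk>a \<in> Obj C; b \<in> Obj C; c \<in> Obj C\<rbrakk> \<Longrightarrow> assoc C a b c = ident C (a \<otimes> (b \<otimes> c))"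
    and lunit: "\<And>a. a \<in> Obj C \<Longrightarrow> lunit C a = ident C a"
    and runit: "\<And>a. a \<in> Obj C \<Longrightarrow> runit C a = ident C a"
  shows "monoidal_category C"
proof -
  interpret category C by fact
  have M: "f \<in> Mor C \<and> Dom C f = a \<and> Cod C f = b \<and> a \<in> Obj C \<and> b \<in> Obj C" if "f \<in> hom C a b" for f a b
    using that Dom_closed Cod_closed by (auto simp: hom_def)
  have id_comp: "ident C a \<cdot> ident C a = ident C a" if "a \<in> Obj C" for a
    using comp_ident_left[OF ident_closed[OF that]] .
  show ?thesis
  proof
    fix f g h a a' b b' c c'
    assume f: "f \<in> hom C a a'" and g: "g \<in> hom C b b'" and h: "h \<in> hom C c c'"
    have k: "f \<star> (g \<star> h) \<in> hom C (a \<otimes> (b \<otimes> c)) (a' \<otimes> (b' \<otimes> c'))"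
      using f g h by (intro ten_arr)
    show "assoc C a' b' c' \<cdot> ((f \<star> g) \<star> h) = (f \<star> (g \<star> h)) \<cdot> assoc C a b c"
      using M[OF f] M[OF g] M[OF h] comp_ident_left[OF k] comp_ident_right[OF k]
      by (simp add: arr_assoc assoc)
  next
    fix f a b assume f: "f \<in> hom C a b"
    show "lunit C b \<cdot> (ident C \<I> \<star> f) = f \<cdot> lunit C a"
      "runit C b \<cdot> (f \<star> ident C \<I>) = f \<cdot> runit C a"
      using M[OF f] comp_ident_left[OF f] comp_ident_right[OF f]
      by (simp_all add: arr_unit lunit runit)
  qed (simp_all add: unit ten_obj ten_arr ten_id inter obj_assoc obj_unit assoc lunit runit
      ident_in_isos id_comp)
qed

section \<open>Arrows in a strict braided monoidal category\<close>

text \<open>The functions on modules, algebras and actions are defined over unextended records, so the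
record type is fixed here. Below, arrows are treated through \<open>Mor\<close>, \<open>Dom\<close> and \<open>Cod\<close> rather than through
\<open>hom\<close>: side conditions then contain no unknown intermediate objects and the simplifier can discharge them.\<close>

locale braided_base = strict_braided_category N
  for N :: "('o, 'a) braided_moncat" (structure)
begin

lemma Mor_ident [simp]: "a \<in> Obj N \<Longrightarrow> ident N a \<in> Mor N"
  and Dom_ident [simp]: "a \<in> Obj N \<Longrightarrow> Dom N (ident N a) = a"
  and Cod_ident [simp]: "a \<in> Obj N \<Longrightarrow> Cod N (ident N a) = a"
  using ident_closed[of a] by (auto simp: hom_def)

lemma Mor_comp [simp]: "\<lbrakk>f \<in> Mor N; g \<in> Mor N; Cod N f = Dom N g\<rbrakk> \<Longrightarrow> g \<cdot> f \<in> Mor N"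
  and Dom_comp [simp]: "\<lbrakk>f \<in> Mor N; g \<in> Mor N; Cod N f = Dom N g\<rbrakk> \<Longrightarrow> Dom N (g \<cdot> f) = Dom N f"
  and Cod_comp [simp]: "\<lbrakk>f \<in> Mor N; g \<in> Mor N; Cod N f = Dom N g\<rbrakk> \<Longrightarrow> Cod N (g \<cdot> f) = Cod N g"
  using comp_closed[of f "Dom N f" "Cod N f" g "Cod N g"] by (auto simp: hom_def)

lemma Mor_ten [simp]: "\<lbrakk>f \<in> Mor N; g \<in> Mor N\<rbrakk> \<Longrightarrow> f \<star> g \<in> Mor N"
  and Dom_ten [simp]: "\<lbrakk>f \<in> Mor N; g \<in> Mor N\<rbrakk> \<Longrightarrow> Dom N (f \<star> g) = Dom N f \<otimes> Dom N g"
  and Cod_ten [simp]: "\<lbrakk>f \<in> Mor N; g \<in> Mor N\<rbrakk> \<Longrightarrow> Cod N (f \<star> g) = Cod N f \<otimes> Cod N g"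
  using ten_arr_closed[of f "Dom N f" "Cod N f" g "Dom N g" "Cod N g"] by (auto simp: hom_def)

lemma braid_hom: "\<lbrakk>a \<in> Obj N; b \<in> Obj N\<rbrakk> \<Longrightarrow> \<Psi> a b \<in> hom N (a \<otimes> b) (b \<otimes> a)"
  using braid_iso by (auto simp: isos_def)

lemma Mor_braid [simp]: "\<lbrakk>a \<in> Obj N; b \<in> Obj N\<rbrakk> \<Longrightarrow> \<Psi> a b \<in> Mor N"
  and Dom_braid [simp]: "\<lbrakk>a \<in> Obj N; b \<in> Obj N\<rbrakk> \<Longrightarrow> Dom N (\<Psi> a b) = a \<otimes> b"
  and Cod_braid [simp]: "\<lbrakk>a \<in> Obj N; b \<in> Obj N\<rbrakk> \<Longrightarrow> Cod N (\<Psi> a b) = b \<otimes> a"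
  using braid_hom[of a b] by (auto simp: hom_def)

lemmas [simp] = Dom_closed Cod_closed unit_closed ten_obj_closed
  ten_obj_assoc unit_ten_obj ten_obj_unit

lemma comp_ident [simp]:
  "\<lbrakk>f \<in> Mor N; Dom N f = a\<rbrakk> \<Longrightarrow> f \<cdot> ident N a = f"
  "\<lbrakk>f \<in> Mor N; Cod N f = a\<rbrakk> \<Longrightarrow> ident N a \<cdot> f = f"
  using comp_ident_right comp_ident_left by (auto simp: hom_def)

lemma comp_assoc' [simp]:
  "\<lbrakk>f \<in> Mor N; g \<in> Mor N; h \<in> Mor N; Cod N f = Dom N g; Cod N g = Dom N h\<rbrakk>
    \<Longrightarrow> (h \<cdot> g) \<cdot> f = h \<cdot> (g \<cdot> f)"
  using comp_assoc by (auto simp: hom_def)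

lemma ten_comp:
  "\<lbrakk>f \<in> Mor N; g \<in> Mor N; Cod N f = Dom N g; f' \<in> Mor N; g' \<in> Mor N; Cod N f' = Dom N g'\<rbrakk>
    \<Longrightarrow> (g \<star> g') \<cdot> (f \<star> f') = (g \<cdot> f) \<star> (g' \<cdot> f')"
  using interchange[of f "Dom N f" "Cod N f" g "Cod N g" f' "Dom N f'" "Cod N f'" g' "Cod N g'"]
  by (auto simp: hom_def)

lemma ten_comp3:
  "\<lbrakk>f \<in> Mor N; f' \<in> Mor N; Cod N f' = Dom N f; g \<in> Mor N; g' \<in> Mor N; Cod N g' = Dom N g;
    h \<in> Mor N; h' \<in> Mor N; Cod N h' = Dom N h\<rbrakk>
    \<Longrightarrow> (f \<star> g \<star> h) \<cdot> (f' \<star> g' \<star> h') = (f \<cdot> f') \<star> (g \<cdot> g') \<star> (h \<cdot> h')"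
  by (simp add: ten_comp)

lemma ident_ten: "\<lbrakk>a \<in> Obj N; b \<in> Obj N\<rbrakk> \<Longrightarrow> ident N (a \<otimes> b) = ident N a \<star> ident N b"
  using ten_ident by simp

text \<open>This is naturality of an associator all of whose components are identities. The unit laws below follow from the
unitors in the same way.\<close>

lemma ten_arr_assoc [simp]:
  assumes "f \<in> Mor N" "g \<in> Mor N" "h \<in> Mor N"
  shows "(f \<star> g) \<star> h = f \<star> (g \<star> h)"
  using assoc_natural[of f "Dom N f" "Cod N f" g "Dom N g" "Cod N g" h "Dom N h" "Cod N h"] assms
  by (simp add: hom_def assoc_strict)

lemma ten_unit_left [simp]: "f \<in> Mor N \<Longrightarrow> ident N \<I> \<star> f = f"
  using lunit_natural[of f "Dom N f" "Cod N f"] by (simp add: hom_def lunit_strict)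

lemma ten_unit_right [simp]: "f \<in> Mor N \<Longrightarrow> f \<star> ident N \<I> = f"
  using runit_natural[of f "Dom N f" "Cod N f"] by (simp add: hom_def runit_strict)

lemma whisker_left:
  "\<lbrakk>f \<in> Mor N; g \<in> Mor N; Cod N f = Dom N g; a \<in> Obj N\<rbrakk>
    \<Longrightarrow> ident N a \<star> (g \<cdot> f) = (ident N a \<star> g) \<cdot> (ident N a \<star> f)"
  by (simp add: ten_comp)

lemma whisker_right:
  "\<lbrakk>f \<in> Mor N; g \<in> Mor N; Cod N f = Dom N g; a \<in> Obj N\<rbrakk>
    \<Longrightarrow> (g \<cdot> f) \<star> ident N a = (g \<star> ident N a) \<cdot> (f \<star> ident N a)"
  by (simp add: ten_comp)

lemma whisker_right2:
  "\<lbrakk>f \<in> Mor N; g \<in> Mor N; Cod N f = Dom N g; a \<in> Obj N; b \<in> Obj N\<rbrakk>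
    \<Longrightarrow> (g \<cdot> f) \<star> ident N a \<star> ident N b
      = (g \<star> ident N a \<star> ident N b) \<cdot> (f \<star> ident N a \<star> ident N b)"
  by (simp add: ten_comp)

text \<open>With these equations a string diagram is cut into horizontal slices, each of which carries a single
non-identity box.\<close>

lemmas slice = whisker_left whisker_right whisker_right2 ident_ten

text \<open>Two boxes on disjoint strands may be moved past each other, as both orders compose to \<open>f \<star> g\<close>.\<close>

lemma slide:
  assumes "f \<in> Mor N" "g \<in> Mor N" "Dom N f = a" "Cod N f = a'" "Dom N g = b" "Cod N g = b'"
  shows "(ident N a' \<star> g) \<cdot> (f \<star> ident N b) = f \<star> g"
    "(f \<star> ident N b') \<cdot> (ident N a \<star> g) = f \<star> g"
  using assms by (auto simp: ten_comp)

text \<open>A hexagon whose arguments are units makes the braiding with the unit idempotent; being invertible, it is then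
the identity.\<close>

lemma iso_idempotent_ident:
  assumes "f \<in> isos N a a" "f \<cdot> f = f"
  shows "f = ident N a"
proof -
  obtain g where g: "g \<in> hom N a a" "g \<cdot> f = ident N a" and f: "f \<in> hom N a a"
    using assms(1) by (auto simp: isos_def)
  have "g \<cdot> (f \<cdot> f) = f"
    using comp_assoc[OF f f g(1)] g(2) comp_ident_left[OF f] by simp
  then show ?thesis using assms(2) g by simp
qed

lemma braid_unit_left [simp]: assumes "x \<in> Obj N" shows "\<Psi> \<I> x = ident N x"
  using hexagon_left[of \<I> \<I> x] braid_iso[of \<I> x] assms
  by (intro iso_idempotent_ident) auto

lemma braid_unit_right [simp]: assumes "x \<in> Obj N" shows "\<Psi> x \<I> = ident N x"
  using hexagon_right[of x \<I> \<I>] braid_iso[of x \<I>] assms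
  by (intro iso_idempotent_ident) auto

lemma iso_cancel:
  assumes "f \<in> isos N x y" "u \<in> hom N a x" "v \<in> hom N a x" "f \<cdot> u = f \<cdot> v"
  shows "u = v"
proof -
  obtain g where g: "g \<in> hom N y x" "g \<cdot> f = ident N x" and f: "f \<in> hom N x y"
    using assms(1) by (auto simp: isos_def)
  have "g \<cdot> (f \<cdot> w) = w" if "w \<in> hom N a x" for w
    using comp_assoc[OF that f g(1)] comp_ident_left[OF that] g(2) by (simp del: comp_assoc')
  then show ?thesis using assms(2-4) by metis
qed

lemma isos_comp:
  assumes "f \<in> isos N a b" "g \<in> isos N b c"
  shows "g \<cdot> f \<in> isos N a c"
proof -
  obtain f' g' where "f' \<in> hom N b a" "f' \<cdot> f = ident N a" "f \<cdot> f' = ident N b"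
    "g' \<in> hom N c b" "g' \<cdot> g = ident N b" "g \<cdot> g' = ident N c" "f \<in> hom N a b" "g \<in> hom N b c"
    using assms by (auto simp: isos_def)
  note a = this
  note ty = a[unfolded hom_def, simplified]
  have "(f' \<cdot> g') \<cdot> g \<cdot> f = f' \<cdot> ((g' \<cdot> g) \<cdot> f)" "(g \<cdot> f) \<cdot> f' \<cdot> g' = g \<cdot> ((f \<cdot> f') \<cdot> g')"
    using a(1,4,7,8) by (auto simp: hom_def)
  then have "(f' \<cdot> g') \<cdot> (g \<cdot> f) = ident N a" "(g \<cdot> f) \<cdot> (f' \<cdot> g') = ident N c"
    using ty by simp_all
  moreover have "f' \<cdot> g' \<in> hom N c a" "g \<cdot> f \<in> hom N a c"
    using ty by (auto simp: hom_def)
  ultimately show ?thesis by (auto simp: isos_def)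
qed

lemma isos_ten:
  assumes "f \<in> isos N a b" "g \<in> isos N c d"
  shows "f \<star> g \<in> isos N (a \<otimes> c) (b \<otimes> d)"
proof -
  obtain f' g' where "f' \<in> hom N b a" "f' \<cdot> f = ident N a" "f \<cdot> f' = ident N b"
    "g' \<in> hom N d c" "g' \<cdot> g = ident N c" "g \<cdot> g' = ident N d" "f \<in> hom N a b" "g \<in> hom N c d"
    using assms by (auto simp: isos_def)
  note a = this
  have ob: "a \<in> Obj N" "b \<in> Obj N" "c \<in> Obj N" "d \<in> Obj N" using a by (auto simp: hom_def)
  have "(f' \<star> g') \<cdot> (f \<star> g) = ident N (a \<otimes> c)" "(f \<star> g) \<cdot> (f' \<star> g') = ident N (b \<otimes> d)"
    using a ob by (auto simp: hom_def ten_comp ten_ident)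
  then show ?thesis
    using ten_arr_closed[OF a(1,4)] ten_arr_closed[OF a(7,8)] by (auto simp: isos_def)
qed

section \<open>Juxtaposition of actions\<close>

text \<open>An action is an arrow \<open>a \<otimes> x \<rightarrow> x'\<close>, with no law imposed. In a strict category its domain does not determine
\<open>a\<close> and \<open>x\<close>, so these are separate arguments.\<close>

definition juxt :: "'o \<Rightarrow> 'o \<Rightarrow> 'a \<Rightarrow> 'o \<Rightarrow> 'o \<Rightarrow> 'a \<Rightarrow> 'a" where
  "juxt a x \<alpha> c y \<beta> = (\<alpha> \<star> \<beta>) \<cdot> (ident N a \<star> \<Psi> c x \<star> ident N y)"

lemma juxt_closed:
  assumes "a \<in> Obj N" "x \<in> Obj N" "c \<in> Obj N" "y \<in> Obj N"
    and "\<alpha> \<in> hom N (a \<otimes> x) x'" "\<beta> \<in> hom N (c \<otimes> y) y'"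
  shows "juxt a x \<alpha> c y \<beta> \<in> hom N ((a \<otimes> c) \<otimes> (x \<otimes> y)) (x' \<otimes> y')"
  using assms by (simp add: juxt_def hom_def)

text \<open>Naturality of the braiding in the acting objects: \<open>g\<close> is moved through the crossing of \<open>c\<close> and \<open>x\<close>.\<close>

lemma juxt_precomp:
  assumes "x \<in> Obj N" "y \<in> Obj N"
    and "\<alpha> \<in> hom N (a \<otimes> x) x'" "\<beta> \<in> hom N (c \<otimes> y) y'" "f \<in> hom N a' a" "g \<in> hom N c' c"
  shows "juxt a' x (\<alpha> \<cdot> (f \<star> ident N x)) c' y (\<beta> \<cdot> (g \<star> ident N y))
    = juxt a x \<alpha> c y \<beta> \<cdot> ((f \<star> g) \<star> ident N (x \<otimes> y))"
proof -
  have ob: "a \<in> Obj N" "a' \<in> Obj N" "c \<in> Obj N" "c' \<in> Obj N" and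
    *: "f \<in> Mor N" "g \<in> Mor N" "\<alpha> \<in> Mor N" "\<beta> \<in> Mor N"
    "Dom N f = a'" "Cod N f = a" "Dom N g = c'" "Cod N g = c"
    "Dom N \<alpha> = a \<otimes> x" "Dom N \<beta> = c \<otimes> y"
    using assms by (auto simp: hom_def)
  have n: "\<Psi> c x \<cdot> (g \<star> ident N x) = (ident N x \<star> g) \<cdot> \<Psi> c' x"
    using braid_natural[of g c' c "ident N x" x x] assms by (simp add: hom_def)
  have "juxt a' x (\<alpha> \<cdot> (f \<star> ident N x)) c' y (\<beta> \<cdot> (g \<star> ident N y))
    = (\<alpha> \<star> \<beta>) \<cdot> (f \<star> (ident N x \<star> g) \<star> ident N y) \<cdot> (ident N a' \<star> \<Psi> c' x \<star> ident N y)"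
    using assms(1,2) ob *
      ten_comp[of "f \<star> ident N x" \<alpha> "g \<star> ident N y" \<beta>]
    by (simp add: juxt_def flip: comp_assoc')
  also have "(f \<star> (ident N x \<star> g) \<star> ident N y) \<cdot> (ident N a' \<star> \<Psi> c' x \<star> ident N y)
    = f \<star> (\<Psi> c x \<cdot> (g \<star> ident N x)) \<star> ident N y"
    using assms(1,2) ob * by (simp add: n ten_comp3 del: ten_arr_assoc)
  also have "\<dots> = (ident N a \<star> \<Psi> c x \<star> ident N y) \<cdot> (f \<star> g \<star> ident N (x \<otimes> y))"
    using assms(1,2) ob *
      ten_comp3[of "ident N a" f "\<Psi> c x" "g \<star> ident N x" "ident N y" "ident N y"]
    by (simp add: ident_ten)
  finally show ?thesis using assms(1,2) ob * by (simp add: juxt_def)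
qed

lemma juxt_precomp3:
  assumes "x \<in> Obj N" "y \<in> Obj N" "z \<in> Obj N"
    and "\<alpha> \<in> hom N (a \<otimes> x) x'" "\<beta> \<in> hom N (c \<otimes> y) y'" "\<gamma> \<in> hom N (e \<otimes> z) z'"
    and "f \<in> hom N a' a" "g \<in> hom N c' c" "h \<in> hom N e' e"
  shows "juxt a' x (\<alpha> \<cdot> (f \<star> ident N x)) (c' \<otimes> e') (y \<otimes> z)
      (juxt c' y (\<beta> \<cdot> (g \<star> ident N y)) e' z (\<gamma> \<cdot> (h \<star> ident N z)))
    = juxt a x \<alpha> (c \<otimes> e) (y \<otimes> z) (juxt c y \<beta> e z \<gamma>) \<cdot> ((f \<star> g \<star> h) \<star> ident N (x \<otimes> y \<otimes> z))"
proof -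
  have "c \<in> Obj N" "e \<in> Obj N" "g \<star> h \<in> hom N (c' \<otimes> e') (c \<otimes> e)"
    using assms by (auto simp: hom_def)
  moreover from this have "juxt c y \<beta> e z \<gamma> \<in> hom N ((c \<otimes> e) \<otimes> (y \<otimes> z)) (y' \<otimes> z')"
    using assms by (intro juxt_closed)
  ultimately show ?thesis
    using assms juxt_precomp[of y z \<beta> c y' \<gamma> e z' g c' h e']
      juxt_precomp[of x "y \<otimes> z" \<alpha> a x' "juxt c y \<beta> e z \<gamma>" "c \<otimes> e" "y' \<otimes> z'" f a' "g \<star> h"]
    by simp
qed

lemma juxt_unit_left:
  "\<lbrakk>c \<in> Obj N; y \<in> Obj N; \<beta> \<in> hom N (c \<otimes> y) y'\<rbrakk> \<Longrightarrow> juxt \<I> \<I> (ident N \<I>) c y \<beta> = \<beta>"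
  by (simp add: juxt_def hom_def flip: ident_ten)

lemma juxt_unit_right:
  "\<lbrakk>a \<in> Obj N; x \<in> Obj N; \<alpha> \<in> hom N (a \<otimes> x) x'\<rbrakk> \<Longrightarrow> juxt a x \<alpha> \<I> \<I> (ident N \<I>) = \<alpha>"
  by (simp add: juxt_def hom_def flip: ident_ten)

text \<open>The condition makes the crossing of \<open>c\<close> with \<open>x\<close> the identity.\<close>

lemma juxt_idents:
  "\<lbrakk>a \<in> Obj N; c \<in> Obj N; x \<in> Obj N; y \<in> Obj N; x = \<I> \<or> c = \<I>\<rbrakk>
    \<Longrightarrow> juxt a x (ident N (a \<otimes> x)) c y (ident N (c \<otimes> y)) = ident N (a \<otimes> c \<otimes> x \<otimes> y)"
  by (auto simp: juxt_def simp flip: ident_ten)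

text \<open>Naturality of the braiding in the objects acted upon: \<open>f\<close> is moved through the crossing of \<open>c\<close> and \<open>x\<close>.\<close>

lemma juxt_intertwine:
  assumes "a \<in> Obj N" "c \<in> Obj N"
    and "\<alpha> \<in> hom N (a \<otimes> x) z" "\<alpha>' \<in> hom N (a \<otimes> x') z'" "\<beta> \<in> hom N (c \<otimes> y) w" "\<beta>' \<in> hom N (c \<otimes> y') w'"
    and "f \<in> hom N x x'" "g \<in> hom N y y'" "f' \<in> hom N z z'" "g' \<in> hom N w w'"
    and "f' \<cdot> \<alpha> = \<alpha>' \<cdot> (ident N a \<star> f)" "g' \<cdot> \<beta> = \<beta>' \<cdot> (ident N c \<star> g)"
  shows "(f' \<star> g') \<cdot> juxt a x \<alpha> c y \<beta> = juxt a x' \<alpha>' c y' \<beta>' \<cdot> (ident N (a \<otimes> c) \<star> (f \<star> g))"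
proof -
  have ob: "x \<in> Obj N" "y \<in> Obj N" "x' \<in> Obj N" "y' \<in> Obj N"
    using assms by (auto simp: hom_def)
  have * : "f \<in> Mor N" "g \<in> Mor N" "f' \<in> Mor N" "g' \<in> Mor N" "\<alpha> \<in> Mor N" "\<beta> \<in> Mor N" "\<alpha>' \<in> Mor N" "\<beta>' \<in> Mor N"
    "Dom N f = x" "Cod N f = x'" "Dom N g = y" "Cod N g = y'"
    "Dom N f' = z" "Cod N f' = z'" "Dom N g' = w" "Cod N g' = w'"
    "Dom N \<alpha> = a \<otimes> x" "Dom N \<beta> = c \<otimes> y" "Cod N \<alpha> = z" "Cod N \<beta> = w"
    "Dom N \<alpha>' = a \<otimes> x'" "Dom N \<beta>' = c \<otimes> y'" "Cod N \<alpha>' = z'" "Cod N \<beta>' = w'"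
    using assms by (auto simp: hom_def)
  have n: "\<Psi> c x' \<cdot> (ident N c \<star> f) = (f \<star> ident N c) \<cdot> \<Psi> c x"
    using braid_natural[of "ident N c" c c f x x'] assms by (simp add: hom_def)
  have "(f' \<star> g') \<cdot> juxt a x \<alpha> c y \<beta>
    = ((f' \<cdot> \<alpha>) \<star> (g' \<cdot> \<beta>)) \<cdot> (ident N a \<star> \<Psi> c x \<star> ident N y)"
    using assms(1,2) ob * ten_comp[of \<alpha> f' \<beta> g'] by (simp add: juxt_def flip: comp_assoc')
  also have "\<dots> = (\<alpha>' \<star> \<beta>') \<cdot> (ident N a \<star> (f \<star> ident N c) \<star> g) \<cdot> (ident N a \<star> \<Psi> c x \<star> ident N y)"
    using assms(1,2) ob * ten_comp[of "ident N a \<star> f" \<alpha>' "ident N c \<star> g" \<beta>']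
    by (simp add: assms(11,12) flip: comp_assoc')
  also have "(ident N a \<star> (f \<star> ident N c) \<star> g) \<cdot> (ident N a \<star> \<Psi> c x \<star> ident N y)
    = ident N a \<star> (\<Psi> c x' \<cdot> (ident N c \<star> f)) \<star> g"
    using assms(1,2) ob * by (simp add: n ten_comp3 del: ten_arr_assoc)
  also have "\<dots> = (ident N a \<star> \<Psi> c x' \<star> ident N y') \<cdot> (ident N (a \<otimes> c) \<star> (f \<star> g))"
    using assms(1,2) ob *
      ten_comp3[of "ident N a" "ident N a" "\<Psi> c x'" "ident N c \<star> f" "ident N y'" g]
    by (simp add: ident_ten)
  finally show ?thesis using assms(1,2) ob * by (simp add: juxt_def)
qed

text \<open>Both sides are \<open>\<alpha> \<star> \<beta> \<star> \<gamma>\<close> after the braid that moves \<open>c\<close> past \<open>x\<close>, and \<open>e\<close> past \<open>x\<close> and \<open>y\<close>.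
The left side has the factor \<open>\<Psi> e (x \<otimes> y)\<close> and the right side the factor \<open>\<Psi> (c \<otimes> e) x\<close>; the hexagons
split both, and then only the crossings of \<open>c\<close> with \<open>x\<close> and of \<open>e\<close> with \<open>y\<close> come in a different order. These are
on disjoint strands.\<close>

lemma juxt_assoc:
  assumes "a \<in> Obj N" "x \<in> Obj N" "c \<in> Obj N" "y \<in> Obj N" "e \<in> Obj N" "z \<in> Obj N"
    and "\<alpha> \<in> hom N (a \<otimes> x) x'" "\<beta> \<in> hom N (c \<otimes> y) y'" "\<gamma> \<in> hom N (e \<otimes> z) z'"
  shows "juxt (a \<otimes> c) (x \<otimes> y) (juxt a x \<alpha> c y \<beta>) e z \<gamma>
    = juxt a x \<alpha> (c \<otimes> e) (y \<otimes> z) (juxt c y \<beta> e z \<gamma>)"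
proof -
  have * : "\<alpha> \<in> Mor N" "\<beta> \<in> Mor N" "\<gamma> \<in> Mor N"
    "Dom N \<alpha> = a \<otimes> x" "Dom N \<beta> = c \<otimes> y" "Dom N \<gamma> = e \<otimes> z"
    using assms by (auto simp: hom_def)
  have "juxt (a \<otimes> c) (x \<otimes> y) (juxt a x \<alpha> c y \<beta>) e z \<gamma>
    = (\<alpha> \<star> \<beta> \<star> \<gamma>) \<cdot> (ident N a \<star> \<Psi> c x \<star> ident N (y \<otimes> e \<otimes> z))
      \<cdot> (ident N (a \<otimes> c) \<star> \<Psi> e (x \<otimes> y) \<star> ident N z)"
    using assms(1-6) * ten_comp[of "ident N a \<star> \<Psi> c x \<star> ident N y" "\<alpha> \<star> \<beta>" "ident N (e \<otimes> z)" \<gamma>]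
    by (simp add: juxt_def ident_ten[of a c] ident_ten[of y] flip: comp_assoc')
  also have "\<dots> = (\<alpha> \<star> \<beta> \<star> \<gamma>) \<cdot> (ident N a \<star> \<Psi> c x \<star> \<Psi> e y \<star> ident N z)
      \<cdot> (ident N (a \<otimes> c) \<star> \<Psi> e x \<star> ident N (y \<otimes> z))"
    using assms(1-6) *
      slide(2)[of "ident N a \<star> \<Psi> c x" "\<Psi> e y \<star> ident N z" "a \<otimes> c \<otimes> x" "a \<otimes> x \<otimes> c"
        "e \<otimes> y \<otimes> z" "y \<otimes> e \<otimes> z"]
    by (simp add: hexagon_right slice flip: comp_assoc')
  also have "\<dots> = (\<alpha> \<star> \<beta> \<star> \<gamma>) \<cdot> (ident N (a \<otimes> x \<otimes> c) \<star> \<Psi> e y \<star> ident N z)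
      \<cdot> (ident N a \<star> \<Psi> (c \<otimes> e) x \<star> ident N (y \<otimes> z))"
    using assms(1-6) *
      slide(1)[of "ident N a \<star> \<Psi> c x" "\<Psi> e y \<star> ident N z" "a \<otimes> c \<otimes> x" "a \<otimes> x \<otimes> c"
        "e \<otimes> y \<otimes> z" "y \<otimes> e \<otimes> z"]
    by (simp add: hexagon_left slice flip: comp_assoc')
  also have "\<dots> = juxt a x \<alpha> (c \<otimes> e) (y \<otimes> z) (juxt c y \<beta> e z \<gamma>)"
    using assms(1-6) * ten_comp[of "ident N (a \<otimes> x)" \<alpha> "ident N c \<star> \<Psi> e y \<star> ident N z" "\<beta> \<star> \<gamma>"]
      ident_ten[of "a \<otimes> x" c]
    by (simp add: juxt_def flip: comp_assoc')
  finally show ?thesis .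
qed

text \<open>Acting twice with a juxtaposition is the juxtaposition of the double actions, up to the crossing of \<open>c\<close> with
\<open>a'\<close>. That crossing is the one in the product of a braided tensor product of algebras, which is why modules
tensor to modules over it.\<close>

lemma juxt_comp:
  assumes "a \<in> Obj N" "c \<in> Obj N" "a' \<in> Obj N" "c' \<in> Obj N"
    "x' \<in> Obj N" "y' \<in> Obj N"
    and "\<alpha> \<in> hom N (a \<otimes> x) x''" "\<beta> \<in> hom N (c \<otimes> y) y''"
    and "\<alpha>' \<in> hom N (a' \<otimes> x') x" "\<beta>' \<in> hom N (c' \<otimes> y') y"
  shows "juxt a x \<alpha> c y \<beta> \<cdot> (ident N (a \<otimes> c) \<star> juxt a' x' \<alpha>' c' y' \<beta>')
    = juxt (a \<otimes> a') x' (\<alpha> \<cdot> (ident N a \<star> \<alpha>')) (c \<otimes> c') y' (\<beta> \<cdot> (ident N c \<star> \<beta>'))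
      \<cdot> ((ident N a \<star> \<Psi> c a' \<star> ident N c') \<star> ident N (x' \<otimes> y'))"
proof -
  have ob: "x \<in> Obj N" "y \<in> Obj N"
    using assms by (auto simp: hom_def)
  have * : "\<alpha> \<in> Mor N" "\<beta> \<in> Mor N" "\<alpha>' \<in> Mor N" "\<beta>' \<in> Mor N"
    "Dom N \<alpha> = a \<otimes> x" "Dom N \<beta> = c \<otimes> y" "Dom N \<alpha>' = a' \<otimes> x'" "Dom N \<beta>' = c' \<otimes> y'"
    "Cod N \<alpha>' = x" "Cod N \<beta>' = y"
    using assms by (auto simp: hom_def)
  note [simp] = assms(1-6) ob *
  let ?K = "(\<alpha> \<cdot> (ident N a \<star> \<alpha>')) \<star> (\<beta> \<cdot> (ident N c \<star> \<beta>'))"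
  have n: "\<Psi> c x \<cdot> (ident N c \<star> \<alpha>') = (\<alpha>' \<star> ident N c) \<cdot> \<Psi> c (a' \<otimes> x')"
    using braid_natural[of "ident N c" c c \<alpha>' "a' \<otimes> x'" x] assms by (simp add: hom_def)
  \<comment> \<open>The braiding is natural in its second argument, so \<open>\<alpha>'\<close> may act before or after \<open>c\<close> crosses.\<close>
  have mid: "(ident N a \<star> \<Psi> c x \<star> ident N y) \<cdot> (ident N (a \<otimes> c) \<star> \<alpha>' \<star> \<beta>')
    = (ident N a \<star> \<alpha>' \<star> ident N c \<star> \<beta>') \<cdot> (ident N a \<star> \<Psi> c (a' \<otimes> x') \<star> ident N (c' \<otimes> y'))"
    using ten_comp3[of "ident N a" "ident N a" "\<Psi> c x" "ident N c \<star> \<alpha>'" "ident N y" \<beta>']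
      ten_comp3[of "ident N a" "ident N a" "\<alpha>' \<star> ident N c" "\<Psi> c (a' \<otimes> x')" \<beta>' "ident N (c' \<otimes> y')"]
    by (simp add: n ident_ten[of a c])
  have "juxt a x \<alpha> c y \<beta> \<cdot> (ident N (a \<otimes> c) \<star> juxt a' x' \<alpha>' c' y' \<beta>')
    = (\<alpha> \<star> \<beta>) \<cdot> ((ident N a \<star> \<Psi> c x \<star> ident N y) \<cdot> (ident N (a \<otimes> c) \<star> \<alpha>' \<star> \<beta>'))
      \<cdot> (ident N (a \<otimes> c \<otimes> a') \<star> \<Psi> c' x' \<star> ident N y')"
    by (simp add: juxt_def slice)
  also have "\<dots> = ?K \<cdot> (ident N a \<star> \<Psi> c (a' \<otimes> x') \<star> ident N (c' \<otimes> y'))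
      \<cdot> (ident N (a \<otimes> c \<otimes> a') \<star> \<Psi> c' x' \<star> ident N y')"
    using ten_comp[of "ident N a \<star> \<alpha>'" \<alpha> "ident N c \<star> \<beta>'" \<beta>]
    by (simp add: mid flip: comp_assoc')
  also have "\<dots> = ?K \<cdot> (ident N (a \<otimes> a') \<star> \<Psi> c x' \<star> ident N (c' \<otimes> y'))
      \<cdot> (ident N a \<star> \<Psi> c a' \<star> \<Psi> c' x' \<star> ident N y')"
    using slide(2)[of "ident N a \<star> \<Psi> c a'" "\<Psi> c' x' \<star> ident N y'" "a \<otimes> c \<otimes> a'" "a \<otimes> a' \<otimes> c"
        "c' \<otimes> x' \<otimes> y'" "x' \<otimes> c' \<otimes> y'"]
    by (simp add: hexagon_right slice)
  also have "\<dots> = ?K \<cdot> (ident N (a \<otimes> a') \<star> \<Psi> (c \<otimes> c') x' \<star> ident N y')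
      \<cdot> (ident N a \<star> \<Psi> c a' \<star> ident N (c' \<otimes> x' \<otimes> y'))"
    using slide(1)[of "ident N a \<star> \<Psi> c a'" "\<Psi> c' x' \<star> ident N y'" "a \<otimes> c \<otimes> a'" "a \<otimes> a' \<otimes> c"
        "c' \<otimes> x' \<otimes> y'" "x' \<otimes> c' \<otimes> y'"]
    by (simp add: hexagon_left slice)
  finally show ?thesis by (simp add: juxt_def ident_ten)
qed

section \<open>Diagonal actions\<close>

text \<open>A left action without associativity and unit law. Equivariance makes sense in this generality, which is needed
because the actions are available before \<open>B\<close> is known to be an algebra.\<close>

definition preaction :: "'o \<Rightarrow> ('o, 'a) lmod \<Rightarrow> bool" where
  "preaction b m \<longleftrightarrow> fst m \<in> Obj N \<and> snd m \<in> hom N (b \<otimes> fst m) (fst m)"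

lemma obj_power_closed [simp]: "b \<in> Obj N \<Longrightarrow> obj_power N b n \<in> Obj N"
  by (induction n) auto

lemma ten_objs_Nil [simp]: "ten_objs N [] = \<I>"
  and ten_objs_Cons [simp]: "ten_objs N (x # xs) = x \<otimes> ten_objs N xs"
  and ten_arrs_Nil [simp]: "ten_arrs N [] = ident N \<I>"
  and ten_arrs_Cons [simp]: "ten_arrs N (f # fs) = f \<star> ten_arrs N fs"
  by (auto simp: ten_objs_def ten_arrs_def)

lemma ten_objs_closed [simp]: "set xs \<subseteq> Obj N \<Longrightarrow> ten_objs N xs \<in> Obj N"
  by (induction xs) auto

lemma interleave_closed:
  assumes "b \<in> Obj N"
  shows "set xs \<subseteq> Obj N \<Longrightarrow> interleave N b xs
    \<in> hom N (obj_power N b (length xs) \<otimes> ten_objs N xs) (ten_objs N (map (\<lambda>x. b \<otimes> x) xs))"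
proof (induction xs)
  case (Cons x xs)
  then have "ten_objs N (map (\<lambda>x. b \<otimes> x) xs) \<in> Obj N" "ten_objs N xs \<in> Obj N"
    using assms by (auto intro!: ten_objs_closed ten_obj_closed)
  with Cons show ?case using assms by (simp add: hom_def)
qed (simp add: hom_def)

lemma ten_arrs_closed:
  assumes "\<And>m. m \<in> set ms \<Longrightarrow> f m \<in> hom N (d m) (c m)"
  shows "ten_arrs N (map f ms) \<in> hom N (ten_objs N (map d ms)) (ten_objs N (map c ms))"
  using assms by (induction ms) (auto simp: hom_def)

lemma diag_action_closed:
  assumes "b \<in> Obj N" "\<forall>m \<in> set ms. preaction b m"
  shows "diag_action N b ms
    \<in> hom N (obj_power N b (length ms) \<otimes> ten_objs N (map fst ms)) (ten_objs N (map fst ms))"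
proof -
  have "set (map fst ms) \<subseteq> Obj N" using assms by (auto simp: preaction_def)
  then show ?thesis
    using interleave_closed[of b "map fst ms"] assms
      ten_arrs_closed[of ms snd "\<lambda>m. b \<otimes> fst m" fst]
    by (auto simp: preaction_def diag_action_def o_def hom_def)
qed

lemma diag_action_Nil [simp]: "diag_action N b [] = ident N \<I>"
  by (simp add: diag_action_def)

text \<open>The recursion of \<open>interleave\<close> moves the last acting factors past the first object, so each step of the diagonal
action is one juxtaposition.\<close>

lemma diag_action_Cons:
  assumes "b \<in> Obj N" "preaction b m" "\<forall>m \<in> set ms. preaction b m"
  shows "diag_action N b (m # ms)
    = juxt b (fst m) (snd m) (obj_power N b (length ms)) (ten_objs N (map fst ms)) (diag_action N b ms)"
proof -
  have "set (map fst ms) \<subseteq> Obj N" using assms by (auto simp: preaction_def)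
  then show ?thesis
    using assms ten_arrs_closed[of ms snd "\<lambda>m. b \<otimes> fst m" fst] interleave_closed[of b "map fst ms"]
      ten_comp[of "ident N (b \<otimes> fst m)" "snd m" "interleave N b (map fst ms)" "ten_arrs N (map snd ms)"]
    by (auto simp: diag_action_def juxt_def hom_def preaction_def o_def simp flip: comp_assoc')
qed

lemma diag_action_1:
  assumes "b \<in> Obj N" "preaction b m"
  shows "diag_action N b [m] = snd m"
  using assms diag_action_Cons[of b m "[]"] juxt_unit_right by (auto simp: preaction_def)

lemma diag_action_2:
  assumes "b \<in> Obj N" "preaction b m" "preaction b n"
  shows "diag_action N b [m, n] = juxt b (fst m) (snd m) b (fst n) (snd n)"
  using assms diag_action_Cons[of b m "[n]"] diag_action_1[of b n] by (auto simp: preaction_def)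

lemma diag_action_3:
  assumes "b \<in> Obj N" "preaction b l" "preaction b m" "preaction b n"
  shows "diag_action N b [l, m, n] = juxt b (fst l) (snd l) (b \<otimes> b) (fst m \<otimes> fst n)
    (juxt b (fst m) (snd m) b (fst n) (snd n))"
  using assms diag_action_Cons[of b l "[m, n]"] diag_action_2[of b m n] by (auto simp: preaction_def)

section \<open>Equivariant arrows\<close>

definition equivariant :: "'o \<Rightarrow> ('o, 'a) lmod \<Rightarrow> 'a \<Rightarrow> ('o, 'a) lmod \<Rightarrow> bool" where
  "equivariant b m f n \<longleftrightarrow> preaction b m \<and> preaction b n \<and> f \<in> hom N (fst m) (fst n) \<and>
     f \<cdot> snd m = snd n \<cdot> (ident N b \<star> f)"

lemma equivariant_ident:
  assumes "b \<in> Obj N" "preaction b m"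
  shows "equivariant b m (ident N (fst m)) m"
  using assms by (simp add: equivariant_def preaction_def hom_def ten_ident)

lemma equivariant_comp:
  assumes "b \<in> Obj N" "equivariant b l f m" "equivariant b m g n"
  shows "equivariant b l (g \<cdot> f) n"
proof -
  note a = assms(2,3)[unfolded equivariant_def preaction_def]
  have ty: "f \<in> Mor N" "g \<in> Mor N" "snd l \<in> Mor N" "snd m \<in> Mor N" "snd n \<in> Mor N"
    "Dom N f = fst l" "Cod N f = fst m" "Dom N g = fst m" "Cod N g = fst n"
    "Cod N (snd l) = fst l" "Dom N (snd m) = b \<otimes> fst m" "Cod N (snd m) = fst m"
    "Dom N (snd n) = b \<otimes> fst n"
    using a by (auto simp: hom_def)
  have "(g \<cdot> f) \<cdot> snd l = g \<cdot> (f \<cdot> snd l)"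
    using ty by simp
  also have "f \<cdot> snd l = snd m \<cdot> (ident N b \<star> f)"
    using a by simp
  also have "g \<cdot> (snd m \<cdot> (ident N b \<star> f)) = (g \<cdot> snd m) \<cdot> (ident N b \<star> f)"
    using ty assms by simp
  also have "g \<cdot> snd m = snd n \<cdot> (ident N b \<star> g)"
    using a by simp
  also have "(snd n \<cdot> (ident N b \<star> g)) \<cdot> (ident N b \<star> f) = snd n \<cdot> (ident N b \<star> (g \<cdot> f))"
    using ty assms by (simp add: whisker_left)
  finally show ?thesis using assms(1) a comp_closed by (auto simp: equivariant_def preaction_def)
qed

text \<open>This is how naturality of a transported action is obtained: compose with the isomorphism along which it was
transported.\<close>

lemma equivariant_cancel:
  assumes "b \<in> Obj N" "equivariant b m (k \<cdot> h) n" "equivariant b m' k n"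
    "k \<in> isos N (fst m') (fst n)" "h \<in> hom N (fst m) (fst m')"
  shows "equivariant b m h m'"
proof -
  note a = assms(2,3)[unfolded equivariant_def preaction_def] assms(5)
  have ty: "h \<in> Mor N" "k \<in> Mor N" "snd m \<in> Mor N" "snd m' \<in> Mor N" "snd n \<in> Mor N"
    "Dom N h = fst m" "Cod N h = fst m'" "Dom N k = fst m'" "Cod N k = fst n"
    "Dom N (snd m) = b \<otimes> fst m" "Cod N (snd m) = fst m" "Dom N (snd m') = b \<otimes> fst m'"
    "Cod N (snd m') = fst m'" "Dom N (snd n) = b \<otimes> fst n" "fst m \<in> Obj N" "fst m' \<in> Obj N"
    using a by (auto simp: hom_def)
  have "k \<cdot> (h \<cdot> snd m) = (k \<cdot> h) \<cdot> snd m" using ty by simp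
  also have "\<dots> = snd n \<cdot> (ident N b \<star> (k \<cdot> h))" using a by simp
  also have "\<dots> = (snd n \<cdot> (ident N b \<star> k)) \<cdot> (ident N b \<star> h)"
    using ty assms(1) by (simp add: whisker_left)
  also have "snd n \<cdot> (ident N b \<star> k) = k \<cdot> snd m'" using a by simp
  also have "(k \<cdot> snd m') \<cdot> (ident N b \<star> h) = k \<cdot> (snd m' \<cdot> (ident N b \<star> h))"
    using ty assms(1) by simp
  finally have "h \<cdot> snd m = snd m' \<cdot> (ident N b \<star> h)"
    using ty assms(1) by - (rule iso_cancel[OF assms(4), where a = "b \<otimes> fst m"], auto simp: hom_def)
  then show ?thesis using a by (simp add: equivariant_def preaction_def)
qed

text \<open>The uniqueness behind every axiom of the reconstructed bialgebra: an isomorphism \<open>f\<close> leaves only one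
action on its source for which it is equivariant, namely \<open>f\<inverse> \<cdot> snd n \<cdot> (ident N b \<star> f)\<close>.\<close>

lemma equivariant_source_unique:
  assumes "equivariant b m f n" "equivariant b m' f n" "f \<in> isos N (fst m) (fst n)"
  shows "m = m'"
proof (rule prod_eqI)
  show fst: "fst m = fst m'" using assms by (simp add: equivariant_def hom_def)
  show "snd m = snd m'"
    using assms fst by - (rule iso_cancel[OF assms(3)], auto simp: equivariant_def preaction_def)
qed

lemma transported_preaction:
  assumes "b \<in> Obj N" "f \<in> isos N x (fst n)" "preaction b n"
  obtains \<alpha> where "equivariant b (x, \<alpha>) f n"
proof -
  obtain g where g: "g \<in> hom N (fst n) x" "f \<cdot> g = ident N (fst n)" and f: "f \<in> hom N x (fst n)"
    using assms(2) by (auto simp: isos_def)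
  note ty = g(1)[unfolded hom_def, simplified] f[unfolded hom_def, simplified]
    assms(3)[unfolded preaction_def hom_def, simplified]
  have "f \<cdot> (g \<cdot> (snd n \<cdot> (ident N b \<star> f))) = (f \<cdot> g) \<cdot> (snd n \<cdot> (ident N b \<star> f))"
    using ty assms(1) by (intro comp_assoc'[symmetric]) auto
  then have "f \<cdot> (g \<cdot> (snd n \<cdot> (ident N b \<star> f))) = snd n \<cdot> (ident N b \<star> f)"
    using ty assms(1) g(2) by simp
  moreover have "x \<in> Obj N" using ty by auto
  ultimately have "equivariant b (x, g \<cdot> snd n \<cdot> (ident N b \<star> f)) f n"
    using ty assms(1) by (simp add: equivariant_def preaction_def hom_def)
  then show thesis using that by blast
qed

lemma pull_eq_iff:
  "pull_mod N f m = pull_mod N g m \<longleftrightarrow> snd m \<cdot> (f \<star> ident N (fst m)) = snd m \<cdot> (g \<star> ident N (fst m))"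
  by (simp add: pull_mod_def)

lemma equivariant_pull:
  assumes "equivariant c m f n" "g \<in> hom N b c"
  shows "equivariant b (pull_mod N g m) f (pull_mod N g n)"
proof -
  note a = assms[unfolded equivariant_def preaction_def]
  have ty: "f \<in> Mor N" "g \<in> Mor N" "snd m \<in> Mor N" "snd n \<in> Mor N" "Dom N g = b" "Cod N g = c"
    "Dom N f = fst m" "Cod N f = fst n" "Dom N (snd m) = c \<otimes> fst m" "Cod N (snd m) = fst m"
    "Dom N (snd n) = c \<otimes> fst n" "Cod N (snd n) = fst n" "fst m \<in> Obj N" "fst n \<in> Obj N" "b \<in> Obj N" "c \<in> Obj N"
    using a by (auto simp: hom_def)
  have "f \<cdot> (snd m \<cdot> (g \<star> ident N (fst m))) = (f \<cdot> snd m) \<cdot> (g \<star> ident N (fst m))"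
    using ty by simp
  also have "f \<cdot> snd m = snd n \<cdot> (ident N c \<star> f)" using a by simp
  also have "(snd n \<cdot> (ident N c \<star> f)) \<cdot> (g \<star> ident N (fst m))
    = (snd n \<cdot> (g \<star> ident N (fst n))) \<cdot> (ident N b \<star> f)"
    using ty by (simp add: slide)
  finally show ?thesis
    using ty by (simp add: equivariant_def preaction_def pull_mod_def hom_def)
qed

section \<open>Algebras and modules\<close>

text \<open>The typing part of an algebra. Modules over such data make sense before associativity has been shown.\<close>

definition alg_data :: "('o, 'a, 'x) alg_scheme \<Rightarrow> bool" where
  "alg_data A \<longleftrightarrow> car A \<in> Obj N \<and> mlt A \<in> hom N (car A \<otimes> car A) (car A) \<and> aunit A \<in> hom N \<I> (car A)"

lemma alg_data_unit_alg: "alg_data (unit_alg N)"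
  by (simp add: alg_data_def unit_alg_def hom_def)

lemma alg_data_alg_tensor: "\<lbrakk>alg_data A; alg_data C\<rbrakk> \<Longrightarrow> alg_data (alg_tensor N A C)"
  by (simp add: alg_data_def alg_tensor_def hom_def)

lemma preaction_if_module: "is_module N A m \<Longrightarrow> preaction (car A) m"
  by (simp add: is_module_def preaction_def)

text \<open>The product of the tensor algebra contains the crossing that \<open>juxt_comp\<close> produces.\<close>

lemma juxt_module:
  assumes "alg_data A" "alg_data C" "is_module N A m" "is_module N C n"
  shows "is_module N (alg_tensor N A C)
    (fst m \<otimes> fst n, juxt (car A) (fst m) (snd m) (car C) (fst n) (snd n))"
proof -
  obtain x \<alpha> y \<beta> where mn: "m = (x, \<alpha>)" "n = (y, \<beta>)" by fastforce
  let ?a = "car A" and ?c = "car C"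
  let ?J = "juxt ?a x \<alpha> ?c y \<beta>"
  note h = assms[unfolded mn alg_data_def is_module_def, simplified]
  have J: "?J \<in> hom N ((?a \<otimes> ?c) \<otimes> (x \<otimes> y)) (x \<otimes> y)"
    using h by (intro juxt_closed) auto
  have "?J \<cdot> (mlt (alg_tensor N A C) \<star> ident N (x \<otimes> y))
    = ?J \<cdot> (((mlt A \<star> mlt C) \<star> ident N (x \<otimes> y))
        \<cdot> ((ident N ?a \<star> \<Psi> ?c ?a \<star> ident N ?c) \<star> ident N (x \<otimes> y)))"
    using h whisker_right[of "ident N ?a \<star> \<Psi> ?c ?a \<star> ident N ?c" "mlt A \<star> mlt C" "x \<otimes> y"]
    by (simp add: alg_tensor_def hom_def)
  also have "\<dots> = (?J \<cdot> ((mlt A \<star> mlt C) \<star> ident N (x \<otimes> y)))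
        \<cdot> ((ident N ?a \<star> \<Psi> ?c ?a \<star> ident N ?c) \<star> ident N (x \<otimes> y))"
    using h J by (simp add: hom_def)
  also have "?J \<cdot> ((mlt A \<star> mlt C) \<star> ident N (x \<otimes> y))
    = juxt (?a \<otimes> ?a) x (\<alpha> \<cdot> (ident N ?a \<star> \<alpha>)) (?c \<otimes> ?c) y (\<beta> \<cdot> (ident N ?c \<star> \<beta>))"
    using h juxt_precomp[of x y \<alpha> ?a x \<beta> ?c y "mlt A" "?a \<otimes> ?a" "mlt C" "?c \<otimes> ?c"] by simp
  also have "\<dots> \<cdot> ((ident N ?a \<star> \<Psi> ?c ?a \<star> ident N ?c) \<star> ident N (x \<otimes> y))
    = ?J \<cdot> (ident N (?a \<otimes> ?c) \<star> ?J)"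
    using h juxt_comp[of ?a ?c ?a ?c x y \<alpha> x x \<beta> y y \<alpha> \<beta>] by simp
  finally have 1: "?J \<cdot> (mlt (alg_tensor N A C) \<star> ident N (x \<otimes> y)) = ?J \<cdot> (ident N (?a \<otimes> ?c) \<star> ?J)" .
  have 2: "?J \<cdot> (aunit (alg_tensor N A C) \<star> ident N (x \<otimes> y)) = ident N (x \<otimes> y)"
    using h juxt_precomp[of x y \<alpha> ?a x \<beta> ?c y "aunit A" "\<I>" "aunit C" "\<I>"]
    by (simp add: alg_tensor_def juxt_def flip: ident_ten)
  show ?thesis using h J 1 2 by (simp add: mn is_module_def alg_tensor_def)
qed

text \<open>Read from right to left, algebra morphisms pull modules back to modules. Read from left to right, if enough
modules pull back to modules to be jointly faithful, then \<open>f\<close> is an algebra morphism.\<close>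

lemma pull_mod_module_iff:
  assumes "alg_data A" "alg_data C" "is_module N C m" "f \<in> hom N (car A) (car C)"
  shows "is_module N A (pull_mod N f m) \<longleftrightarrow>
    snd m \<cdot> ((f \<cdot> mlt A) \<star> ident N (fst m)) = snd m \<cdot> ((mlt C \<cdot> (f \<star> f)) \<star> ident N (fst m)) \<and>
    snd m \<cdot> ((f \<cdot> aunit A) \<star> ident N (fst m)) = snd m \<cdot> (aunit C \<star> ident N (fst m))"
proof -
  obtain x \<alpha> where m: "m = (x, \<alpha>)" by fastforce
  note h = assms[unfolded m alg_data_def is_module_def, simplified]
  have *: "f \<in> Mor N" "mlt A \<in> Mor N" "mlt C \<in> Mor N" "\<alpha> \<in> Mor N" "aunit A \<in> Mor N" "aunit C \<in> Mor N"
    "Dom N f = car A" "Cod N f = car C" "Dom N (mlt A) = car A \<otimes> car A" "Cod N (mlt A) = car A"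
    "Dom N (mlt C) = car C \<otimes> car C" "Cod N (mlt C) = car C"  "Dom N (aunit A) = \<I>" "Cod N (aunit A) = car A"
    "Dom N (aunit C) = \<I>" "Cod N (aunit C) = car C" "Dom N \<alpha> = car C \<otimes> x" "Cod N \<alpha> = x"
    "car A \<in> Obj N" "car C \<in> Obj N" "x \<in> Obj N"
    using h by (auto simp: hom_def)
  have 1: "\<alpha> \<cdot> ((mlt C \<cdot> (f \<star> f)) \<star> ident N x)
      = (\<alpha> \<cdot> (f \<star> ident N x)) \<cdot> (ident N (car A) \<star> (\<alpha> \<cdot> (f \<star> ident N x)))"
  proof -
    have "\<alpha> \<cdot> ((mlt C \<cdot> (f \<star> f)) \<star> ident N x)
      = (\<alpha> \<cdot> (mlt C \<star> ident N x)) \<cdot> ((f \<star> f) \<star> ident N x)"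
      using * by (simp add: whisker_right)
    also have "\<dots> = \<alpha> \<cdot> ((ident N (car C) \<star> \<alpha>) \<cdot> (f \<star> f \<star> ident N x))"
      using * h by simp
    also have "(ident N (car C) \<star> \<alpha>) \<cdot> (f \<star> f \<star> ident N x)
      = (f \<star> ident N x) \<cdot> (ident N (car A) \<star> (\<alpha> \<cdot> (f \<star> ident N x)))"
      using * by (simp add: ten_comp)
    finally show ?thesis using * by simp
  qed
  have 2: "(\<alpha> \<cdot> (f \<star> ident N x)) \<cdot> (g \<star> ident N x) = \<alpha> \<cdot> ((f \<cdot> g) \<star> ident N x)"
    if "g \<in> Mor N" "Cod N g = car A" for g
    using that * by (simp add: whisker_right)
  show ?thesis
    using * h by (simp add: 1[symmetric] 2 is_module_def pull_mod_def m del: comp_assoc') (simp add: hom_def)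
qed

lemma module_transport:
  assumes "alg_data A" "is_module N A n" "f \<in> isos N (fst m) (fst n)" "equivariant (car A) m f n"
  shows "is_module N A m"
proof -
  obtain x \<alpha> y \<beta> where mn: "m = (x, \<alpha>)" "n = (y, \<beta>)" by fastforce
  note a = assms[unfolded alg_data_def is_module_def equivariant_def preaction_def mn, simplified]
  have *: "mlt A \<in> Mor N" "\<alpha> \<in> Mor N" "\<beta> \<in> Mor N" "f \<in> Mor N" "aunit A \<in> Mor N"
    "Dom N f = x" "Cod N f = y"
    "Dom N (mlt A) = car A \<otimes> car A" "Cod N (mlt A) = car A" "Dom N (aunit A) = \<I>" "Cod N (aunit A) = car A"
    "Dom N \<alpha> = car A \<otimes> x" "Cod N \<alpha> = x"  "Dom N \<beta> = car A \<otimes> y" "Cod N \<beta> = y"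
    "car A \<in> Obj N" "x \<in> Obj N" "y \<in> Obj N"
    using a by (auto simp: hom_def)
  have int: "f \<cdot> \<alpha> = \<beta> \<cdot> (ident N (car A) \<star> f)" using a by simp
  have cancel: "u = v" if "f \<cdot> u = f \<cdot> v" "u \<in> Mor N" "v \<in> Mor N" "Cod N u = x" "Cod N v = x" "Dom N u = Dom N v" for u v
    using that a by (intro iso_cancel[of f x y u "Dom N u" v]) (auto simp: hom_def)
  have sl: "(ident N (car A) \<star> f) \<cdot> (k \<star> ident N x) = (k \<star> ident N y) \<cdot> (ident N a \<star> f)"
    if "k \<in> Mor N" "Dom N k = a" "Cod N k = car A" for k a
    using that * by (simp add: slide)
  have "f \<cdot> (\<alpha> \<cdot> (mlt A \<star> ident N x)) = (\<beta> \<cdot> (mlt A \<star> ident N y)) \<cdot> (ident N (car A \<otimes> car A) \<star> f)"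
    using * sl[of "mlt A" "car A \<otimes> car A"] by (simp add: int flip: comp_assoc') simp
  also have "\<dots> = (\<beta> \<cdot> (ident N (car A) \<star> \<beta>)) \<cdot> (ident N (car A \<otimes> car A) \<star> f)"
    using a by simp
  also have "\<dots> = \<beta> \<cdot> (ident N (car A) \<star> (f \<cdot> \<alpha>))"
    using * whisker_left[of "ident N (car A) \<star> f" \<beta> "car A"] by (simp add: int ident_ten)
  also have "\<dots> = (\<beta> \<cdot> (ident N (car A) \<star> f)) \<cdot> (ident N (car A) \<star> \<alpha>)"
    using * by (simp add: whisker_left)
  also have "\<dots> = f \<cdot> (\<alpha> \<cdot> (ident N (car A) \<star> \<alpha>))"
    using * by (subst int[symmetric]) simp
  finally have 1: "\<alpha> \<cdot> (mlt A \<star> ident N x) = \<alpha> \<cdot> (ident N (car A) \<star> \<alpha>)"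
    using * by - (rule cancel, simp_all)
  have "f \<cdot> (\<alpha> \<cdot> (aunit A \<star> ident N x)) = (\<beta> \<cdot> (aunit A \<star> ident N y)) \<cdot> (ident N \<I> \<star> f)"
    using * sl[of "aunit A" \<I>] by (simp add: int del: ten_unit_left flip: comp_assoc') simp
  also have "\<dots> = f \<cdot> ident N x" using a * by simp
  finally have 2: "\<alpha> \<cdot> (aunit A \<star> ident N x) = ident N x"
    using * by - (rule cancel, simp_all)
  show ?thesis using a * 1 2 by (simp add: is_module_def mn)
qed

section \<open>Tensor products of modules over a comultiplication\<close>

lemma fst_ten_mod [simp]: "fst (ten_mod N H m n) = fst m \<otimes> fst n"
  by (simp add: ten_mod_def)

lemma ten_mod_preaction:
  assumes "car H \<in> Obj N" "comul H \<in> hom N (car H) (car H \<otimes> car H)"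
    "preaction (car H) m" "preaction (car H) n"
  shows "preaction (car H) (ten_mod N H m n)"
  using assms diag_action_closed[of "car H" "[m, n]"]
  by (simp add: preaction_def ten_mod_def hom_def)

lemma ten_mod_eq_pull:
  assumes "car H \<in> Obj N" "preaction (car H) m" "preaction (car H) n"
  shows "ten_mod N H m n = pull_mod N (comul H)
    (fst m \<otimes> fst n, juxt (car H) (fst m) (snd m) (car H) (fst n) (snd n))"
  using assms by (simp add: ten_mod_def pull_mod_def diag_action_2)

lemma equivariant_ten:
  assumes B: "car H \<in> Obj N" and D: "comul H \<in> hom N (car H) (car H \<otimes> car H)"
    and "equivariant (car H) m f n" "equivariant (car H) m' g n'"
  shows "equivariant (car H) (ten_mod N H m m') (f \<star> g) (ten_mod N H n n')"
proof -
  let ?b = "car H"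
  let ?J = "juxt ?b (fst m) (snd m) ?b (fst m') (snd m')"
  let ?J' = "juxt ?b (fst n) (snd n) ?b (fst n') (snd n')"
  note a = assms(3,4)[unfolded equivariant_def]
  note q = a[unfolded preaction_def]
  have J: "?J \<in> hom N ((?b \<otimes> ?b) \<otimes> fst m \<otimes> fst m') (fst m \<otimes> fst m')"
    "?J' \<in> hom N ((?b \<otimes> ?b) \<otimes> fst n \<otimes> fst n') (fst n \<otimes> fst n')"
    using q B by - (rule juxt_closed; simp)+
  have "(f \<star> g) \<cdot> ?J = ?J' \<cdot> (ident N (?b \<otimes> ?b) \<star> (f \<star> g))"
    using q B by (intro juxt_intertwine) auto
  moreover have "f \<star> g \<in> hom N (fst m \<otimes> fst m') (fst n \<otimes> fst n')"
    using a by (intro ten_arr_closed) auto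
  ultimately have "equivariant (?b \<otimes> ?b) (fst m \<otimes> fst m', ?J) (f \<star> g) (fst n \<otimes> fst n', ?J')"
    using q J by (simp add: equivariant_def preaction_def)
  then show ?thesis
    using D equivariant_pull a B by (simp add: ten_mod_eq_pull)
qed

text \<open>Tensoring twice is the diagonal action of three factors, restricted along an iterated coproduct. Comparing this
with \<open>ten_mod_right\<close> turns associativity of the tensor product into coassociativity, and conversely.\<close>

lemma ten_mod_left:
  assumes B: "car H \<in> Obj N" and D: "comul H \<in> hom N (car H) (car H \<otimes> car H)"
    and p: "preaction (car H) l" "preaction (car H) m" "preaction (car H) n"
  shows "ten_mod N H (ten_mod N H l m) n
    = (fst l \<otimes> fst m \<otimes> fst n, diag_action N (car H) [l, m, n]
        \<cdot> (((comul H \<star> ident N (car H)) \<cdot> comul H) \<star> ident N (fst l \<otimes> fst m \<otimes> fst n)))"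
proof -
  let ?b = "car H" and ?D = "comul H"
  let ?J = "juxt ?b (fst l) (snd l) ?b (fst m) (snd m)"
  note q = p[unfolded preaction_def]
  have J: "?J \<in> hom N ((?b \<otimes> ?b) \<otimes> fst l \<otimes> fst m) (fst l \<otimes> fst m)"
    using q B by (intro juxt_closed) auto
  have "diag_action N ?b [ten_mod N H l m, n]
    = juxt ?b (fst l \<otimes> fst m) (?J \<cdot> (?D \<star> ident N (fst l \<otimes> fst m))) ?b (fst n) (snd n)"
    using assms ten_mod_preaction diag_action_2[of ?b "ten_mod N H l m" n]
    by (simp add: ten_mod_eq_pull pull_mod_def)
  also have "\<dots> = juxt ?b (fst l \<otimes> fst m) (?J \<cdot> (?D \<star> ident N (fst l \<otimes> fst m))) ?b (fst n)
      (snd n \<cdot> (ident N ?b \<star> ident N (fst n)))"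
    using q B by (simp add: hom_def flip: ident_ten)
  also have "\<dots> = juxt (?b \<otimes> ?b) (fst l \<otimes> fst m) ?J ?b (fst n) (snd n)
      \<cdot> ((?D \<star> ident N ?b) \<star> ident N ((fst l \<otimes> fst m) \<otimes> fst n))"
    using assms q J ident_closed by (intro juxt_precomp) auto
  also have "juxt (?b \<otimes> ?b) (fst l \<otimes> fst m) ?J ?b (fst n) (snd n) = diag_action N ?b [l, m, n]"
    using assms q
      juxt_assoc[of ?b "fst l" ?b "fst m" ?b "fst n" "snd l" "fst l" "snd m" "fst m" "snd n" "fst n"]
    by (simp add: diag_action_3)
  finally show ?thesis
    using B D q diag_action_closed[of ?b "[l, m, n]"] p
    by (simp add: ten_mod_def[of _ _ "ten_mod N H l m"] whisker_right hom_def)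
qed

lemma ten_mod_right:
  assumes B: "car H \<in> Obj N" and D: "comul H \<in> hom N (car H) (car H \<otimes> car H)"
    and p: "preaction (car H) l" "preaction (car H) m" "preaction (car H) n"
  shows "ten_mod N H l (ten_mod N H m n)
    = (fst l \<otimes> fst m \<otimes> fst n, diag_action N (car H) [l, m, n]
        \<cdot> (((ident N (car H) \<star> comul H) \<cdot> comul H) \<star> ident N (fst l \<otimes> fst m \<otimes> fst n)))"
proof -
  let ?b = "car H" and ?D = "comul H"
  let ?J = "juxt ?b (fst m) (snd m) ?b (fst n) (snd n)"
  note q = p[unfolded preaction_def]
  have J: "?J \<in> hom N ((?b \<otimes> ?b) \<otimes> fst m \<otimes> fst n) (fst m \<otimes> fst n)"
    using q B by (intro juxt_closed) auto
  have "diag_action N ?b [l, ten_mod N H m n]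
    = juxt ?b (fst l) (snd l) ?b (fst m \<otimes> fst n) (?J \<cdot> (?D \<star> ident N (fst m \<otimes> fst n)))"
    using assms ten_mod_preaction diag_action_2[of ?b l "ten_mod N H m n"]
    by (simp add: ten_mod_eq_pull pull_mod_def)
  also have "\<dots> = juxt ?b (fst l) (snd l \<cdot> (ident N ?b \<star> ident N (fst l))) ?b (fst m \<otimes> fst n)
      (?J \<cdot> (?D \<star> ident N (fst m \<otimes> fst n)))"
    using q B by (simp add: hom_def flip: ident_ten)
  also have "\<dots> = juxt ?b (fst l) (snd l) (?b \<otimes> ?b) (fst m \<otimes> fst n) ?J
      \<cdot> ((ident N ?b \<star> ?D) \<star> ident N (fst l \<otimes> (fst m \<otimes> fst n)))"
    using assms q J ident_closed by (intro juxt_precomp) auto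
  also have "juxt ?b (fst l) (snd l) (?b \<otimes> ?b) (fst m \<otimes> fst n) ?J = diag_action N ?b [l, m, n]"
    using assms q by (simp add: diag_action_3)
  finally show ?thesis
    using B D q diag_action_closed[of ?b "[l, m, n]"] p
    by (simp add: ten_mod_def[of _ _ _ "ten_mod N H m n"] whisker_right hom_def)
qed

lemma ten_mod_unit:
  assumes B: "car H \<in> Obj N" and D: "comul H \<in> hom N (car H) (car H \<otimes> car H)"
    and e: "counit H \<in> hom N (car H) \<I>" and p: "preaction (car H) m"
  shows "ten_mod N H (unit_mod N H) m
      = pull_mod N ((counit H \<star> ident N (car H)) \<cdot> comul H) m"
    and "ten_mod N H m (unit_mod N H)
      = pull_mod N ((ident N (car H) \<star> counit H) \<cdot> comul H) m"
proof -
  let ?b = "car H" and ?e = "counit H" and ?x = "fst m" and ?\<alpha> = "snd m"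
  note q = p[unfolded preaction_def]
  have u: "preaction ?b (unit_mod N H)"
    using e B by (simp add: preaction_def unit_mod_def hom_def)
  have "juxt ?b \<I> (ident N \<I> \<cdot> (?e \<star> ident N \<I>)) ?b ?x (?\<alpha> \<cdot> (ident N ?b \<star> ident N ?x))
    = juxt \<I> \<I> (ident N \<I>) ?b ?x ?\<alpha> \<cdot> ((?e \<star> ident N ?b) \<star> ident N (\<I> \<otimes> ?x))"
    using q e B by (intro juxt_precomp) (auto simp: hom_def)
  then show "ten_mod N H (unit_mod N H) m = pull_mod N ((?e \<star> ident N ?b) \<cdot> comul H) m"
    using q e B D u p juxt_unit_left[of ?b ?x ?\<alpha> ?x]
    by (simp add: ten_mod_eq_pull pull_mod_def unit_mod_def whisker_right hom_def ten_ident)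
  have "juxt ?b ?x (?\<alpha> \<cdot> (ident N ?b \<star> ident N ?x)) ?b \<I> (ident N \<I> \<cdot> (?e \<star> ident N \<I>))
    = juxt ?b ?x ?\<alpha> \<I> \<I> (ident N \<I>) \<cdot> ((ident N ?b \<star> ?e) \<star> ident N (?x \<otimes> \<I>))"
    using q e B by (intro juxt_precomp) (auto simp: hom_def)
  then show "ten_mod N H m (unit_mod N H) = pull_mod N ((ident N ?b \<star> ?e) \<cdot> comul H) m"
    using q e B D u p juxt_unit_right[of ?b ?x ?\<alpha> ?x]
    by (simp add: ten_mod_eq_pull pull_mod_def unit_mod_def whisker_right hom_def ten_ident)
qed

section \<open>Bialgebras as quasi-bialgebras\<close>

text \<open>What it takes to multiply by a trivial reassociator: the property passes to braided tensor powers.\<close>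

definition unital :: "('o, 'a, 'x) alg_scheme \<Rightarrow> bool" where
  "unital A \<longleftrightarrow> alg_data A \<and> mlt A \<cdot> (aunit A \<star> ident N (car A)) = ident N (car A) \<and>
     mlt A \<cdot> (ident N (car A) \<star> aunit A) = ident N (car A)"

lemma unital_unit_alg: "unital (unit_alg N)"
  using alg_data_unit_alg by (simp add: unital_def unit_alg_def)

text \<open>The product of the tensor algebra is the juxtaposition of the two regular actions, so the left unit law is
\<open>juxt_precomp\<close> and the right one is \<open>juxt_intertwine\<close>, both applied to the units.\<close>

lemma unital_alg_tensor:
  assumes "unital A" "unital C"
  shows "unital (alg_tensor N A C)"
proof -
  let ?a = "car A" and ?c = "car C"
  have d: "alg_data A" "alg_data C" using assms by (simp_all add: unital_def)
  note h = assms[unfolded unital_def alg_data_def]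
  have mlt: "mlt (alg_tensor N A C) = juxt ?a ?a (mlt A) ?c ?c (mlt C)"
    by (simp add: alg_tensor_def juxt_def)
  have "juxt \<I> ?a (mlt A \<cdot> (aunit A \<star> ident N ?a)) \<I> ?c (mlt C \<cdot> (aunit C \<star> ident N ?c))
    = juxt ?a ?a (mlt A) ?c ?c (mlt C) \<cdot> ((aunit A \<star> aunit C) \<star> ident N (?a \<otimes> ?c))"
    using h by (intro juxt_precomp) auto
  moreover have "(ident N ?a \<star> ident N ?c) \<cdot> juxt ?a \<I> (ident N ?a) ?c \<I> (ident N ?c)
    = juxt ?a ?a (mlt A) ?c ?c (mlt C) \<cdot> (ident N (?a \<otimes> ?c) \<star> (aunit A \<star> aunit C))"
    using h by (intro juxt_intertwine[where z = ?a and z' = ?a and w = ?c and w' = ?c])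
      (auto simp: ident_closed hom_def)
  ultimately show ?thesis
    using h juxt_idents[of \<I> \<I> ?a ?c] juxt_idents[of ?a ?c \<I> \<I>]
      alg_data_alg_tensor[OF d] by (simp add: unital_def mlt ten_ident) (simp add: alg_tensor_def)
qed

lemma unital_alg_power: "unital A \<Longrightarrow> unital (alg_power N A n)"
  by (induction n) (simp_all add: unital_unit_alg unital_alg_tensor)

lemma unital_if_algebra: "is_algebra N A \<Longrightarrow> unital A"
  by (simp add: unital_def is_algebra_def alg_data_def)

lemma alg_prod_aunit:
  assumes "unital A" "g \<in> hom N v (car A)"
  shows "alg_prod N A (aunit A) g = g" "alg_prod N A g (aunit A) = g"
proof -
  note h = assms[unfolded unital_def alg_data_def hom_def, simplified]
  have "alg_prod N A (aunit A) g = mlt A \<cdot> ((aunit A \<star> ident N (car A)) \<cdot> (ident N \<I> \<star> g))"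
    using h slide(2)[of "aunit A" g \<I> "car A" v "car A"] by (simp add: alg_prod_def)
  also have "\<dots> = (mlt A \<cdot> (aunit A \<star> ident N (car A))) \<cdot> (ident N \<I> \<star> g)"
    using h by (subst comp_assoc') auto
  finally show "alg_prod N A (aunit A) g = g" using h by simp
  have "alg_prod N A g (aunit A) = mlt A \<cdot> ((ident N (car A) \<star> aunit A) \<cdot> (g \<star> ident N \<I>))"
    using h slide(1)[of g "aunit A" v "car A" \<I> "car A"] by (simp add: alg_prod_def)
  also have "\<dots> = (mlt A \<cdot> (ident N (car A) \<star> aunit A)) \<cdot> (g \<star> ident N \<I>)"
    using h by (subst comp_assoc') auto
  finally show "alg_prod N A g (aunit A) = g" using h by simp
qed

text \<open>A bialgebra, presented as a quasi-bialgebra with reassociator \<open>1 \<otimes> 1 \<otimes> 1\<close>.\<close>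

definition bialgebra :: "('o, 'a) qbialg \<Rightarrow> bool" where
  "bialgebra H \<longleftrightarrow> is_algebra N H \<and> alg_morphism N H (alg_tensor N H H) (comul H) \<and>
     alg_morphism N H (unit_alg N) (counit H) \<and>
     (ident N (car H) \<star> comul H) \<cdot> comul H = (comul H \<star> ident N (car H)) \<cdot> comul H \<and>
     (counit H \<star> ident N (car H)) \<cdot> comul H = ident N (car H) \<and>
     (ident N (car H) \<star> counit H) \<cdot> comul H = ident N (car H) \<and>
     reassoc H = aunit H \<star> aunit H \<star> aunit H"

lemma bialgebra_typing:
  assumes "bialgebra H"
  shows "car H \<in> Obj N" "alg_data H" "aunit H \<in> hom N \<I> (car H)"
    "comul H \<in> hom N (car H) (car H \<otimes> car H)" "counit H \<in> hom N (car H) \<I>"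
    "comul H \<cdot> aunit H = aunit H \<star> aunit H" "counit H \<cdot> aunit H = ident N \<I>"
  using assms
  by (auto simp: bialgebra_def is_algebra_def alg_data_def alg_morphism_def alg_tensor_def unit_alg_def)

text \<open>All factors in the 3-cycle condition are the unit of the fourth tensor power, since the coproduct preserves units.
In the quasi-coassociativity axiom, multiplication by the unit of the third tensor power does nothing.\<close>

lemma bialgebra_quasi:
  assumes "bialgebra H"
  shows "quasi_bialgebra N H"
proof -
  let ?i = "ident N (car H)" and ?\<eta> = "aunit H" and ?\<Delta> = "comul H"
  note t = bialgebra_typing[OF assms]
  note t' = t[unfolded hom_def, simplified]
  have alg: "is_algebra N H" and r: "reassoc H = ?\<eta> \<star> ?\<eta> \<star> ?\<eta>"
    using assms by (auto simp: bialgebra_def)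
  have u: "unital (alg_power N H n)" for n
    using unital_alg_power unital_if_algebra alg by blast
  have 3: "car (alg_power N H 3) = car H \<otimes> car H \<otimes> car H" "aunit (alg_power N H 3) = reassoc H"
    and 4: "aunit (alg_power N H 4) = ?\<eta> \<star> ?\<eta> \<star> ?\<eta> \<star> ?\<eta>"
    using t' by (simp_all add: eval_nat_numeral alg_tensor_def unit_alg_def r)
  have unit_hom: "aunit (alg_power N H n) \<in> hom N \<I> (car (alg_power N H n))" for n
    using u[of n] by (simp add: unital_def alg_data_def)
  have D: "(?i \<star> ?\<Delta>) \<cdot> ?\<Delta> \<in> hom N (car H) (car (alg_power N H 3))"
    using t' by (simp add: 3 hom_def)
  have e: "(?i \<star> counit H \<star> ?i) \<cdot> reassoc H = ?\<eta> \<star> ?\<eta>"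
    using t' by (simp add: r ten_comp3)
  have c: "?\<eta> \<star> reassoc H = aunit (alg_power N H 4)" "reassoc H \<star> ?\<eta> = aunit (alg_power N H 4)"
    "(?i \<star> ?\<Delta> \<star> ?i) \<cdot> reassoc H = aunit (alg_power N H 4)"
    "(?i \<star> ?i \<star> ?\<Delta>) \<cdot> reassoc H = aunit (alg_power N H 4)"
    "(?\<Delta> \<star> ?i \<star> ?i) \<cdot> reassoc H = aunit (alg_power N H 4)"
    using t' by (simp_all add: r 4 ten_comp3)
  have "invertible_element N (alg_power N H 3) (reassoc H)"
    unfolding invertible_element_def
    using unit_hom[of 3] alg_prod_aunit[OF u unit_hom[of 3]] by (auto simp: 3)
  moreover have "alg_prod N (alg_power N H 3) ((?i \<star> ?\<Delta>) \<cdot> ?\<Delta>) (reassoc H) = (?i \<star> ?\<Delta>) \<cdot> ?\<Delta>"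
    "alg_prod N (alg_power N H 3) (reassoc H) ((?i \<star> ?\<Delta>) \<cdot> ?\<Delta>) = (?i \<star> ?\<Delta>) \<cdot> ?\<Delta>"
    using alg_prod_aunit[OF u D] by (simp_all add: 3)
  moreover have "alg_morphism N H (alg_tensor N H H) ?\<Delta>" "alg_morphism N H (unit_alg N) (counit H)"
    "(?i \<star> ?\<Delta>) \<cdot> ?\<Delta> = (?\<Delta> \<star> ?i) \<cdot> ?\<Delta>" "(counit H \<star> ?i) \<cdot> ?\<Delta> = ?i" "(?i \<star> counit H) \<cdot> ?\<Delta> = ?i"
    using assms by (auto simp: bialgebra_def)
  ultimately show ?thesis
    using alg e alg_prod_aunit[OF u unit_hom[of 4]]
    unfolding quasi_bialgebra_def Let_def by (simp add: c)
qed

text \<open>The juxtaposition is a module over \<open>H \<otimes> H\<close>, and it is restricted along the algebra morphism \<open>\<Delta>\<close>.\<close>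

lemma ten_mod_module:
  assumes "bialgebra H" "is_module N H m" "is_module N H n"
  shows "is_module N H (ten_mod N H m n)"
proof -
  note t = bialgebra_typing[OF assms(1)]
  have f: "alg_morphism N H (alg_tensor N H H) (comul H)" using assms(1) by (simp add: bialgebra_def)
  have "is_module N (alg_tensor N H H)
    (fst m \<otimes> fst n, juxt (car H) (fst m) (snd m) (car H) (fst n) (snd n))"
    using t assms by (intro juxt_module)
  then show ?thesis
    using f t assms pull_mod_module_iff[of H "alg_tensor N H H" _ "comul H"] alg_data_alg_tensor[of H H]
    by (simp add: ten_mod_eq_pull preaction_if_module alg_morphism_def)
qed

lemma regular_unit_module: "is_module N (unit_alg N) (\<I>, ident N \<I>)"
  by (simp add: is_module_def unit_alg_def hom_def)

lemma unit_mod_module: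
  assumes "bialgebra H"
  shows "is_module N H (unit_mod N H)"
proof -
  note t = bialgebra_typing[OF assms]
  have f: "alg_morphism N H (unit_alg N) (counit H)" using assms by (simp add: bialgebra_def)
  then have "is_module N H (pull_mod N (counit H) (\<I>, ident N \<I>))"
    using t regular_unit_module alg_data_unit_alg pull_mod_module_iff[of H "unit_alg N" _ "counit H"]
    by (simp add: alg_morphism_def)
  then show ?thesis using t by (simp add: pull_mod_def unit_mod_def hom_def)
qed

section \<open>The monoidal category of modules over a bialgebra\<close>

lemma Mod_simps [simp]:
  "Obj (Mod N H) = {m. is_module N H m}"
  "Dom (Mod N H) (m, f, n) = m" "Cod (Mod N H) (m, f, n) = n"
  "ident (Mod N H) m = (m, ident N (fst m), m)"
  "comp (Mod N H) (m', g, n') (m, f, n) = (m, g \<cdot> f, n')"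
  "ten_obj (Mod N H) = ten_mod N H"
  "ten_arr (Mod N H) (m, f, n) (m', g, n') = (ten_mod N H m m', f \<star> g, ten_mod N H n n')"
  "unit_obj (Mod N H) = unit_mod N H"
  "assoc (Mod N H) l m n = (ten_mod N H (ten_mod N H l m) n,
     diag_action N (car H) [l, m, n] \<cdot> (reassoc H \<star> ident N (fst l \<otimes> fst m \<otimes> fst n)),
     ten_mod N H l (ten_mod N H m n))"
  "lunit (Mod N H) m = (ten_mod N H (unit_mod N H) m, ident N (fst m), m)"
  "runit (Mod N H) m = (ten_mod N H m (unit_mod N H), ident N (fst m), m)"
  by (simp_all add: Mod_def)

lemma Mod_Mor [simp]:
  "(m, f, n) \<in> Mor (Mod N H) \<longleftrightarrow> is_module N H m \<and> is_module N H n \<and> f \<in> hom N (fst m) (fst n) \<and>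
     f \<cdot> snd m = snd n \<cdot> (ident N (car H) \<star> f)"
  by (simp add: Mod_def)

lemma Mod_homE:
  assumes "u \<in> hom (Mod N H) m n"
  obtains f where "u = (m, f, n)" "(m, f, n) \<in> Mor (Mod N H)"
  using assms by (cases u) (auto simp: hom_def)

lemma Mod_homI: "(m, f, n) \<in> Mor (Mod N H) \<Longrightarrow> (m, f, n) \<in> hom (Mod N H) m n"
  by (simp add: hom_def)

lemma Mod_Mor_iff_equivariant:
  "(m, f, n) \<in> Mor (Mod N H) \<longleftrightarrow> is_module N H m \<and> is_module N H n \<and> equivariant (car H) m f n"
  by (auto simp: equivariant_def preaction_if_module)

lemma ten_arr_module_hom:
  assumes "bialgebra H" "(m, f, n) \<in> Mor (Mod N H)" "(m', g, n') \<in> Mor (Mod N H)"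
  shows "(ten_mod N H m m', f \<star> g, ten_mod N H n n') \<in> Mor (Mod N H)"
  using assms bialgebra_typing[OF assms(1)] unfolding Mod_Mor_iff_equivariant
  by (simp add: ten_mod_module equivariant_ten)

lemma Mod_category:
  assumes "car H \<in> Obj N"
  shows "category (Mod N H)"
proof
  fix m assume "m \<in> Obj (Mod N H)"
  then show "ident (Mod N H) m \<in> hom (Mod N H) m m"
    using assms by (simp add: is_module_def hom_def flip: ident_ten)
next
  fix u v l m n
  assume "u \<in> hom (Mod N H) l m" "v \<in> hom (Mod N H) m n"
  then obtain f g where fg: "u = (l, f, m)" "(l, f, m) \<in> Mor (Mod N H)"
    "v = (m, g, n)" "(m, g, n) \<in> Mor (Mod N H)"
    by (auto elim!: Mod_homE)
  have "(l, g \<cdot> f, n) \<in> Mor (Mod N H)"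
    using fg(2,4) assms equivariant_comp unfolding Mod_Mor_iff_equivariant by blast
  then show "comp (Mod N H) v u \<in> hom (Mod N H) l n"
    using fg by (simp add: Mod_homI del: Mod_Mor)
next
  fix u m n assume "u \<in> hom (Mod N H) m n"
  then show "comp (Mod N H) u (ident (Mod N H) m) = u" "comp (Mod N H) (ident (Mod N H) n) u = u"
    by (auto elim!: Mod_homE simp: comp_ident_right comp_ident_left)
next
  fix u v w k l m n
  assume "u \<in> hom (Mod N H) k l" "v \<in> hom (Mod N H) l m" "w \<in> hom (Mod N H) m n"
  then show "comp (Mod N H) (comp (Mod N H) w v) u = comp (Mod N H) w (comp (Mod N H) v u)"
    by (auto elim!: Mod_homE simp: comp_assoc)
qed (auto simp: Mod_def)

lemma ten_mod_assoc:
  assumes "bialgebra H" "is_module N H l" "is_module N H m" "is_module N H n"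
  shows "ten_mod N H (ten_mod N H l m) n = ten_mod N H l (ten_mod N H m n)"
  using assms bialgebra_typing[OF assms(1)]
  by (simp add: ten_mod_left ten_mod_right preaction_if_module bialgebra_def)

lemma ten_mod_unit_mod:
  assumes "bialgebra H" "is_module N H m"
  shows "ten_mod N H (unit_mod N H) m = m" "ten_mod N H m (unit_mod N H) = m"
  using assms bialgebra_typing[OF assms(1)] ident_ten[of "car H" "fst m"]
  by (auto simp: ten_mod_unit preaction_if_module bialgebra_def pull_mod_def is_module_def hom_def
      simp flip: ident_ten intro!: prod_eqI)

text \<open>Hence the associativity isomorphism of modules given by a trivial reassociator is an identity.\<close>

lemma units_act_trivially:
  assumes "alg_data H" "is_module N H l" "is_module N H m" "is_module N H n"
  shows "diag_action N (car H) [l, m, n] \<cdot> ((aunit H \<star> aunit H \<star> aunit H) \<star> ident N (fst l \<otimes> fst m \<otimes> fst n))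
    = ident N (fst l \<otimes> fst m \<otimes> fst n)"
proof -
  let ?b = "car H"
  note h = assms[unfolded is_module_def alg_data_def]
  have "diag_action N ?b [l, m, n] = juxt ?b (fst l) (snd l) (?b \<otimes> ?b) (fst m \<otimes> fst n)
      (juxt ?b (fst m) (snd m) ?b (fst n) (snd n))"
    using h assms by (intro diag_action_3 preaction_if_module) auto
  then show ?thesis
    using h juxt_precomp3[of "fst l" "fst m" "fst n" "snd l" ?b "fst l" "snd m" ?b "fst m"
      "snd n" ?b "fst n"
      "aunit H" \<I> "aunit H" \<I> "aunit H" \<I>] juxt_idents[of \<I> \<I> "fst m" "fst n"]
      juxt_idents[of \<I> \<I> "fst l" "fst m \<otimes> fst n"] by simp
qed

text \<open>Coassociativity and the counit laws make the tensor product of modules strictly associative and unital,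
and the reassociator contributes only identities; so the criterion for strict structures applies.\<close>

theorem Mod_monoidal:
  assumes "bialgebra H"
  shows "monoidal_category (Mod N H)"
proof (rule monoidal_category_if_strict)
  note t = bialgebra_typing[OF assms]
  show "category (Mod N H)" using t Mod_category by simp
  show "unit_obj (Mod N H) \<in> Obj (Mod N H)" using assms unit_mod_module by simp
  fix l m n assume lmn: "l \<in> Obj (Mod N H)" "m \<in> Obj (Mod N H)" "n \<in> Obj (Mod N H)"
  then show "ten_obj (Mod N H) l m \<in> Obj (Mod N H)" using assms ten_mod_module by simp
  show "ten_arr (Mod N H) (ident (Mod N H) l) (ident (Mod N H) m) = ident (Mod N H) (ten_obj (Mod N H) l m)"
    using lmn by (simp add: ident_ten is_module_def)
  show "ten_obj (Mod N H) (ten_obj (Mod N H) l m) n = ten_obj (Mod N H) l (ten_obj (Mod N H) m n)"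
    using assms lmn ten_mod_assoc by simp
  show "ten_obj (Mod N H) (unit_obj (Mod N H)) l = l" "ten_obj (Mod N H) l (unit_obj (Mod N H)) = l"
    "lunit (Mod N H) l = ident (Mod N H) l" "runit (Mod N H) l = ident (Mod N H) l"
    using assms lmn ten_mod_unit_mod by simp_all
  show "assoc (Mod N H) l m n = ident (Mod N H) (ten_obj (Mod N H) l (ten_obj (Mod N H) m n))"
    using assms lmn ten_mod_assoc t units_act_trivially[of H l m n] by (simp add: bialgebra_def)
next
  fix u v a b c d assume "u \<in> hom (Mod N H) a b" "v \<in> hom (Mod N H) c d"
  then show "ten_arr (Mod N H) u v \<in> hom (Mod N H) (ten_obj (Mod N H) a c) (ten_obj (Mod N H) b d)"
    using ten_arr_module_hom[OF assms] by (elim Mod_homE) (simp add: Mod_homI del: Mod_Mor)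
next
  fix u v u' v' a b c a' b' c'
  assume "u \<in> hom (Mod N H) a b" "v \<in> hom (Mod N H) b c" "u' \<in> hom (Mod N H) a' b'" "v' \<in> hom (Mod N H) b' c'"
  then show "ten_arr (Mod N H) (comp (Mod N H) v u) (comp (Mod N H) v' u')
    = comp (Mod N H) (ten_arr (Mod N H) v v') (ten_arr (Mod N H) u u')"
    by (elim Mod_homE) (auto intro!: interchange)
next
  fix u v w assume "u \<in> Mor (Mod N H)" "v \<in> Mor (Mod N H)" "w \<in> Mor (Mod N H)"
  then show "ten_arr (Mod N H) (ten_arr (Mod N H) u v) w = ten_arr (Mod N H) u (ten_arr (Mod N H) v w)"
    by (cases u; cases v; cases w) (simp add: ten_mod_assoc[OF assms] hom_def)
next
  fix u assume "u \<in> Mor (Mod N H)"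
  then show "ten_arr (Mod N H) (ident (Mod N H) (unit_obj (Mod N H))) u = u"
    "ten_arr (Mod N H) u (ident (Mod N H) (unit_obj (Mod N H))) = u"
    by (cases u, simp add: ten_mod_unit_mod[OF assms] hom_def, simp add: unit_mod_def)+
qed

lemma Mod_isoI:
  assumes "car H \<in> Obj N" "(m, f, n) \<in> Mor (Mod N H)" "f \<in> isos N (fst m) (fst n)"
  shows "(m, f, n) \<in> isos (Mod N H) m n"
proof -
  obtain g where g: "g \<in> hom N (fst n) (fst m)" "g \<cdot> f = ident N (fst m)" "f \<cdot> g = ident N (fst n)"
    using assms(3) by (auto simp: isos_def)
  have mn: "is_module N H m" "is_module N H n" "equivariant (car H) m f n"
    using assms(2) unfolding Mod_Mor_iff_equivariant by auto
  have "equivariant (car H) n g m"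
    using assms mn g equivariant_ident[of "car H" n]
    by (intro equivariant_cancel[of "car H" n f g n m]) (auto simp: preaction_if_module)
  then have "(n, g, m) \<in> Mor (Mod N H)" using mn unfolding Mod_Mor_iff_equivariant by simp
  then show ?thesis using assms g
    by (auto simp: isos_def simp del: Mod_Mor intro!: Mod_homI bexI[of _ "(n, g, m)"])
qed

end

section \<open>Lifts of a monoidal functor to modules\<close>

locale fibre_functor = braided_base N + F: monoidal_functor M N F
  for N :: "('o, 'a) braided_moncat" (structure)
    and M :: "('p, 'q) moncat" and F :: "('p, 'q, 'o, 'a) mfctr"
begin

text \<open>The object \<open>F x\<close> together with a candidate for an action on it.\<close>

definition modF :: "('p \<Rightarrow> 'a) \<Rightarrow> 'p \<Rightarrow> ('o, 'a) lmod" where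
  "modF \<tau> x = (fobj F x, \<tau> x)"

lemma modF_simps [simp]: "fst (modF \<tau> x) = fobj F x" "snd (modF \<tau> x) = \<tau> x"
  by (simp_all add: modF_def)

text \<open>What a family of actions must satisfy for \<open>F\<close>, with its own comparison arrows, to take values in modules. Over a
bialgebra this is a factorization of \<open>F\<close>, and every factorization arises in this way.\<close>

definition lifts :: "('o, 'a) qbialg \<Rightarrow> ('p \<Rightarrow> 'a) \<Rightarrow> bool" where
  "lifts H \<tau> \<longleftrightarrow>
     (\<forall>x \<in> Obj M. is_module N H (modF \<tau> x)) \<and>
     (\<forall>f x y. f \<in> hom M x y \<longrightarrow> equivariant (car H) (modF \<tau> x) (farr F f) (modF \<tau> y)) \<and>
     (\<forall>x \<in> Obj M. \<forall>y \<in> Obj M. equivariant (car H)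
        (ten_mod N H (modF \<tau> x) (modF \<tau> y)) (fmult F x y) (modF \<tau> (x \<otimes>\<^bsub>M\<^esub> y))) \<and>
     equivariant (car H) (unit_mod N H) (funit F) (modF \<tau> \<I>\<^bsub>M\<^esub>)"

definition lifted_fctr :: "('o, 'a) qbialg \<Rightarrow> ('p \<Rightarrow> 'a) \<Rightarrow>
    ('p, 'q, ('o, 'a) lmod, ('o, 'a) lmod_hom) mfctr" where
  "lifted_fctr H \<tau> =
     \<lparr>fobj = modF \<tau>,
      farr = (\<lambda>f. (modF \<tau> (Dom M f), farr F f, modF \<tau> (Cod M f))),
      fmult = (\<lambda>x y. (ten_mod N H (modF \<tau> x) (modF \<tau> y), fmult F x y, modF \<tau> (x \<otimes>\<^bsub>M\<^esub> y))),
      funit = (unit_mod N H, funit F, modF \<tau> \<I>\<^bsub>M\<^esub>)\<rparr>"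

lemmas [simp] = F.fobj_closed F.M.unit_closed F.M.ten_obj_closed

lemma fmult_hom: "\<lbrakk>x \<in> Obj M; y \<in> Obj M\<rbrakk>
    \<Longrightarrow> fmult F x y \<in> hom N (fobj F x \<otimes> fobj F y) (fobj F (x \<otimes>\<^bsub>M\<^esub> y))"
  using F.fmult_iso by (auto simp: isos_def)

lemma funit_hom: "funit F \<in> hom N \<I> (fobj F \<I>\<^bsub>M\<^esub>)"
  using F.funit_iso by (auto simp: isos_def)

lemma fmult_associative:
  assumes "x \<in> Obj M" "y \<in> Obj M" "z \<in> Obj M"
  shows "farr F (assoc M x y z) \<cdot> fmult F (x \<otimes>\<^bsub>M\<^esub> y) z \<cdot> (fmult F x y \<star> ident N (fobj F z))
    = fmult F x (y \<otimes>\<^bsub>M\<^esub> z) \<cdot> (ident N (fobj F x) \<star> fmult F y z)"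
  using F.fmult_assoc[OF assms] assms fmult_hom[of y z] fmult_hom[of x "y \<otimes>\<^bsub>M\<^esub> z"]
  by (simp add: assoc_strict hom_def)

lemma fmult_fmult_iso:
  assumes "x \<in> Obj M" "y \<in> Obj M" "z \<in> Obj M"
  shows "fmult F x (y \<otimes>\<^bsub>M\<^esub> z) \<cdot> (ident N (fobj F x) \<star> fmult F y z)
    \<in> isos N (fobj F x \<otimes> fobj F y \<otimes> fobj F z) (fobj F (x \<otimes>\<^bsub>M\<^esub> y \<otimes>\<^bsub>M\<^esub> z))"
  using assms F.fmult_iso[of x "y \<otimes>\<^bsub>M\<^esub> z"] F.fmult_iso[of y z]
  by (intro isos_comp[where b = "fobj F x \<otimes> fobj F (y \<otimes>\<^bsub>M\<^esub> z)"] isos_ten ident_in_isos) auto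

text \<open>The underlying arrows are those of \<open>F\<close>, so the coherence axioms hold because they hold for \<open>F\<close>; the
associator of modules enters one of them, and it is an identity.\<close>

lemma lifted_fctr_monoidal:
  assumes "bialgebra H" "lifts H \<tau>"
  shows "monoidal_functor M (Mod N H) (lifted_fctr H \<tau>)"
proof -
  let ?b = "car H" and ?m = "modF \<tau>"
  note t = bialgebra_typing[OF assms(1)]
  have mod: "is_module N H (?m x)" if "x \<in> Obj M" for x
    using that assms by (simp add: lifts_def)
  have arr: "(?m x, farr F f, ?m y) \<in> Mor (Mod N H)" if "f \<in> hom M x y" for f x y
  proof -
    have "x \<in> Obj M" "y \<in> Obj M" using that F.C.Dom_closed F.C.Cod_closed by (auto simp: hom_def)
    then show ?thesis using that assms mod unfolding Mod_Mor_iff_equivariant lifts_def by simp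
  qed
  have mult: "(ten_mod N H (?m x) (?m y), fmult F x y, ?m (x \<otimes>\<^bsub>M\<^esub> y)) \<in> Mor (Mod N H)"
    if "x \<in> Obj M" "y \<in> Obj M" for x y
    using that assms mod ten_mod_module unfolding Mod_Mor_iff_equivariant lifts_def by simp
  have unit: "(unit_mod N H, funit F, ?m \<I>\<^bsub>M\<^esub>) \<in> Mor (Mod N H)"
    using assms mod unit_mod_module unfolding Mod_Mor_iff_equivariant lifts_def by simp
  interpret Mod: monoidal_category "Mod N H" using assms(1) Mod_monoidal by simp
  show ?thesis
  proof (intro monoidal_functor.intro is_functor.intro is_functor_axioms.intro
      monoidal_functor_axioms.intro F.C.category_axioms Mod.category_axioms
      F.M.monoidal_category_axioms Mod.monoidal_category_axioms)
    fix x assume "x \<in> Obj M"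
    then show "fobj (lifted_fctr H \<tau>) x \<in> Obj (Mod N H)"
      "farr (lifted_fctr H \<tau>) (ident M x) = ident (Mod N H) (fobj (lifted_fctr H \<tau>) x)"
      using mod F.C.ident_closed[of x] by (auto simp: lifted_fctr_def F.farr_ident hom_def)
  next
    fix f x y assume "f \<in> hom M x y"
    then show "farr (lifted_fctr H \<tau>) f
      \<in> hom (Mod N H) (fobj (lifted_fctr H \<tau>) x) (fobj (lifted_fctr H \<tau>) y)"
      using arr[of f x y] by (auto simp: lifted_fctr_def hom_def simp del: Mod_Mor)
  next
    fix f g x y z assume "f \<in> hom M x y" "g \<in> hom M y z"
    then show "farr (lifted_fctr H \<tau>) (g \<cdot>\<^bsub>M\<^esub> f)
      = farr (lifted_fctr H \<tau>) g \<cdot>\<^bsub>Mod N H\<^esub> farr (lifted_fctr H \<tau>) f"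
      using F.C.comp_closed[of f x y g z] by (auto simp: lifted_fctr_def F.farr_comp hom_def)
  next
    fix x y assume "x \<in> Obj M" "y \<in> Obj M"
    then show "fmult (lifted_fctr H \<tau>) x y \<in> isos (Mod N H)
      (fobj (lifted_fctr H \<tau>) x \<otimes>\<^bsub>Mod N H\<^esub> fobj (lifted_fctr H \<tau>) y) (fobj (lifted_fctr H \<tau>) (x \<otimes>\<^bsub>M\<^esub> y))"
      using mult[of x y] t F.fmult_iso[of x y] by (simp add: lifted_fctr_def Mod_isoI del: Mod_Mor)
  next
    show "funit (lifted_fctr H \<tau>) \<in> isos (Mod N H) \<I>\<^bsub>Mod N H\<^esub> (fobj (lifted_fctr H \<tau>) \<I>\<^bsub>M\<^esub>)"
      using unit t F.funit_iso by (simp add: lifted_fctr_def Mod_isoI unit_mod_def del: Mod_Mor)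
  next
    fix f g x y x' y' assume "f \<in> hom M x x'" "g \<in> hom M y y'"
    then show "fmult (lifted_fctr H \<tau>) x' y' \<cdot>\<^bsub>Mod N H\<^esub>
        (farr (lifted_fctr H \<tau>) f \<star>\<^bsub>Mod N H\<^esub> farr (lifted_fctr H \<tau>) g)
      = farr (lifted_fctr H \<tau>) (f \<star>\<^bsub>M\<^esub> g) \<cdot>\<^bsub>Mod N H\<^esub> fmult (lifted_fctr H \<tau>) x y"
      using F.fmult_natural[of f x x' g y y'] F.M.ten_arr_closed[of f x x' g y y']
      by (auto simp: lifted_fctr_def hom_def)
  next
    fix x y z assume xyz: "x \<in> Obj M" "y \<in> Obj M" "z \<in> Obj M"
    have "assoc M x y z \<in> hom M ((x \<otimes>\<^bsub>M\<^esub> y) \<otimes>\<^bsub>M\<^esub> z) (x \<otimes>\<^bsub>M\<^esub> y \<otimes>\<^bsub>M\<^esub> z)"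
      using F.M.assoc_iso[OF xyz] by (simp add: isos_def)
    moreover have "diag_action N ?b [?m x, ?m y, ?m z]
        \<cdot> (reassoc H \<star> ident N (fobj F x \<otimes> fobj F y \<otimes> fobj F z))
      = ident N (fobj F x \<otimes> fobj F y \<otimes> fobj F z)"
      using units_act_trivially[of H "?m x" "?m y" "?m z"] mod xyz t assms by (simp add: bialgebra_def)
    ultimately show "farr (lifted_fctr H \<tau>) (assoc M x y z) \<cdot>\<^bsub>Mod N H\<^esub>
        fmult (lifted_fctr H \<tau>) (x \<otimes>\<^bsub>M\<^esub> y) z \<cdot>\<^bsub>Mod N H\<^esub>
        (fmult (lifted_fctr H \<tau>) x y \<star>\<^bsub>Mod N H\<^esub> ident (Mod N H) (fobj (lifted_fctr H \<tau>) z))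
      = fmult (lifted_fctr H \<tau>) x (y \<otimes>\<^bsub>M\<^esub> z) \<cdot>\<^bsub>Mod N H\<^esub>
        (ident (Mod N H) (fobj (lifted_fctr H \<tau>) x) \<star>\<^bsub>Mod N H\<^esub> fmult (lifted_fctr H \<tau>) y z) \<cdot>\<^bsub>Mod N H\<^esub>
        assoc (Mod N H) (fobj (lifted_fctr H \<tau>) x) (fobj (lifted_fctr H \<tau>) y) (fobj (lifted_fctr H \<tau>) z)"
      using F.fmult_assoc[OF xyz] xyz
      by (simp add: lifted_fctr_def hom_def assoc_strict)
  next
    fix x assume x: "x \<in> Obj M"
    have "lunit M x \<in> hom M (\<I>\<^bsub>M\<^esub> \<otimes>\<^bsub>M\<^esub> x) x" "runit M x \<in> hom M (x \<otimes>\<^bsub>M\<^esub> \<I>\<^bsub>M\<^esub>) x"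
      using F.M.lunit_iso[OF x] F.M.runit_iso[OF x] by (simp_all add: isos_def)
    then show "farr (lifted_fctr H \<tau>) (lunit M x) \<cdot>\<^bsub>Mod N H\<^esub> fmult (lifted_fctr H \<tau>) \<I>\<^bsub>M\<^esub> x
        \<cdot>\<^bsub>Mod N H\<^esub> (funit (lifted_fctr H \<tau>) \<star>\<^bsub>Mod N H\<^esub> ident (Mod N H) (fobj (lifted_fctr H \<tau>) x))
      = lunit (Mod N H) (fobj (lifted_fctr H \<tau>) x)"
      "farr (lifted_fctr H \<tau>) (runit M x) \<cdot>\<^bsub>Mod N H\<^esub> fmult (lifted_fctr H \<tau>) x \<I>\<^bsub>M\<^esub>
        \<cdot>\<^bsub>Mod N H\<^esub> (ident (Mod N H) (fobj (lifted_fctr H \<tau>) x) \<star>\<^bsub>Mod N H\<^esub> funit (lifted_fctr H \<tau>))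
      = runit (Mod N H) (fobj (lifted_fctr H \<tau>) x)"
      using F.fmult_lunit[OF x] F.fmult_runit[OF x] x
      by (simp_all add: lifted_fctr_def hom_def lunit_strict runit_strict)
  qed
qed

lemma forget_lifted_fctr:
  "mfctr_eq M (mfctr_comp N (forget N) (lifted_fctr H \<tau>)) F"
  using fmult_hom funit_hom
  by (auto simp: mfctr_eq_def mfctr_comp_def forget_def lifted_fctr_def hom_def)

theorem factorization_lifted_fctr:
  assumes "bialgebra H" "lifts H \<tau>"
  shows "factorization N M F H (lifted_fctr H \<tau>)"
  using assms by (simp add: factorization_def bialgebra_quasi lifted_fctr_monoidal forget_lifted_fctr)

text \<open>Agreement with \<open>F\<close> fixes the underlying objects, arrows and comparison arrows, so only the actions remain
free. Moreover the coherence axiom of \<open>G\<close> differs from that of \<open>F\<close> by the action of the reassociator. The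
comparison arrows are invertible, so this action is the identity.\<close>

lemma factorizationE:
  assumes "factorization N M F H G"
  obtains \<tau> where "lifts H \<tau>" "mfctr_eq M G (lifted_fctr H \<tau>)"
    "\<And>x y z. \<lbrakk>x \<in> Obj M; y \<in> Obj M; z \<in> Obj M\<rbrakk> \<Longrightarrow>
      diag_action N (car H) [modF \<tau> x, modF \<tau> y, modF \<tau> z]
        \<cdot> (reassoc H \<star> ident N (fobj F x \<otimes> fobj F y \<otimes> fobj F z))
      = ident N (fobj F x \<otimes> fobj F y \<otimes> fobj F z)"
proof -
  define \<tau> where "\<tau> x = snd (fobj G x)" for x
  let ?m = "modF \<tau>" and ?b = "car H"
  interpret G: monoidal_functor M "Mod N H" G using assms by (simp add: factorization_def)
  have eq: "mfctr_eq M (mfctr_comp N (forget N) G) F" using assms by (simp add: factorization_def)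
  have fobj: "fobj G x = ?m x" if "x \<in> Obj M" for x
    using eq that by (auto simp: mfctr_eq_def mfctr_comp_def forget_def modF_def \<tau>_def intro: prod_eqI)
  have mod: "is_module N H (?m x)" if "x \<in> Obj M" for x
    using G.fobj_closed[OF that] fobj[OF that] by simp
  have farr: "farr G f = (?m x, farr F f, ?m y)" "equivariant ?b (?m x) (farr F f) (?m y)"
    if f: "f \<in> hom M x y" for f x y
  proof -
    have xy: "x \<in> Obj M" "y \<in> Obj M" and M: "f \<in> Mor M"
      using f F.C.Dom_closed F.C.Cod_closed by (auto simp: hom_def)
    obtain g where g: "farr G f = (?m x, g, ?m y)" "(?m x, g, ?m y) \<in> Mor (Mod N H)"
      using G.farr_closed[OF f] fobj xy by (auto elim: Mod_homE)
    moreover have "g = farr F f"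
      using eq M g(1) by (auto simp: mfctr_eq_def mfctr_comp_def forget_def)
    ultimately show "farr G f = (?m x, farr F f, ?m y)" "equivariant ?b (?m x) (farr F f) (?m y)"
      unfolding Mod_Mor_iff_equivariant by auto
  qed
  have fmult: "fmult G x y = (ten_mod N H (?m x) (?m y), fmult F x y, ?m (x \<otimes>\<^bsub>M\<^esub> y))"
    "equivariant ?b (ten_mod N H (?m x) (?m y)) (fmult F x y) (?m (x \<otimes>\<^bsub>M\<^esub> y))"
    if xy: "x \<in> Obj M" "y \<in> Obj M" for x y
  proof -
    have "fmult G x y \<in> hom (Mod N H) (ten_mod N H (?m x) (?m y)) (?m (x \<otimes>\<^bsub>M\<^esub> y))"
      using G.fmult_iso[OF xy] fobj xy by (auto simp: isos_def)
    then obtain g where g: "fmult G x y = (ten_mod N H (?m x) (?m y), g, ?m (x \<otimes>\<^bsub>M\<^esub> y))"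
      "(ten_mod N H (?m x) (?m y), g, ?m (x \<otimes>\<^bsub>M\<^esub> y)) \<in> Mor (Mod N H)"
      by (auto elim: Mod_homE)
    moreover have "fmult (mfctr_comp N (forget N) G) x y = fmult F x y"
      using eq xy by (simp add: mfctr_eq_def)
    then have "g = fmult F x y"
      using xy g fobj by (simp add: mfctr_comp_def forget_def hom_def)
    ultimately show "fmult G x y = (ten_mod N H (?m x) (?m y), fmult F x y, ?m (x \<otimes>\<^bsub>M\<^esub> y))"
      "equivariant ?b (ten_mod N H (?m x) (?m y)) (fmult F x y) (?m (x \<otimes>\<^bsub>M\<^esub> y))"
      unfolding Mod_Mor_iff_equivariant by auto
  qed
  have funit: "funit G = (unit_mod N H, funit F, ?m \<I>\<^bsub>M\<^esub>)"
    "equivariant ?b (unit_mod N H) (funit F) (?m \<I>\<^bsub>M\<^esub>)"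
  proof -
    have "funit G \<in> hom (Mod N H) (unit_mod N H) (?m \<I>\<^bsub>M\<^esub>)"
      using G.funit_iso fobj by (auto simp: isos_def)
    then obtain g where g: "funit G = (unit_mod N H, g, ?m \<I>\<^bsub>M\<^esub>)"
      "(unit_mod N H, g, ?m \<I>\<^bsub>M\<^esub>) \<in> Mor (Mod N H)"
      by (auto elim: Mod_homE)
    moreover have "funit (mfctr_comp N (forget N) G) = funit F"
      using eq by (simp add: mfctr_eq_def)
    then have "g = funit F"
      using g by (simp add: mfctr_comp_def forget_def hom_def unit_mod_def)
    ultimately show "funit G = (unit_mod N H, funit F, ?m \<I>\<^bsub>M\<^esub>)"
      "equivariant ?b (unit_mod N H) (funit F) (?m \<I>\<^bsub>M\<^esub>)"
      unfolding Mod_Mor_iff_equivariant by auto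
  qed
  show thesis
  proof
    show "lifts H \<tau>" using mod farr fmult funit by (simp add: lifts_def)
    show "mfctr_eq M G (lifted_fctr H \<tau>)"
      using fobj farr(1) fmult(1) funit(1) by (simp add: mfctr_eq_def lifted_fctr_def hom_def)
    fix x y z assume xyz: "x \<in> Obj M" "y \<in> Obj M" "z \<in> Obj M"
    let ?X = "fobj F x \<otimes> fobj F y \<otimes> fobj F z"
    let ?\<Phi> = "diag_action N ?b [?m x, ?m y, ?m z] \<cdot> (reassoc H \<star> ident N ?X)"
    let ?k = "fmult F x (y \<otimes>\<^bsub>M\<^esub> z) \<cdot> (ident N (fobj F x) \<star> fmult F y z)"
    have a: "assoc M x y z \<in> hom M ((x \<otimes>\<^bsub>M\<^esub> y) \<otimes>\<^bsub>M\<^esub> z) (x \<otimes>\<^bsub>M\<^esub> y \<otimes>\<^bsub>M\<^esub> z)"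
      using F.M.assoc_iso[OF xyz] by (simp add: isos_def)
    have "assoc (Mod N H) (?m x) (?m y) (?m z) \<in> Mor (Mod N H)"
      using G.N.assoc_iso[of "?m x" "?m y" "?m z"] mod xyz unfolding isos_def hom_def by simp
    then have \<Phi>: "?\<Phi> \<in> hom N ?X ?X" using xyz by simp
    have "?k = fmult F x (y \<otimes>\<^bsub>M\<^esub> z) \<cdot> (ident N (fobj F x) \<star> fmult F y z) \<cdot> ?\<Phi>"
      using G.fmult_assoc[OF xyz] xyz farr[OF a] fmult fobj fmult_associative[OF xyz] by simp
    also have "\<dots> = ?k \<cdot> ?\<Phi>"
      using xyz by (intro comp_assoc[symmetric, OF \<Phi>, where c = "fobj F x \<otimes> fobj F (y \<otimes>\<^bsub>M\<^esub> z)"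
          and d = "fobj F (x \<otimes>\<^bsub>M\<^esub> y \<otimes>\<^bsub>M\<^esub> z)"] fmult_hom ten_arr_closed ident_closed) simp_all
    finally have "?k \<cdot> ident N ?X = ?k \<cdot> ?\<Phi>"
      using xyz fmult_hom[of y z] fmult_hom[of x "y \<otimes>\<^bsub>M\<^esub> z"]
      by (subst comp_ident(1)) (auto simp: hom_def)
    moreover have "?k \<in> isos N ?X (fobj F (x \<otimes>\<^bsub>M\<^esub> y \<otimes>\<^bsub>M\<^esub> z))"
      by (rule fmult_fmult_iso[OF xyz])
    ultimately show "?\<Phi> = ident N ?X"
      using \<Phi> xyz iso_cancel[of ?k ?X "fobj F (x \<otimes>\<^bsub>M\<^esub> y \<otimes>\<^bsub>M\<^esub> z)" ?\<Phi> ?X "ident N ?X"] by (simp add: ident_closed)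
  qed
qed

end

section \<open>Consequences of higher representability\<close>

locale representable_fibre_functor = fibre_functor N M F
  for N :: "('o, 'a) braided_moncat" (structure)
    and M :: "('p, 'q) moncat" and F :: "('p, 'q, 'o, 'a) mfctr" +
  fixes B :: 'o and \<rho> :: "'o \<Rightarrow> 'a \<Rightarrow> 'p \<Rightarrow> 'a"
  assumes B_closed [simp]: "B \<in> Obj N"
    and represents: "represents N M F B \<rho>"
    and higher: "v \<in> Obj N \<Longrightarrow> bij_betw (theta N M F B (\<rho> B (ident N B)) n)
      (hom N v (obj_power N B n))
      (nat_trans (power_cat M n) N (ten_fctr N v (tensor_power_fctr N F)) (tensor_power_fctr N F))"
begin

text \<open>The universal action. By naturality in \<open>v\<close> it determines the representation \<open>\<rho>\<close>.\<close>

definition \<sigma> :: "'p \<Rightarrow> 'a" where "\<sigma> = \<rho> B (ident N B)"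

abbreviation "mF \<equiv> modF \<sigma>"

lemma hom_Obj: "f \<in> hom N v w \<Longrightarrow> v \<in> Obj N" "f \<in> hom N v w \<Longrightarrow> w \<in> Obj N"
  by (auto simp: hom_def)

lemma \<rho>_eq:
  assumes "\<beta> \<in> hom N v B" "x \<in> Obj M"
  shows "\<rho> v \<beta> x = \<sigma> x \<cdot> (\<beta> \<star> ident N (fobj F x))"
  using represents assms hom_Obj[OF assms(1)] ident_closed[of B] comp_ident_left[OF assms(1)]
  unfolding represents_def \<sigma>_def by (metis B_closed)

lemma \<sigma>_nat: "\<sigma> \<in> nat_trans M N (ten_fctr N B F) F"
  using represents ident_closed[of B] unfolding represents_def \<sigma>_def
  by (auto dest!: bspec[of "Obj N" _ B] bij_betw_apply)

lemma mF_preaction: "x \<in> Obj M \<Longrightarrow> preaction B (mF x)"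
  using \<sigma>_nat by (auto simp: nat_trans_def ten_fctr_def preaction_def)

lemma \<sigma>_hom: "x \<in> Obj M \<Longrightarrow> \<sigma> x \<in> hom N (B \<otimes> fobj F x) (fobj F x)"
  using mF_preaction by (auto simp: preaction_def)

lemma mF_ident: "x \<in> Obj M \<Longrightarrow> equivariant B (mF x) (ident N (fobj F x)) (mF x)"
  using equivariant_ident[of B "mF x"] mF_preaction[of x] by simp

lemma \<sigma>_ident: "x \<in> Obj M \<Longrightarrow> \<sigma> x \<cdot> (ident N B \<star> ident N (fobj F x)) = \<sigma> x"
  using \<sigma>_hom[of x] by (simp add: ten_ident hom_def)

lemma M_hom: "f \<in> hom M x y \<Longrightarrow> f \<in> Mor M \<and> Dom M f = x \<and> Cod M f = y \<and> x \<in> Obj M \<and> y \<in> Obj M"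
  using F.C.Dom_closed F.C.Cod_closed by (auto simp: hom_def)

lemma mF_equivariant:
  assumes "f \<in> hom M x y"
  shows "equivariant B (mF x) (farr F f) (mF y)"
  using assms M_hom[OF assms] \<sigma>_nat F.farr_closed[OF assms] mF_preaction
  by (auto simp: nat_trans_def ten_fctr_def equivariant_def)

lemma faithful1:
  assumes "\<beta> \<in> hom N v B" "\<beta>' \<in> hom N v B"
    and "\<And>x. x \<in> Obj M \<Longrightarrow> \<sigma> x \<cdot> (\<beta> \<star> ident N (fobj F x)) = \<sigma> x \<cdot> (\<beta>' \<star> ident N (fobj F x))"
  shows "\<beta> = \<beta>'"
proof -
  have b: "bij_betw (\<rho> v) (hom N v B) (nat_trans M N (ten_fctr N v F) F)"
    using represents hom_Obj[OF assms(1)] by (simp add: represents_def)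
  then have "\<rho> v \<beta> \<in> extensional (Obj M)" "\<rho> v \<beta>' \<in> extensional (Obj M)"
    using bij_betw_apply[OF b] assms(1,2) by (auto simp: nat_trans_def)
  then have "\<rho> v \<beta> = \<rho> v \<beta>'"
    using assms \<rho>_eq by (auto intro: extensionalityI)
  then show ?thesis using b assms(1,2) by (auto simp: bij_betw_def inj_on_def)
qed

lemma full1:
  assumes "v \<in> Obj N" "\<And>x. x \<in> Obj M \<Longrightarrow> t x \<in> hom N (v \<otimes> fobj F x) (fobj F x)"
    and "\<And>f x y. f \<in> hom M x y \<Longrightarrow> equivariant v (modF t x) (farr F f) (modF t y)"
  obtains \<beta> where "\<beta> \<in> hom N v B" "\<And>x. x \<in> Obj M \<Longrightarrow> \<sigma> x \<cdot> (\<beta> \<star> ident N (fobj F x)) = t x"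
proof -
  have b: "bij_betw (\<rho> v) (hom N v B) (nat_trans M N (ten_fctr N v F) F)"
    using represents assms(1) by (simp add: represents_def)
  have "equivariant v (modF t (Dom M f)) (farr F f) (modF t (Cod M f))" if "f \<in> Mor M" for f
    using assms(3) that by (simp add: hom_def)
  then have "restrict t (Obj M) \<in> nat_trans M N (ten_fctr N v F) F"
    using assms(2) F.C.Dom_closed F.C.Cod_closed
    by (auto simp: nat_trans_def ten_fctr_def equivariant_def)
  then obtain \<beta> where "\<beta> \<in> hom N v B" "\<rho> v \<beta> = restrict t (Obj M)"
    using bij_betw_imp_surj_on[OF b] by (metis imageE)
  then show thesis using that \<rho>_eq by fastforce
qed

lemma faithful_n:
  assumes "\<beta> \<in> hom N v (obj_power N B n)" "\<beta>' \<in> hom N v (obj_power N B n)"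
    and "\<And>xs. \<lbrakk>length xs = n; set xs \<subseteq> Obj M\<rbrakk> \<Longrightarrow>
      diag_action N B (map mF xs) \<cdot> (\<beta> \<star> ident N (ten_objs N (map (fobj F) xs)))
      = diag_action N B (map mF xs) \<cdot> (\<beta>' \<star> ident N (ten_objs N (map (fobj F) xs)))"
  shows "\<beta> = \<beta>'"
proof -
  have "theta N M F B \<sigma> n \<beta> = theta N M F B \<sigma> n \<beta>'"
    using assms(3) unfolding theta_def power_cat_def modF_def by (auto intro!: restrict_ext)
  then show ?thesis
    using higher[of v n] hom_Obj[OF assms(1)] assms(1,2) by (auto simp: bij_betw_def inj_on_def \<sigma>_def)
qed

lemma faithful2:
  assumes "\<beta> \<in> hom N v (B \<otimes> B)" "\<beta>' \<in> hom N v (B \<otimes> B)"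
    and "\<And>x y. \<lbrakk>x \<in> Obj M; y \<in> Obj M\<rbrakk> \<Longrightarrow>
      diag_action N B [mF x, mF y] \<cdot> (\<beta> \<star> ident N (fobj F x \<otimes> fobj F y))
      = diag_action N B [mF x, mF y] \<cdot> (\<beta>' \<star> ident N (fobj F x \<otimes> fobj F y))"
  shows "\<beta> = \<beta>'"
proof (rule faithful_n[of _ v "Suc (Suc 0)"])
  fix xs assume "length xs = Suc (Suc 0)" "set xs \<subseteq> Obj M"
  then obtain x y where "xs = [x, y]" "x \<in> Obj M" "y \<in> Obj M" by (auto simp: length_Suc_conv)
  then show "diag_action N B (map mF xs) \<cdot> (\<beta> \<star> ident N (ten_objs N (map (fobj F) xs)))
      = diag_action N B (map mF xs) \<cdot> (\<beta>' \<star> ident N (ten_objs N (map (fobj F) xs)))"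
    using assms(3)[of x y] by simp
qed (use assms in simp_all)

lemma faithful3:
  assumes "\<beta> \<in> hom N v (B \<otimes> B \<otimes> B)" "\<beta>' \<in> hom N v (B \<otimes> B \<otimes> B)"
    and "\<And>x y z. \<lbrakk>x \<in> Obj M; y \<in> Obj M; z \<in> Obj M\<rbrakk> \<Longrightarrow>
      diag_action N B [mF x, mF y, mF z] \<cdot> (\<beta> \<star> ident N (fobj F x \<otimes> fobj F y \<otimes> fobj F z))
      = diag_action N B [mF x, mF y, mF z] \<cdot> (\<beta>' \<star> ident N (fobj F x \<otimes> fobj F y \<otimes> fobj F z))"
  shows "\<beta> = \<beta>'"
proof (rule faithful_n[of _ v "Suc (Suc (Suc 0))"])
  fix xs assume "length xs = Suc (Suc (Suc 0))" "set xs \<subseteq> Obj M"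
  then obtain x y z where "xs = [x, y, z]" "x \<in> Obj M" "y \<in> Obj M" "z \<in> Obj M"
    by (auto simp: length_Suc_conv)
  then show "diag_action N B (map mF xs) \<cdot> (\<beta> \<star> ident N (ten_objs N (map (fobj F) xs)))
      = diag_action N B (map mF xs) \<cdot> (\<beta>' \<star> ident N (ten_objs N (map (fobj F) xs)))"
    using assms(3)[of x y z] by simp
qed (use assms in simp_all)

text \<open>Naturality in the pair \<open>(x, y)\<close> is stated as equivariance; its instance at identities carries the typing of \<open>t\<close>.\<close>

lemma full2:
  assumes v: "v \<in> Obj N"
    and "\<And>f g x y x' y'. \<lbrakk>f \<in> hom M x x'; g \<in> hom M y y'\<rbrakk> \<Longrightarrow>
      equivariant v (fobj F x \<otimes> fobj F y, t x y) (farr F f \<star> farr F g) (fobj F x' \<otimes> fobj F y', t x' y')"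
  obtains \<beta> where "\<beta> \<in> hom N v (B \<otimes> B)"
    "\<And>x y. \<lbrakk>x \<in> Obj M; y \<in> Obj M\<rbrakk> \<Longrightarrow>
      diag_action N B [mF x, mF y] \<cdot> (\<beta> \<star> ident N (fobj F x \<otimes> fobj F y)) = t x y"
proof -
  let ?n = "Suc (Suc 0)"
  let ?T = "\<lambda>xs \<in> Obj (power_cat M ?n). t (hd xs) (hd (tl xs))"
  have Obj: "xs \<in> Obj (power_cat M ?n) \<longleftrightarrow> (\<exists>x y. xs = [x, y] \<and> x \<in> Obj M \<and> y \<in> Obj M)" for xs
    by (auto simp: power_cat_def length_Suc_conv)
  have Mor: "fs \<in> Mor (power_cat M ?n) \<longleftrightarrow> (\<exists>f g. fs = [f, g] \<and> f \<in> Mor M \<and> g \<in> Mor M)" for fs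
    by (auto simp: power_cat_def length_Suc_conv)
  have t: "t x y \<in> hom N (v \<otimes> fobj F x \<otimes> fobj F y) (fobj F x \<otimes> fobj F y)" if "x \<in> Obj M" "y \<in> Obj M" for x y
    using assms(2)[of "ident M x" x x "ident M y" y y] that F.C.ident_closed
    by (simp add: equivariant_def preaction_def)
  have eq: "equivariant v (fobj F (Dom M f) \<otimes> fobj F (Dom M g), t (Dom M f) (Dom M g)) (farr F f \<star> farr F g)
    (fobj F (Cod M f) \<otimes> fobj F (Cod M g), t (Cod M f) (Cod M g))" if "f \<in> Mor M" "g \<in> Mor M" for f g
    using assms(2) that by (simp add: hom_def)
  have F: "farr F f \<in> Mor N" if "f \<in> Mor M" for f
    using F.farr_closed[of f "Dom M f" "Cod M f"] that by (simp add: hom_def)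
  have "?T \<in> nat_trans (power_cat M ?n) N (ten_fctr N v (tensor_power_fctr N F)) (tensor_power_fctr N F)"
    unfolding nat_trans_def
  proof (intro CollectI conjI ballI)
    fix xs assume "xs \<in> Obj (power_cat M ?n)"
    then show "?T xs \<in> hom N (fobj (ten_fctr N v (tensor_power_fctr N F)) xs) (fobj (tensor_power_fctr N F) xs)"
      using t v unfolding Obj by (auto simp: Obj ten_fctr_def tensor_power_fctr_def)
  next
    fix fs assume "fs \<in> Mor (power_cat M ?n)"
    then obtain f g where fg: "fs = [f, g]" "f \<in> Mor M" "g \<in> Mor M" by (auto simp: Mor)
    then show "?T (Cod (power_cat M ?n) fs) \<cdot> farr (ten_fctr N v (tensor_power_fctr N F)) fs
      = farr (tensor_power_fctr N F) fs \<cdot> ?T (Dom (power_cat M ?n) fs)"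
      using eq[of f g] F F.C.Dom_closed F.C.Cod_closed
      by (auto simp: equivariant_def power_cat_def ten_fctr_def tensor_power_fctr_def)
  qed simp
  then have "?T \<in> theta N M F B \<sigma> ?n ` hom N v (B \<otimes> B)"
    using bij_betw_imp_surj_on[OF higher[OF v, of ?n], folded \<sigma>_def]
    by (simp only: obj_power.simps ten_obj_unit[OF B_closed])
  then obtain \<beta> where \<beta>: "?T = theta N M F B \<sigma> ?n \<beta>" "\<beta> \<in> hom N v (B \<otimes> B)"
    by (rule imageE)
  have "diag_action N B [mF x, mF y] \<cdot> (\<beta> \<star> ident N (fobj F x \<otimes> fobj F y)) = t x y"
    if "x \<in> Obj M" "y \<in> Obj M" for x y
    using fun_cong[OF \<beta>(1), of "[x, y]"] that by (auto simp: theta_def Obj modF_def)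
  then show thesis using that \<beta>(2) by blast
qed

section \<open>Existence of the structure arrows\<close>

lemma \<sigma>_comp:
  assumes "x \<in> Obj M" "f \<in> hom N u v" "g \<in> hom N v B"
  shows "\<sigma> x \<cdot> ((g \<cdot> f) \<star> ident N (fobj F x)) = (\<sigma> x \<cdot> (g \<star> ident N (fobj F x))) \<cdot> (f \<star> ident N (fobj F x))"
  using assms \<sigma>_hom[OF assms(1)] by (simp add: hom_def whisker_right)

text \<open>The double action is natural because \<open>\<sigma>\<close> is, so it is the action of an arrow from \<open>B \<otimes> B\<close>.\<close>

lemma mult_exists:
  obtains \<mu> where "\<mu> \<in> hom N (B \<otimes> B) B"
    "\<And>x. x \<in> Obj M \<Longrightarrow> \<sigma> x \<cdot> (\<mu> \<star> ident N (fobj F x)) = \<sigma> x \<cdot> (ident N B \<star> \<sigma> x)"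
proof (rule full1[of "B \<otimes> B" "\<lambda>x. \<sigma> x \<cdot> (ident N B \<star> \<sigma> x)"])
  fix x assume x: "x \<in> Obj M"
  show "\<sigma> x \<cdot> (ident N B \<star> \<sigma> x) \<in> hom N ((B \<otimes> B) \<otimes> fobj F x) (fobj F x)"
    using \<sigma>_hom[OF x] x by (simp add: hom_def)
next
  fix f x y assume f: "f \<in> hom M x y"
  then have xy: "x \<in> Obj M" "y \<in> Obj M" using M_hom by auto
  note ty = \<sigma>_hom[OF xy(1), unfolded hom_def, simplified] \<sigma>_hom[OF xy(2), unfolded hom_def, simplified]
    F.farr_closed[OF f, unfolded hom_def, simplified]
  have e: "farr F f \<cdot> \<sigma> x = \<sigma> y \<cdot> (ident N B \<star> farr F f)"
    using mF_equivariant[OF f] by (simp add: equivariant_def)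
  have "farr F f \<cdot> \<sigma> x \<cdot> (ident N B \<star> \<sigma> x) = (farr F f \<cdot> \<sigma> x) \<cdot> (ident N B \<star> \<sigma> x)"
    using ty xy by simp
  also have "\<dots> = \<sigma> y \<cdot> (ident N B \<star> (farr F f \<cdot> \<sigma> x))"
    unfolding e using ty xy whisker_left[of "\<sigma> x" "farr F f" B] by (simp add: e)
  also have "\<dots> = (\<sigma> y \<cdot> (ident N B \<star> \<sigma> y)) \<cdot> (ident N (B \<otimes> B) \<star> farr F f)"
    unfolding e using ty xy whisker_left[of "ident N B \<star> farr F f" "\<sigma> y" B] by (simp add: ident_ten)
  finally show "equivariant (B \<otimes> B) (modF (\<lambda>x. \<sigma> x \<cdot> (ident N B \<star> \<sigma> x)) x) (farr F f)
      (modF (\<lambda>x. \<sigma> x \<cdot> (ident N B \<star> \<sigma> x)) y)"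
    using ty xy by (simp add: equivariant_def preaction_def hom_def)
qed (auto intro: that)

lemma unit_exists:
  obtains \<eta> where "\<eta> \<in> hom N \<I> B" "\<And>x. x \<in> Obj M \<Longrightarrow> \<sigma> x \<cdot> (\<eta> \<star> ident N (fobj F x)) = ident N (fobj F x)"
proof (rule full1[of \<I> "\<lambda>x. ident N (fobj F x)"])
  fix f x y assume f: "f \<in> hom M x y"
  then have xy: "x \<in> Obj M" "y \<in> Obj M" using M_hom by auto
  then show "equivariant \<I> (modF (\<lambda>x. ident N (fobj F x)) x) (farr F f) (modF (\<lambda>x. ident N (fobj F x)) y)"
    using F.farr_closed[OF f] by (simp add: equivariant_def preaction_def hom_def)
qed (auto simp: ident_closed intro: that)

text \<open>The action of \<open>B\<close> on \<open>F (x \<otimes> y)\<close> is transported to \<open>F x \<otimes> F y\<close>. The result is natural since \<open>\<sigma>\<close> and the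
comparison arrows are, so it is the diagonal action restricted along an arrow \<open>B \<rightarrow> B \<otimes> B\<close>.\<close>

lemma comul_exists:
  obtains \<Delta> where "\<Delta> \<in> hom N B (B \<otimes> B)"
    "\<And>x y. \<lbrakk>x \<in> Obj M; y \<in> Obj M\<rbrakk> \<Longrightarrow> equivariant B
      (pull_mod N \<Delta> (fobj F x \<otimes> fobj F y, diag_action N B [mF x, mF y])) (fmult F x y) (mF (x \<otimes>\<^bsub>M\<^esub> y))"
proof -
  define t where "t x y = (SOME \<alpha>. equivariant B (fobj F x \<otimes> fobj F y, \<alpha>) (fmult F x y) (mF (x \<otimes>\<^bsub>M\<^esub> y)))" for x y
  have t: "equivariant B (fobj F x \<otimes> fobj F y, t x y) (fmult F x y) (mF (x \<otimes>\<^bsub>M\<^esub> y))"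
    if "x \<in> Obj M" "y \<in> Obj M" for x y
  proof -
    have "preaction B (mF (x \<otimes>\<^bsub>M\<^esub> y))" "fmult F x y \<in> isos N (fobj F x \<otimes> fobj F y) (fst (mF (x \<otimes>\<^bsub>M\<^esub> y)))"
      using that mF_preaction F.fmult_iso by simp_all
    then have "\<exists>\<alpha>. equivariant B (fobj F x \<otimes> fobj F y, \<alpha>) (fmult F x y) (mF (x \<otimes>\<^bsub>M\<^esub> y))"
      using transported_preaction[OF B_closed] by blast
    then show ?thesis unfolding t_def by (rule someI_ex)
  qed
  have nat: "equivariant B (fobj F x \<otimes> fobj F y, t x y) (farr F f \<star> farr F g) (fobj F x' \<otimes> fobj F y', t x' y')"
    if f: "f \<in> hom M x x'" and g: "g \<in> hom M y y'" for f g x y x' y'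
  proof -
    have xy: "x \<in> Obj M" "y \<in> Obj M" "x' \<in> Obj M" "y' \<in> Obj M" using M_hom f g by auto
    have "equivariant B (fobj F x \<otimes> fobj F y, t x y) (farr F (f \<star>\<^bsub>M\<^esub> g) \<cdot> fmult F x y) (mF (x' \<otimes>\<^bsub>M\<^esub> y'))"
      by (rule equivariant_comp[OF B_closed t[OF xy(1,2)] mF_equivariant[OF F.M.ten_arr_closed[OF f g]]])
    then show ?thesis
      using t[OF xy(3,4)] F.fmult_iso[OF xy(3,4)] F.fmult_natural[OF f g]
        ten_arr_closed[OF F.farr_closed[OF f] F.farr_closed[OF g]]
      by - (rule equivariant_cancel[of B _ "fmult F x' y'" _ "mF (x' \<otimes>\<^bsub>M\<^esub> y')"], simp_all)
  qed
  obtain \<Delta> where "\<Delta> \<in> hom N B (B \<otimes> B)" "\<And>x y. \<lbrakk>x \<in> Obj M; y \<in> Obj M\<rbrakk> \<Longrightarrow>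
      diag_action N B [mF x, mF y] \<cdot> (\<Delta> \<star> ident N (fobj F x \<otimes> fobj F y)) = t x y"
    by (rule full2[where t = t, OF B_closed nat]) (auto intro: that)
  then show thesis using that t by (simp add: pull_mod_def)
qed

text \<open>An action of \<open>B\<close> on the unit object is itself an arrow \<open>B \<rightarrow> \<I>\<close>.\<close>

lemma counit_exists:
  obtains \<epsilon> where "\<epsilon> \<in> hom N B \<I>" "equivariant B (\<I>, \<epsilon>) (funit F) (mF \<I>\<^bsub>M\<^esub>)"
proof -
  obtain \<epsilon> where "equivariant B (\<I>, \<epsilon>) (funit F) (mF \<I>\<^bsub>M\<^esub>)"
    using transported_preaction[of B "funit F" \<I> "mF \<I>\<^bsub>M\<^esub>"] F.funit_iso mF_preaction by auto
  moreover from this have "\<epsilon> \<in> hom N B \<I>" by (simp add: equivariant_def preaction_def)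
  ultimately show thesis using that by blast
qed

lemma lift_exists:
  obtains H where "car H = B" "alg_data H" "comul H \<in> hom N B (B \<otimes> B)" "counit H \<in> hom N B \<I>"
    "reassoc H = aunit H \<star> aunit H \<star> aunit H" "lifts H \<sigma>"
proof -
  obtain \<mu> where \<mu>: "\<mu> \<in> hom N (B \<otimes> B) B"
    "\<And>x. x \<in> Obj M \<Longrightarrow> \<sigma> x \<cdot> (\<mu> \<star> ident N (fobj F x)) = \<sigma> x \<cdot> (ident N B \<star> \<sigma> x)"
    using mult_exists by blast
  obtain \<eta> where \<eta>: "\<eta> \<in> hom N \<I> B"
    "\<And>x. x \<in> Obj M \<Longrightarrow> \<sigma> x \<cdot> (\<eta> \<star> ident N (fobj F x)) = ident N (fobj F x)"
    using unit_exists by blast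
  obtain \<Delta> where \<Delta>: "\<Delta> \<in> hom N B (B \<otimes> B)"
    "\<And>x y. \<lbrakk>x \<in> Obj M; y \<in> Obj M\<rbrakk> \<Longrightarrow> equivariant B
      (pull_mod N \<Delta> (fobj F x \<otimes> fobj F y, diag_action N B [mF x, mF y])) (fmult F x y) (mF (x \<otimes>\<^bsub>M\<^esub> y))"
    using comul_exists by blast
  obtain \<epsilon> where \<epsilon>: "\<epsilon> \<in> hom N B \<I>" "equivariant B (\<I>, \<epsilon>) (funit F) (mF \<I>\<^bsub>M\<^esub>)"
    using counit_exists by blast
  let ?H = "\<lparr>car = B, mlt = \<mu>, aunit = \<eta>, comul = \<Delta>, counit = \<epsilon>, reassoc = \<eta> \<star> \<eta> \<star> \<eta>\<rparr>"
  have "lifts ?H \<sigma>"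
    unfolding lifts_def using \<mu> \<eta> \<Delta> \<epsilon> \<sigma>_hom mF_equivariant
    by (simp add: is_module_def unit_mod_def ten_mod_def pull_mod_def)
  then show thesis
    using that[of ?H] \<mu> \<eta> \<Delta> \<epsilon> by (simp add: alg_data_def)
qed

end

section \<open>The reconstructed bialgebra\<close>

text \<open>The typing of the structure arrows and the lifting property already force the bialgebra axioms.\<close>

locale reconstructed = representable_fibre_functor N M F B \<rho>
  for N :: "('o, 'a) braided_moncat" (structure)
    and M :: "('p, 'q) moncat" and F :: "('p, 'q, 'o, 'a) mfctr"
    and B :: 'o and \<rho> :: "'o \<Rightarrow> 'a \<Rightarrow> 'p \<Rightarrow> 'a" +
  fixes H :: "('o, 'a) qbialg"
  assumes car [simp]: "car H = B" and alg_data: "alg_data H"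
    and comul: "comul H \<in> hom N B (B \<otimes> B)" and counit: "counit H \<in> hom N B \<I>"
    and reassoc: "reassoc H = aunit H \<star> aunit H \<star> aunit H"
    and lifts: "lifts H \<sigma>"
begin

lemma mF_module: "x \<in> Obj M \<Longrightarrow> is_module N H (mF x)"
  using lifts by (simp add: lifts_def)

lemma fmult_equivariant:
  "\<lbrakk>x \<in> Obj M; y \<in> Obj M\<rbrakk> \<Longrightarrow> equivariant B (ten_mod N H (mF x) (mF y)) (fmult F x y) (mF (x \<otimes>\<^bsub>M\<^esub> y))"
  using lifts by (simp add: lifts_def)

lemma funit_equivariant: "equivariant B (unit_mod N H) (funit F) (mF \<I>\<^bsub>M\<^esub>)"
  using lifts by (simp add: lifts_def)

lemma ten_equivariant:
  "\<lbrakk>equivariant B m f n; equivariant B m' g n'\<rbrakk>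
    \<Longrightarrow> equivariant B (ten_mod N H m m') (f \<star> g) (ten_mod N H n n')"
  using equivariant_ten[of H] comul by simp

text \<open>A product \<open>f \<cdot> g\<close> acts as \<open>f\<close> after \<open>g\<close>, so the axioms are those of composition, and actions are faithful.\<close>

lemma algebra: "is_algebra N H"
proof -
  note ty = alg_data[unfolded alg_data_def car]
  note ty' = ty[unfolded hom_def, simplified]
  have mu: "\<sigma> x \<cdot> (mlt H \<star> ident N (fobj F x)) = \<sigma> x \<cdot> (ident N B \<star> \<sigma> x)"
    and eta: "\<sigma> x \<cdot> (aunit H \<star> ident N (fobj F x)) = ident N (fobj F x)" if "x \<in> Obj M" for x
    using mF_module[OF that] by (simp_all add: is_module_def)
  have act: "\<sigma> x \<cdot> ((mlt H \<cdot> (f \<star> g)) \<star> ident N (fobj F x))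
    = (\<sigma> x \<cdot> (f \<star> ident N (fobj F x))) \<cdot> (ident N u \<star> (\<sigma> x \<cdot> (g \<star> ident N (fobj F x))))"
    if x: "x \<in> Obj M" and f: "f \<in> hom N u B" and g: "g \<in> hom N w B" for x f g u w
  proof -
    note t = f[unfolded hom_def, simplified] g[unfolded hom_def, simplified]
      \<sigma>_hom[OF x, unfolded hom_def, simplified]
    have ob: "u \<in> Obj N" "w \<in> Obj N" using t by auto
    have "\<sigma> x \<cdot> ((mlt H \<cdot> (f \<star> g)) \<star> ident N (fobj F x))
      = (\<sigma> x \<cdot> (mlt H \<star> ident N (fobj F x))) \<cdot> ((f \<star> g) \<star> ident N (fobj F x))"
      using t ty f g x by (intro \<sigma>_comp[of _ _ "u \<otimes> w" "B \<otimes> B"] ten_arr_closed) auto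
    also have "\<dots> = \<sigma> x \<cdot> ((ident N B \<star> \<sigma> x) \<cdot> (f \<star> (g \<star> ident N (fobj F x))))"
      using t x ob by (simp add: mu)
    also have "(ident N B \<star> \<sigma> x) \<cdot> (f \<star> (g \<star> ident N (fobj F x)))
      = (f \<star> ident N (fobj F x)) \<cdot> (ident N u \<star> (\<sigma> x \<cdot> (g \<star> ident N (fobj F x))))"
      using t x ob by (simp add: ten_comp)
    finally show ?thesis using t x ob by simp
  qed
  have "mlt H \<cdot> (mlt H \<star> ident N B) = mlt H \<cdot> (ident N B \<star> mlt H)"
  proof (rule faithful1)
    fix x assume x: "x \<in> Obj M"
    note t = \<sigma>_hom[OF x, unfolded hom_def, simplified]
    show "\<sigma> x \<cdot> ((mlt H \<cdot> (mlt H \<star> ident N B)) \<star> ident N (fobj F x))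
      = \<sigma> x \<cdot> ((mlt H \<cdot> (ident N B \<star> mlt H)) \<star> ident N (fobj F x))"
      using act[OF x, of "mlt H" "B \<otimes> B" "ident N B" B] act[OF x, of "ident N B" B "mlt H" "B \<otimes> B"]
        ty t x whisker_left[of "ident N B \<star> \<sigma> x" "\<sigma> x" B]
      by (simp add: mu \<sigma>_ident ident_closed ident_ten)
  qed (use ty' in \<open>auto simp: hom_def\<close>)
  moreover have "mlt H \<cdot> (aunit H \<star> ident N B) = ident N B"
  proof (rule faithful1)
    fix x assume x: "x \<in> Obj M"
    then show "\<sigma> x \<cdot> ((mlt H \<cdot> (aunit H \<star> ident N B)) \<star> ident N (fobj F x))
      = \<sigma> x \<cdot> (ident N B \<star> ident N (fobj F x))"
      using act[OF x, of "aunit H" \<I> "ident N B" B] ty \<sigma>_hom[OF x]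
      by (simp add: eta \<sigma>_ident ident_closed) (simp add: hom_def)
  qed (use ty' in \<open>auto simp: hom_def\<close>)
  moreover have "mlt H \<cdot> (ident N B \<star> aunit H) = ident N B"
  proof (rule faithful1)
    fix x assume x: "x \<in> Obj M"
    then show "\<sigma> x \<cdot> ((mlt H \<cdot> (ident N B \<star> aunit H)) \<star> ident N (fobj F x))
      = \<sigma> x \<cdot> (ident N B \<star> ident N (fobj F x))"
      using act[OF x, of "ident N B" B "aunit H" \<I>] ty \<sigma>_hom[OF x]
      by (simp add: eta \<sigma>_ident ident_closed)
  qed (use ty' in \<open>auto simp: hom_def\<close>)
  ultimately show ?thesis using ty by (simp add: is_algebra_def)
qed

lemma diag_action_mF: "\<lbrakk>x \<in> Obj M; y \<in> Obj M\<rbrakk> \<Longrightarrow>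
    diag_action N B [mF x, mF y] = juxt B (fobj F x) (\<sigma> x) B (fobj F y) (\<sigma> y)"
  using diag_action_2[of B "mF x" "mF y"] mF_preaction by simp

lemma diag_action_mF_module: "\<lbrakk>x \<in> Obj M; y \<in> Obj M\<rbrakk> \<Longrightarrow>
    is_module N (alg_tensor N H H) (fobj F x \<otimes> fobj F y, diag_action N B [mF x, mF y])"
  using juxt_module[OF alg_data alg_data mF_module mF_module, of x y] by (simp add: diag_action_mF)

lemma ten_mod_mF: "\<lbrakk>x \<in> Obj M; y \<in> Obj M\<rbrakk> \<Longrightarrow>
    ten_mod N H (mF x) (mF y) = pull_mod N (comul H) (fobj F x \<otimes> fobj F y, diag_action N B [mF x, mF y])"
  by (simp add: ten_mod_def pull_mod_def)

text \<open>\<open>F x \<otimes> F y\<close> is a module because it is equivariantly isomorphic to \<open>F (x \<otimes> y)\<close>. Its action is the pullback along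
\<open>\<Delta>\<close> of a module over \<open>B \<otimes> B\<close>, and these modules are jointly faithful.\<close>

lemma comul_alg_morphism: "alg_morphism N H (alg_tensor N H H) (comul H)"
proof -
  note ty = alg_data[unfolded alg_data_def car hom_def, simplified] comul[unfolded hom_def, simplified]
  have T: "alg_data (alg_tensor N H H)" "car (alg_tensor N H H) = B \<otimes> B"
    using alg_data_alg_tensor[OF alg_data alg_data] by (simp_all add: alg_tensor_def)
  note tyT = T(1)[unfolded alg_data_def T(2) hom_def, simplified]
  have *: "diag_action N B [mF x, mF y] \<cdot> ((comul H \<cdot> mlt H) \<star> ident N (fobj F x \<otimes> fobj F y))
      = diag_action N B [mF x, mF y] \<cdot> ((mlt (alg_tensor N H H) \<cdot> (comul H \<star> comul H)) \<star> ident N (fobj F x \<otimes> fobj F y))"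
    "diag_action N B [mF x, mF y] \<cdot> ((comul H \<cdot> aunit H) \<star> ident N (fobj F x \<otimes> fobj F y))
      = diag_action N B [mF x, mF y] \<cdot> (aunit (alg_tensor N H H) \<star> ident N (fobj F x \<otimes> fobj F y))"
    if xy: "x \<in> Obj M" "y \<in> Obj M" for x y
  proof -
    have "is_module N H (ten_mod N H (mF x) (mF y))"
      using xy fmult_equivariant F.fmult_iso[OF xy]
      by (intro module_transport[OF alg_data mF_module[of "x \<otimes>\<^bsub>M\<^esub> y"]]) auto
    then show "diag_action N B [mF x, mF y] \<cdot> ((comul H \<cdot> mlt H) \<star> ident N (fobj F x \<otimes> fobj F y))
      = diag_action N B [mF x, mF y] \<cdot> ((mlt (alg_tensor N H H) \<cdot> (comul H \<star> comul H)) \<star> ident N (fobj F x \<otimes> fobj F y))"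
    "diag_action N B [mF x, mF y] \<cdot> ((comul H \<cdot> aunit H) \<star> ident N (fobj F x \<otimes> fobj F y))
      = diag_action N B [mF x, mF y] \<cdot> (aunit (alg_tensor N H H) \<star> ident N (fobj F x \<otimes> fobj F y))"
      using pull_mod_module_iff[OF alg_data T(1) diag_action_mF_module[OF xy], of "comul H"] comul
      by (simp_all add: ten_mod_mF xy T(2))
  qed
  have "comul H \<cdot> mlt H = mlt (alg_tensor N H H) \<cdot> (comul H \<star> comul H)"
    using ty tyT by - (rule faithful2[of _ "B \<otimes> B"], auto simp: hom_def *(1))
  moreover have "comul H \<cdot> aunit H = aunit (alg_tensor N H H)"
    using ty tyT by - (rule faithful2[of _ \<I>], auto simp: hom_def *(2))
  ultimately show ?thesis using comul T by (simp add: alg_morphism_def)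
qed

text \<open>The unit object with the action \<open>\<epsilon>\<close> is a module because it is equivariantly isomorphic to \<open>F \<I>\<close>.\<close>

lemma counit_alg_morphism: "alg_morphism N H (unit_alg N) (counit H)"
proof -
  note ty = alg_data[unfolded alg_data_def car hom_def, simplified] counit[unfolded hom_def, simplified]
  have "is_module N H (unit_mod N H)"
    using funit_equivariant F.funit_iso
    by (intro module_transport[OF alg_data mF_module[of "\<I>\<^bsub>M\<^esub>"]]) (auto simp: unit_mod_def)
  moreover have "unit_mod N H = pull_mod N (counit H) (\<I>, ident N \<I>)"
    using ty by (simp add: unit_mod_def pull_mod_def)
  ultimately show ?thesis
    using pull_mod_module_iff[OF alg_data alg_data_unit_alg regular_unit_module, of "counit H"] ty
    by (simp add: alg_morphism_def unit_alg_def hom_def)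
qed

text \<open>The two iterated coproducts act on the two bracketings of \<open>F x \<otimes> F y \<otimes> F z\<close>. Each is carried equivariantly to
\<open>F (x \<otimes> (y \<otimes> z))\<close> by an iterated comparison arrow, the left one followed by \<open>F\<close> of the associator, and
coherence of \<open>F\<close> says that these arrows are equal.\<close>

lemma coassociative: "(ident N B \<star> comul H) \<cdot> comul H = (comul H \<star> ident N B) \<cdot> comul H"
proof (rule faithful3)
  show "(ident N B \<star> comul H) \<cdot> comul H \<in> hom N B (B \<otimes> B \<otimes> B)"
    "(comul H \<star> ident N B) \<cdot> comul H \<in> hom N B (B \<otimes> B \<otimes> B)"
    using comul by (auto simp: hom_def)
  fix x y z assume xyz: "x \<in> Obj M" "y \<in> Obj M" "z \<in> Obj M"
  let ?X = "fobj F x \<otimes> fobj F y \<otimes> fobj F z"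
  let ?k = "fmult F x (y \<otimes>\<^bsub>M\<^esub> z) \<cdot> (ident N (fobj F x) \<star> fmult F y z)"
  have k: "?k \<in> isos N ?X (fobj F (x \<otimes>\<^bsub>M\<^esub> y \<otimes>\<^bsub>M\<^esub> z))"
    by (rule fmult_fmult_iso[OF xyz])
  have a: "assoc M x y z \<in> hom M ((x \<otimes>\<^bsub>M\<^esub> y) \<otimes>\<^bsub>M\<^esub> z) (x \<otimes>\<^bsub>M\<^esub> y \<otimes>\<^bsub>M\<^esub> z)"
    using F.M.assoc_iso[OF xyz] by (simp add: isos_def)
  have right: "equivariant B (ten_mod N H (mF x) (ten_mod N H (mF y) (mF z))) ?k (mF (x \<otimes>\<^bsub>M\<^esub> y \<otimes>\<^bsub>M\<^esub> z))"
    using xyz by (intro equivariant_comp[OF B_closed _ fmult_equivariant] ten_equivariant mF_ident fmult_equivariant) auto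
  have "equivariant B (ten_mod N H (ten_mod N H (mF x) (mF y)) (mF z))
     (farr F (assoc M x y z) \<cdot> fmult F (x \<otimes>\<^bsub>M\<^esub> y) z \<cdot> (fmult F x y \<star> ident N (fobj F z)))
     (mF (x \<otimes>\<^bsub>M\<^esub> y \<otimes>\<^bsub>M\<^esub> z))"
    using xyz by (intro equivariant_comp[OF B_closed _ mF_equivariant[OF a]]
      equivariant_comp[OF B_closed _ fmult_equivariant] ten_equivariant mF_ident fmult_equivariant) auto
  then have left: "equivariant B (ten_mod N H (ten_mod N H (mF x) (mF y)) (mF z)) ?k (mF (x \<otimes>\<^bsub>M\<^esub> y \<otimes>\<^bsub>M\<^esub> z))"
    using fmult_associative[OF xyz] by simp
  have "ten_mod N H (mF x) (ten_mod N H (mF y) (mF z)) = ten_mod N H (ten_mod N H (mF x) (mF y)) (mF z)"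
    by (rule equivariant_source_unique[OF right left]) (use k in simp)
  then show "diag_action N B [mF x, mF y, mF z] \<cdot> (((ident N B \<star> comul H) \<cdot> comul H) \<star> ident N ?X)
    = diag_action N B [mF x, mF y, mF z] \<cdot> (((comul H \<star> ident N B) \<cdot> comul H) \<star> ident N ?X)"
    using comul xyz ten_mod_left[of H "mF x" "mF y" "mF z"]
      ten_mod_right[of H "mF x" "mF y" "mF z"] mF_preaction by simp
qed

text \<open>The unit laws of \<open>F\<close> show that the identity of \<open>F x\<close> is equivariant from \<open>\<I> \<otimes> F x\<close> and from \<open>F x \<otimes> \<I>\<close>, so the
unit module is a strict unit for these modules.\<close>

lemma counital:
  "(counit H \<star> ident N B) \<cdot> comul H = ident N B" "(ident N B \<star> counit H) \<cdot> comul H = ident N B"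
proof -
  have *: "ten_mod N H (unit_mod N H) (mF x) = mF x" "ten_mod N H (mF x) (unit_mod N H) = mF x"
    if x: "x \<in> Obj M" for x
  proof -
    have l: "lunit M x \<in> hom M (\<I>\<^bsub>M\<^esub> \<otimes>\<^bsub>M\<^esub> x) x" and r: "runit M x \<in> hom M (x \<otimes>\<^bsub>M\<^esub> \<I>\<^bsub>M\<^esub>) x"
      using F.M.lunit_iso[OF x] F.M.runit_iso[OF x] by (simp_all add: isos_def)
    have "equivariant B (ten_mod N H (unit_mod N H) (mF x))
      (farr F (lunit M x) \<cdot> fmult F \<I>\<^bsub>M\<^esub> x \<cdot> (funit F \<star> ident N (fobj F x))) (mF x)"
      using x by (intro equivariant_comp[OF B_closed _ mF_equivariant[OF l]]
        equivariant_comp[OF B_closed _ fmult_equivariant] ten_equivariant mF_ident funit_equivariant) auto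
    moreover have "equivariant B (ten_mod N H (mF x) (unit_mod N H))
      (farr F (runit M x) \<cdot> fmult F x \<I>\<^bsub>M\<^esub> \<cdot> (ident N (fobj F x) \<star> funit F)) (mF x)"
      using x by (intro equivariant_comp[OF B_closed _ mF_equivariant[OF r]]
        equivariant_comp[OF B_closed _ fmult_equivariant] ten_equivariant mF_ident funit_equivariant) auto
    ultimately have "equivariant B (ten_mod N H (unit_mod N H) (mF x)) (ident N (fobj F x)) (mF x)"
      "equivariant B (ten_mod N H (mF x) (unit_mod N H)) (ident N (fobj F x)) (mF x)"
      using F.fmult_lunit[OF x] F.fmult_runit[OF x] x by (simp_all add: lunit_strict runit_strict)
    then show "ten_mod N H (unit_mod N H) (mF x) = mF x" "ten_mod N H (mF x) (unit_mod N H) = mF x"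
      using equivariant_source_unique[OF mF_ident[OF x], symmetric] x ident_in_isos[of "fobj F x"]
      by simp_all
  qed
  show "(counit H \<star> ident N B) \<cdot> comul H = ident N B"
  proof (rule faithful1)
    fix x assume x: "x \<in> Obj M"
    then show "\<sigma> x \<cdot> (((counit H \<star> ident N B) \<cdot> comul H) \<star> ident N (fobj F x))
      = \<sigma> x \<cdot> (ident N B \<star> ident N (fobj F x))"
      using ten_mod_unit(1)[of H "mF x"] *(1) comul counit mF_preaction by (simp add: \<sigma>_ident pull_mod_def prod_eq_iff)
  qed (use comul counit in \<open>auto simp: hom_def\<close>)
  show "(ident N B \<star> counit H) \<cdot> comul H = ident N B"
  proof (rule faithful1)
    fix x assume x: "x \<in> Obj M"
    then show "\<sigma> x \<cdot> (((ident N B \<star> counit H) \<cdot> comul H) \<star> ident N (fobj F x))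
      = \<sigma> x \<cdot> (ident N B \<star> ident N (fobj F x))"
      using ten_mod_unit(2)[of H "mF x"] *(2) comul counit mF_preaction by (simp add: \<sigma>_ident pull_mod_def prod_eq_iff)
  qed (use comul counit in \<open>auto simp: hom_def\<close>)
qed

theorem bialgebra_H: "bialgebra H"
  using algebra comul_alg_morphism counit_alg_morphism coassociative counital reassoc
  by (simp add: bialgebra_def)

section \<open>The universal property\<close>

context
  fixes H' and \<tau>
  assumes quasi: "quasi_bialgebra N H'" and lifts': "lifts H' \<tau>"
    and trivial: "\<And>x y z. \<lbrakk>x \<in> Obj M; y \<in> Obj M; z \<in> Obj M\<rbrakk> \<Longrightarrow>
      diag_action N (car H') [modF \<tau> x, modF \<tau> y, modF \<tau> z]
        \<cdot> (reassoc H' \<star> ident N (fobj F x \<otimes> fobj F y \<otimes> fobj F z))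
      = ident N (fobj F x \<otimes> fobj F y \<otimes> fobj F z)"
begin

lemma quasi_typing:
  "alg_data H'" "car H' \<in> Obj N" "comul H' \<in> hom N (car H') (car H' \<otimes> car H')"
  "counit H' \<in> hom N (car H') \<I>" "reassoc H' \<in> hom N \<I> (car H' \<otimes> car H' \<otimes> car H')"
proof -
  show "alg_data H'" "comul H' \<in> hom N (car H') (car H' \<otimes> car H')" "counit H' \<in> hom N (car H') \<I>"
    and c: "car H' \<in> Obj N"
    using quasi by (auto simp: quasi_bialgebra_def Let_def is_algebra_def alg_data_def alg_morphism_def
        alg_tensor_def unit_alg_def)
  have "car (alg_power N H' 3) = car H' \<otimes> car H' \<otimes> car H'"
    using c by (simp add: eval_nat_numeral alg_tensor_def unit_alg_def)
  then show "reassoc H' \<in> hom N \<I> (car H' \<otimes> car H' \<otimes> car H')"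
    using quasi by (simp add: quasi_bialgebra_def Let_def invertible_element_def)
qed

text \<open>An action of \<open>H'\<close> on \<open>F\<close> is a natural transformation \<open>H' \<otimes> F \<rightarrow> F\<close>, which representability turns into an arrow
to \<open>B\<close>.\<close>

lemma comparison_exists:
  obtains f where "f \<in> hom N (car H') B" "\<And>x. x \<in> Obj M \<Longrightarrow> pull_mod N f (mF x) = modF \<tau> x"
proof -
  have "\<tau> x \<in> hom N (car H' \<otimes> fobj F x) (fobj F x)" if "x \<in> Obj M" for x
    using lifts' that by (simp add: lifts_def is_module_def)
  moreover have "equivariant (car H') (modF \<tau> x) (farr F f) (modF \<tau> y)" if "f \<in> hom M x y" for f x y
    using lifts' that by (simp add: lifts_def)
  ultimately obtain f where "f \<in> hom N (car H') B"
    "\<And>x. x \<in> Obj M \<Longrightarrow> \<sigma> x \<cdot> (f \<star> ident N (fobj F x)) = \<tau> x"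
    by (rule full1[OF quasi_typing(2)]) (auto intro: that)
  then show thesis using that by (simp add: pull_mod_def modF_def)
qed

context
  fixes f
  assumes f: "f \<in> hom N (car H') B" and pull: "\<And>x. x \<in> Obj M \<Longrightarrow> pull_mod N f (mF x) = modF \<tau> x"
begin

lemma \<tau>_eq: "x \<in> Obj M \<Longrightarrow> \<tau> x = \<sigma> x \<cdot> (f \<star> ident N (fobj F x))"
  using pull[of x] by (simp add: pull_mod_def modF_def)

lemma \<tau>_preaction: "x \<in> Obj M \<Longrightarrow> preaction (car H') (modF \<tau> x)"
  using lifts' by (simp add: lifts_def preaction_if_module)

text \<open>The modules \<open>F x\<close> of \<open>B\<close> pull back along \<open>f\<close> to modules of \<open>H'\<close>, and they are jointly faithful.\<close>

lemma comparison_alg_morphism: "alg_morphism N H' H f"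
proof -
  have *: "\<sigma> x \<cdot> ((f \<cdot> mlt H') \<star> ident N (fobj F x)) = \<sigma> x \<cdot> ((mlt H \<cdot> (f \<star> f)) \<star> ident N (fobj F x))"
    "\<sigma> x \<cdot> ((f \<cdot> aunit H') \<star> ident N (fobj F x)) = \<sigma> x \<cdot> (aunit H \<star> ident N (fobj F x))"
    if x: "x \<in> Obj M" for x
    using pull_mod_module_iff[OF quasi_typing(1) alg_data mF_module[OF x], of f] f pull[OF x] lifts' x
    by (simp_all add: lifts_def)
  note ty = f[unfolded hom_def, simplified] quasi_typing(1)[unfolded alg_data_def hom_def, simplified]
    alg_data[unfolded alg_data_def hom_def car, simplified]
  have "f \<cdot> mlt H' = mlt H \<cdot> (f \<star> f)"
    using ty by - (rule faithful1[of _ "car H' \<otimes> car H'"], auto simp: hom_def *(1))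
  moreover have "f \<cdot> aunit H' = aunit H"
    using ty by - (rule faithful1[of _ \<I>], auto simp: hom_def *(2))
  ultimately show ?thesis using f by (simp add: alg_morphism_def)
qed

text \<open>Both sides, through the diagonal action, give the action of \<open>H'\<close> on \<open>F x \<otimes> F y\<close> for which the comparison arrow
to \<open>F (x \<otimes> y)\<close> is equivariant.\<close>

lemma comparison_comul: "(f \<star> f) \<cdot> comul H' = comul H \<cdot> f"
proof (rule faithful2)
  note ty = f[unfolded hom_def, simplified] comul[unfolded hom_def, simplified]
    quasi_typing(3)[unfolded hom_def, simplified] quasi_typing(2)
  show "(f \<star> f) \<cdot> comul H' \<in> hom N (car H') (B \<otimes> B)" "comul H \<cdot> f \<in> hom N (car H') (B \<otimes> B)"
    using ty by (auto simp: hom_def)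
  fix x y assume xy: "x \<in> Obj M" "y \<in> Obj M"
  let ?X = "fobj F x \<otimes> fobj F y" and ?D = "diag_action N B [mF x, mF y]"
  have D: "?D \<in> Mor N" "Dom N ?D = B \<otimes> B \<otimes> ?X" "Cod N ?D = ?X"
    using diag_action_closed[of B "[mF x, mF y]"] mF_preaction xy by (simp_all add: hom_def)
  have "diag_action N (car H') [modF \<tau> x, modF \<tau> y] = ?D \<cdot> ((f \<star> f) \<star> ident N ?X)"
    using xy f \<sigma>_hom juxt_precomp[of "fobj F x" "fobj F y" "\<sigma> x" B "fobj F x" "\<sigma> y" B "fobj F y" f "car H'" f "car H'"]
    by (simp add: diag_action_2 \<tau>_preaction quasi_typing(2) diag_action_mF \<tau>_eq)
  then have 1: "ten_mod N H' (modF \<tau> x) (modF \<tau> y) = pull_mod N ((f \<star> f) \<cdot> comul H') (?X, ?D)"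
    using ty D xy by (simp add: ten_mod_def pull_mod_def whisker_right)
  have 2: "pull_mod N f (ten_mod N H (mF x) (mF y)) = pull_mod N (comul H \<cdot> f) (?X, ?D)"
    using ty D xy by (simp add: ten_mod_def pull_mod_def whisker_right)
  have "equivariant (car H') (ten_mod N H' (modF \<tau> x) (modF \<tau> y)) (fmult F x y) (modF \<tau> (x \<otimes>\<^bsub>M\<^esub> y))"
    using lifts' xy by (simp add: lifts_def)
  moreover have "equivariant (car H') (pull_mod N f (ten_mod N H (mF x) (mF y))) (fmult F x y) (modF \<tau> (x \<otimes>\<^bsub>M\<^esub> y))"
    using equivariant_pull[OF fmult_equivariant[OF xy] f] pull[of "x \<otimes>\<^bsub>M\<^esub> y"] xy by simp
  ultimately have "ten_mod N H' (modF \<tau> x) (modF \<tau> y) = pull_mod N f (ten_mod N H (mF x) (mF y))"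
    by (rule equivariant_source_unique) (use F.fmult_iso[OF xy] in simp)
  then show "?D \<cdot> (((f \<star> f) \<cdot> comul H') \<star> ident N ?X) = ?D \<cdot> ((comul H \<cdot> f) \<star> ident N ?X)"
    unfolding 1 2 pull_eq_iff by simp
qed

lemma comparison_unit_mod: "pull_mod N f (unit_mod N H) = unit_mod N H'"
proof (rule equivariant_source_unique)
  show "equivariant (car H') (pull_mod N f (unit_mod N H)) (funit F) (modF \<tau> \<I>\<^bsub>M\<^esub>)"
    using equivariant_pull[OF funit_equivariant f] pull[of "\<I>\<^bsub>M\<^esub>"] by simp
  show "equivariant (car H') (unit_mod N H') (funit F) (modF \<tau> \<I>\<^bsub>M\<^esub>)"
    using lifts' by (simp add: lifts_def)
  show "funit F \<in> isos N (fst (pull_mod N f (unit_mod N H))) (fst (modF \<tau> \<I>\<^bsub>M\<^esub>))"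
    using F.funit_iso by (simp add: pull_mod_def unit_mod_def)
qed

lemma comparison_counit: "counit H \<cdot> f = counit H'"
  using comparison_unit_mod f by (simp add: pull_mod_def unit_mod_def hom_def)

text \<open>Both sides act as the identity: the left one because \<open>H'\<close> carries a coherent lift of \<open>F\<close>, the right one because
it consists of units.\<close>

lemma comparison_reassoc: "(f \<star> f \<star> f) \<cdot> reassoc H' = reassoc H"
proof (rule faithful3)
  note ty = f[unfolded hom_def, simplified] quasi_typing(2)
    quasi_typing(5)[unfolded hom_def, simplified] alg_data[unfolded alg_data_def hom_def car, simplified]
  show "(f \<star> f \<star> f) \<cdot> reassoc H' \<in> hom N \<I> (B \<otimes> B \<otimes> B)" "reassoc H \<in> hom N \<I> (B \<otimes> B \<otimes> B)"
    using ty by (auto simp: hom_def reassoc)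
  fix x y z assume xyz: "x \<in> Obj M" "y \<in> Obj M" "z \<in> Obj M"
  let ?X = "fobj F x \<otimes> fobj F y \<otimes> fobj F z" and ?D = "diag_action N B [mF x, mF y, mF z]"
  have D: "?D \<in> Mor N" "Dom N ?D = B \<otimes> B \<otimes> B \<otimes> ?X" "Cod N ?D = ?X"
    using diag_action_closed[of B "[mF x, mF y, mF z]"] mF_preaction xyz by (simp_all add: hom_def)
  have "diag_action N (car H') [modF \<tau> x, modF \<tau> y, modF \<tau> z] = ?D \<cdot> ((f \<star> f \<star> f) \<star> ident N ?X)"
    using xyz f \<sigma>_hom juxt_precomp3[of "fobj F x" "fobj F y" "fobj F z" "\<sigma> x" B "fobj F x" "\<sigma> y" B "fobj F y"
      "\<sigma> z" B "fobj F z" f "car H'" f "car H'" f "car H'"]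
    by (simp add: diag_action_3 \<tau>_preaction mF_preaction quasi_typing(2) \<tau>_eq)
  then have "?D \<cdot> (((f \<star> f \<star> f) \<cdot> reassoc H') \<star> ident N ?X) = ident N ?X"
    using trivial[OF xyz] ty D xyz by (simp add: whisker_right)
  also have "\<dots> = ?D \<cdot> (reassoc H \<star> ident N ?X)"
    using units_act_trivially[OF alg_data mF_module mF_module mF_module] xyz by (simp add: reassoc)
  finally show "?D \<cdot> (((f \<star> f \<star> f) \<cdot> reassoc H') \<star> ident N ?X) = ?D \<cdot> (reassoc H \<star> ident N ?X)" .
qed

lemma comparison_qb_morphism: "qb_morphism N H' H f"
  using comparison_alg_morphism comparison_comul comparison_counit comparison_reassoc
  by (simp add: qb_morphism_def)

lemma comparison_pullback:
  "mfctr_eq M (mfctr_comp (Mod N H') (pullback N H' f) (lifted_fctr H \<sigma>)) (lifted_fctr H' \<tau>)"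
  using pull comparison_unit_mod fmult_hom funit_hom F.C.Dom_closed F.C.Cod_closed
  by (auto simp: mfctr_eq_def mfctr_comp_def pullback_def lifted_fctr_def hom_def unit_mod_def)

end
end

lemma pullback_forget:
  "mfctr_eq (Mod N H) (mfctr_comp N (forget N) (pullback N H' f)) (forget N)"
  by (auto simp: mfctr_eq_def mfctr_comp_def pullback_def forget_def pull_mod_def is_module_def unit_mod_def)

theorem universal: "universal_factorization N M F H (lifted_fctr H \<sigma>)"
  unfolding universal_factorization_def
proof (intro conjI allI impI)
  show "factorization N M F H (lifted_fctr H \<sigma>)"
    using bialgebra_H lifts by (rule factorization_lifted_fctr)
  fix H' G' assume fac: "factorization N M F H' G'"
  then have quasi: "quasi_bialgebra N H'" by (simp add: factorization_def)
  obtain \<tau> where \<tau>: "lifts H' \<tau>" "mfctr_eq M G' (lifted_fctr H' \<tau>)"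
    "\<And>x y z. \<lbrakk>x \<in> Obj M; y \<in> Obj M; z \<in> Obj M\<rbrakk> \<Longrightarrow>
      diag_action N (car H') [modF \<tau> x, modF \<tau> y, modF \<tau> z]
        \<cdot> (reassoc H' \<star> ident N (fobj F x \<otimes> fobj F y \<otimes> fobj F z))
      = ident N (fobj F x \<otimes> fobj F y \<otimes> fobj F z)"
    using factorizationE[OF fac] by blast
  obtain f where f: "f \<in> hom N (car H') B" "\<And>x. x \<in> Obj M \<Longrightarrow> pull_mod N f (mF x) = modF \<tau> x"
    using comparison_exists[OF quasi \<tau>(1,3)] by blast
  show "\<exists>!f. qb_morphism N H' H f \<and>
      mfctr_eq M (mfctr_comp (Mod N H') (pullback N H' f) (lifted_fctr H \<sigma>)) G' \<and>
      mfctr_eq (Mod N H) (mfctr_comp N (forget N) (pullback N H' f)) (forget N)"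
  proof (rule ex1I[of _ f], intro conjI)
    show "qb_morphism N H' H f"
      by (rule comparison_qb_morphism[OF quasi \<tau>(1,3) f])
    show "mfctr_eq M (mfctr_comp (Mod N H') (pullback N H' f) (lifted_fctr H \<sigma>)) G'"
      using comparison_pullback[OF quasi \<tau>(1,3) f] \<tau>(2) by (simp add: mfctr_eq_def)
    show "mfctr_eq (Mod N H) (mfctr_comp N (forget N) (pullback N H' f)) (forget N)"
      by (rule pullback_forget)
  next
    fix g assume g: "qb_morphism N H' H g \<and>
      mfctr_eq M (mfctr_comp (Mod N H') (pullback N H' g) (lifted_fctr H \<sigma>)) G' \<and>
      mfctr_eq (Mod N H) (mfctr_comp N (forget N) (pullback N H' g)) (forget N)"
    show "g = f"
    proof (rule faithful1)
      show "g \<in> hom N (car H') B" using g by (simp add: qb_morphism_def alg_morphism_def)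
      show "f \<in> hom N (car H') B" by fact
      fix x assume x: "x \<in> Obj M"
      then have "pull_mod N g (mF x) = pull_mod N f (mF x)"
        using g \<tau>(2) f(2) by (simp add: mfctr_eq_def mfctr_comp_def pullback_def lifted_fctr_def)
      then show "\<sigma> x \<cdot> (g \<star> ident N (fobj F x)) = \<sigma> x \<cdot> (f \<star> ident N (fobj F x))"
        by (simp add: pull_eq_iff)
    qed
  qed
qed

end

theorem theorem2p3p3:
  fixes N :: "('o, 'a) braided_moncat"
    and M :: "('p, 'q) moncat"
    and F :: "('p, 'q, 'o, 'a) mfctr"
    and B :: 'o
  assumes "strict_braided_category N"
    and "monoidal_category M"
    and "monoidal_functor M N F"
    and "B \<in> Obj N"
    and "higher_representable N M F B"
  shows "\<exists>H G. car H = B \<and> universal_factorization N M F H G"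
proof -
  obtain \<rho> where \<rho>: "represents N M F B \<rho>" "\<And>n v. v \<in> Obj N \<Longrightarrow>
      bij_betw (theta N M F B (\<rho> B (ident N B)) n) (hom N v (obj_power N B n))
        (nat_trans (power_cat M n) N (ten_fctr N v (tensor_power_fctr N F)) (tensor_power_fctr N F))"
    using assms(5) unfolding higher_representable_def by blast
  interpret representable_fibre_functor N M F B \<rho>
    by (intro representable_fibre_functor.intro fibre_functor.intro braided_base.intro
        representable_fibre_functor_axioms.intro assms \<rho>)
  obtain H where H: "car H = B" "alg_data H" "comul H \<in> hom N B (B \<otimes>\<^bsub>N\<^esub> B)" "counit H \<in> hom N B \<I>\<^bsub>N\<^esub>"
    "reassoc H = aunit H \<star>\<^bsub>N\<^esub> aunit H \<star>\<^bsub>N\<^esub> aunit H" "lifts H \<sigma>"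
    using lift_exists by blast
  interpret reconstructed N M F B \<rho> H
    by unfold_locales (fact H)+
  show ?thesis using H(1) universal by blast
qed

end
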